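(* Let $f=u\chi_\Omega$, where $\Omega\subset B=\{|\mathbf{x}|<1\}\subset\mathbb{R}^2$ is a compact domain with smooth boundary and $u=n_e>0$ is constant. Suppose that the set of $(s,\theta)$ such that $L(s,\theta)$ is tangent to $\partial\Omega$ on a disconnected set or at a single point with zero curvature is finite. Let $\varphi=\frac{1}{\epsilon^2}\chi_{B_\epsilon(0)}$ with $\epsilon>0$ small enough. Then $\mathcal{R}f$ determines $f$ uniquely.
   Context: Here $\chi_S$ is the characteristic function of a set $S$, and $B_\epsilon(0)$ is the disc of radius $\epsilon$ centred at the origin of $\mathbb{R}^2$. Fix $a,b>0$ and $2\psi\in(0,\pi)$. The V-line transform is $$\mathcal{V}_{a,b}f(\mathbf{x},\phi)=a\int_0^\infty f(\mathbf{x}+t\Phi)\,dt+b\int_0^\infty f(\mathbf{x}+t\Phi')\,dt,$$ with $\Phi=(\cos(\phi+2\psi-\pi/2),\sin(\phi+2\psi-\pi/2))$ and $\Phi'=(\cos(\phi-\pi/2),\sin(\phi-\pi/2))$. Its smoothed version with kernel $\varphi$ is $\widetilde{\mathcal{V}_{a,b}}f(\cdot,\phi)=\varphi*\mathcal{V}_{a,b}f(\cdot,\phi)$ (convolution in $\mathbf{x}$). For $s\in\mathbb{R}$ and an angle $\theta$ let $\Theta=(\cos\theta,\sin\theta)$ and $L(s,\theta)=\{\mathbf{x}\in\mathbb{R}^2:\mathbf{x}\cdot\Theta=s\}$. The non-linear transform (which depends on $\epsilon$ through $\varphi$) is $$\mathcal{R}f(s,\theta)=c_0\int_{L(s,\theta)}w(\mathbf{x})f(\mathbf{x})e^{-\widetilde{\mathcal{V}_{a,b}}f(\mathbf{x},\theta)}\,dl(\mathbf{x}),$$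 where $c_0>0$ is a constant, $w$ is a fixed smooth weight with $w>0$ on $B$, and $dl$ is arc length. The data $a,b,\psi,c_0,w$ are fixed and known. *)

theory Defs
  imports "HOL-Analysis.Analysis"
begin

type_synonym plane = "real^2"

text \<open>The sets \<open>S\<close> below are always open, so full derivatives \<open>at x\<close> are the right ones.\<close>

fun k_times_diff_on :: "nat \<Rightarrow> 'a::real_normed_vector set \<Rightarrow> ('a \<Rightarrow> 'b::real_normed_vector) \<Rightarrow> bool" where
  "k_times_diff_on 0 S f \<longleftrightarrow> continuous_on S f"
| "k_times_diff_on (Suc k) S f \<longleftrightarrow>
     (\<forall>x\<in>S. f differentiable (at x)) \<and>
     (\<forall>v. k_times_diff_on k S (\<lambda>x. frechet_derivative f (at x) v))"

definition smooth_on :: "'a::real_normed_vector set \<Rightarrow> ('a \<Rightarrow> 'b::real_normed_vector) \<Rightarrow> bool" where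
  "smooth_on S f \<longleftrightarrow> (\<forall>k. k_times_diff_on k S f)"

definition unit_dir :: "real \<Rightarrow> plane" where
  "unit_dir \<theta> = vector [cos \<theta>, sin \<theta>]"

definition Line :: "real \<Rightarrow> real \<Rightarrow> plane set" where
  "Line s \<theta> = {x. x \<bullet> unit_dir \<theta> = s}"

definition vline :: "real \<Rightarrow> real \<Rightarrow> real \<Rightarrow> (plane \<Rightarrow> real) \<Rightarrow> plane \<Rightarrow> real \<Rightarrow> real" where
  "vline a b \<psi> f x \<phi> =
     a * (LINT t:{0..}|lborel. f (x + t *\<^sub>R unit_dir (\<phi> + 2 * \<psi> - pi / 2))) +
     b * (LINT t:{0..}|lborel. f (x + t *\<^sub>R unit_dir (\<phi> - pi / 2)))"

definition convolve :: "(plane \<Rightarrow> real) \<Rightarrow> (plane \<Rightarrow> real) \<Rightarrow> plane \<Rightarrow> real" where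
  "convolve k g x = (LINT y|lborel. k y * g (x - y))"

definition smoothed_vline ::
  "(plane \<Rightarrow> real) \<Rightarrow> real \<Rightarrow> real \<Rightarrow> real \<Rightarrow> (plane \<Rightarrow> real) \<Rightarrow> plane \<Rightarrow> real \<Rightarrow> real" where
  "smoothed_vline k a b \<psi> f x \<phi> = convolve k (\<lambda>y. vline a b \<psi> f y \<phi>) x"

text \<open>The factor is \<open>1 / \<epsilon>\<^sup>2\<close>, so the kernel has total mass \<open>pi\<close> rather than 1.\<close>

definition disc_kernel :: "real \<Rightarrow> plane \<Rightarrow> real" where
  "disc_kernel \<epsilon> x = 1 / \<epsilon>\<^sup>2 * indicator (ball 0 \<epsilon>) x"

text \<open>Arc length integral over \<open>Line s \<theta>\<close>, via the unit speed parametrization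
  \<open>s \<Theta> + t \<Theta>\<^sup>\<bottom>\<close>, where \<open>\<Theta>\<^sup>\<bottom>\<close> is \<open>\<Theta>\<close> rotated by a right angle.\<close>

definition line_integral :: "real \<Rightarrow> real \<Rightarrow> (plane \<Rightarrow> real) \<Rightarrow> real" where
  "line_integral s \<theta> g = (LINT t|lborel. g (s *\<^sub>R unit_dir \<theta> + t *\<^sub>R unit_dir (\<theta> + pi / 2)))"

definition nonlinear_transform ::
  "(plane \<Rightarrow> real) \<Rightarrow> real \<Rightarrow> real \<Rightarrow> real \<Rightarrow> real \<Rightarrow> (plane \<Rightarrow> real) \<Rightarrow>
   (plane \<Rightarrow> real) \<Rightarrow> real \<Rightarrow> real \<Rightarrow> real" where
  "nonlinear_transform k a b \<psi> c0 w f s \<theta> =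
     c0 * line_integral s \<theta> (\<lambda>x. w x * f x * exp (- smoothed_vline k a b \<psi> f x \<theta>))"

text \<open>Near each boundary point, \<open>\<Omega>\<close> is a sublevel set of a smooth function with nonvanishing
  gradient; in particular \<open>\<Omega>\<close> lies locally on one side of its boundary, and \<open>\<Omega>\<close> is the closure
  of its interior.\<close>

definition smooth_boundary :: "plane set \<Rightarrow> bool" where
  "smooth_boundary \<Omega> \<longleftrightarrow>
     (\<forall>p\<in>frontier \<Omega>. \<exists>U (\<rho> :: plane \<Rightarrow> real).
        open U \<and> p \<in> U \<and> smooth_on U \<rho> \<and>
        (\<forall>x\<in>U. \<exists>v. frechet_derivative \<rho> (at x) v \<noteq> 0) \<and>
        \<Omega> \<inter> U = {x \<in> U. \<rho> x \<le> 0})"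

definition compact_smooth_domain :: "plane set \<Rightarrow> bool" where
  "compact_smooth_domain \<Omega> \<longleftrightarrow>
     compact \<Omega> \<and> connected \<Omega> \<and> \<Omega> \<noteq> {} \<and> smooth_boundary \<Omega>"

text \<open>A regular smooth parametrization, near parameter 0, of the boundary of \<open>\<Omega>\<close> around \<open>x\<close>.\<close>

definition boundary_param :: "plane set \<Rightarrow> (real \<Rightarrow> plane) \<Rightarrow> plane \<Rightarrow> bool" where
  "boundary_param \<Omega> c x \<longleftrightarrow> c 0 = x \<and>
     (\<exists>\<delta>>0. smooth_on {-\<delta><..<\<delta>} c \<and>
        (\<forall>t\<in>{-\<delta><..<\<delta>}. c t \<in> frontier \<Omega> \<and> vector_derivative c (at t) \<noteq> 0))"

definition curvature :: "(real \<Rightarrow> plane) \<Rightarrow> real \<Rightarrow> real" where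
  "curvature c t =
     (let c1 = vector_derivative c (at t);
          c2 = vector_derivative (\<lambda>r. vector_derivative c (at r)) (at t)
      in (c1 $ 1 * c2 $ 2 - c1 $ 2 * c2 $ 1) / norm c1 ^ 3)"

text \<open>For a smooth boundary, neither the tangent direction nor the vanishing of the curvature
  at \<open>x\<close> depends on the parametrization, so the existential quantifiers below are harmless.\<close>

definition boundary_curvature_zero :: "plane set \<Rightarrow> plane \<Rightarrow> bool" where
  "boundary_curvature_zero \<Omega> x \<longleftrightarrow> (\<exists>c. boundary_param \<Omega> c x \<and> curvature c 0 = 0)"

definition tangency_set :: "plane set \<Rightarrow> real \<Rightarrow> real \<Rightarrow> plane set" where
  "tangency_set \<Omega> s \<theta> =
     {x \<in> frontier \<Omega> \<inter> Line s \<theta>.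
        \<exists>c. boundary_param \<Omega> c x \<and> vector_derivative c (at 0) \<bullet> unit_dir \<theta> = 0}"

text \<open>Angles are taken in \<open>[0, 2 pi)\<close>: as \<open>Line s\<close> is periodic, the set
  would otherwise be infinite as soon as it is nonempty.\<close>

definition degenerate_tangents :: "plane set \<Rightarrow> (real \<times> real) set" where
  "degenerate_tangents \<Omega> =
     {(s, \<theta>). 0 \<le> \<theta> \<and> \<theta> < 2 * pi \<and>
        (\<not> connected (tangency_set \<Omega> s \<theta>) \<or>
         (\<exists>x. tangency_set \<Omega> s \<theta> = {x} \<and> boundary_curvature_zero \<Omega> x))}"

definition admissible_densities :: "(plane \<Rightarrow> real) set" where
  "admissible_densities =
     {f. \<exists>\<Omega> u. compact_smooth_domain \<Omega> \<and> \<Omega> \<subseteq> ball 0 1 \<and> finite (degenerate_tangents \<Omega>) \<and>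
          u > 0 \<and> f = (\<lambda>x. u * indicator \<Omega> x)}"

end

theory Submission
  imports Defs
begin

text \<open>With \<open>f = u \<chi>\<^sub>\<Omega>\<close>, the transform integrates a Lipschitz positive weight over \<open>\<Omega> \<inter> L(s, \<theta>)\<close>,
  so \<open>s \<mapsto> \<R>f(s, \<theta>)\<close> is Lipschitz at lines transversal to \<open>\<partial>\<Omega>\<close> and not Lipschitz at lines with a single
  point of tangency. If \<open>\<R>f = \<R>g\<close>, the tangent lines of a curved arc of \<open>\<partial>\<Omega>\<close> are therefore, up to finitely
  many, tangent to \<open>\<partial>\<Omega>'\<close>. Away from the arc these lines foliate the plane, so by Sard's theorem only a
  null set of them can be tangent to \<open>\<partial>\<Omega>'\<close> off the arc, and the arc lies in \<open>\<partial>\<Omega>'\<close>. Straight pieces lie in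
  \<open>\<partial>\<Omega>'\<close> too, by looking at a farthest point of \<open>\<partial>\<Omega> - \<partial>\<Omega>'\<close> from the origin. Hence \<open>\<partial>\<Omega> = \<partial>\<Omega>'\<close> and, by
  connectedness, \<open>\<Omega> = \<Omega>'\<close>.

  For the constants, let \<open>p\<close> be a point of \<open>\<Omega>\<close> farthest from the origin. Lines perpendicular to \<open>p\<close> that
  tend to \<open>p\<close> give \<open>u exp (- u A) = u' exp (- u' A)\<close>, where \<open>A\<close> is the attenuation at \<open>p\<close> of \<open>\<chi>\<^sub>\<Omega>\<close>. If
  \<open>u \<noteq> u'\<close> this determines \<open>A\<close>; but the two orientations of these lines give attenuations of which, for
  small \<open>\<epsilon>\<close>, one is close to 0 and the other is bounded below.\<close>

section \<open>Calculus of smooth functions\<close>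

text \<open>The Lipschitz test compares \<open>F (s0 + \<sigma>)\<close> with
  \<open>F (s0 - \<sigma>)\<close>, never with \<open>F s0\<close>: at a tangency the sign of the
  boundary function \<open>\<eta>\<close> is unknown, so a gain relative to the middle line cannot
  be located, whereas the graph runs between the two outer lines. A common tangent line says nothing
  about where the second domain touches it, so single lines decide nothing and a family of positive
  measure is needed. A straight piece offers no such family, since its tangent line is one and the
  same; but the middle of a segment is never farthest from the origin. Equality of the domains holds
  for every \<open>\<epsilon> > 0\<close>. Smallness of \<open>\<epsilon>\<close> serves only the
  constant: \<open>u exp (- u A)\<close> is not injective in \<open>u\<close> when
  \<open>A > 0\<close>, so one attenuation cannot fix \<open>u\<close>. The bound on
  \<open>\<epsilon>\<close> is chosen from \<open>f\<close> and the data, before the competitor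
  \<open>g\<close>. Lines close to a farthest point meet \<open>\<Omega>\<close> only near that
  point, which turns an identity of integrals into a pointwise one.\<close>

lemma k_times_diff_on_cong:
  assumes "open S" "\<And>x. x \<in> S \<Longrightarrow> f x = g x" "k_times_diff_on k S f"
  shows "k_times_diff_on k S g"
  using assms(2,3)
proof (induction k arbitrary: f g)
  case 0
  then show ?case
    by (metis continuous_on_cong k_times_diff_on.simps(1))
next
  case (Suc k)
  have d: "(g has_derivative frechet_derivative f (at x)) (at x)" if "x \<in> S" for x
    using Suc.prems that assms(1)
    by (metis (no_types, lifting) frechet_derivative_works has_derivative_transform_within_open
        k_times_diff_on.simps(2))
  then have e: "frechet_derivative g (at x) = frechet_derivative f (at x)" if "x \<in> S" for x
    using that frechet_derivative_at by metis
  show ?case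
    unfolding k_times_diff_on.simps
  proof (intro conjI ballI allI)
    show "g differentiable at x" if "x \<in> S" for x
      using d that differentiableI by blast
    show "k_times_diff_on k S (\<lambda>x. frechet_derivative g (at x) v)" for v
      using Suc.IH[of "\<lambda>x. frechet_derivative f (at x) v" "\<lambda>x. frechet_derivative g (at x) v"]
        Suc.prems(2) e by simp
  qed
qed

text \<open>\<open>frechet_derivative\<close> is a choice operator; here an explicit derivative
  formula takes its place. The closure properties and the smoothness of the implicit function are
  inductions through this rule.\<close>

lemma k_times_diff_on_SucI:
  assumes "open S" "\<And>x. x \<in> S \<Longrightarrow> (f has_derivative f' x) (at x)"
    "\<And>v. k_times_diff_on k S (\<lambda>x. f' x v)"
  shows "k_times_diff_on (Suc k) S f"
proof -
  have "f' x = frechet_derivative f (at x)" if "x \<in> S" for x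
    using assms(2) that frechet_derivative_at by blast
  then have "k_times_diff_on k S (\<lambda>x. frechet_derivative f (at x) v)" for v
    using k_times_diff_on_cong[OF assms(1) _ assms(3)] by simp
  then show ?thesis
    using assms(2) by (auto simp: differentiable_def)
qed

lemma k_times_diff_on_SucD:
  assumes "k_times_diff_on (Suc k) S f"
  shows "\<And>x. x \<in> S \<Longrightarrow> (f has_derivative frechet_derivative f (at x)) (at x)"
    and "\<And>v. k_times_diff_on k S (\<lambda>x. frechet_derivative f (at x) v)"
  using assms frechet_derivative_works by auto

lemma k_times_diff_on_Suc_imp: "k_times_diff_on (Suc k) S f \<Longrightarrow> k_times_diff_on k S f"
proof (induction k arbitrary: f)
  case 0
  then show ?case
    by (simp add: continuous_at_imp_continuous_on differentiable_imp_continuous_within)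
next
  case (Suc k)
  then show ?case
    by (meson k_times_diff_on.simps(2))
qed

lemma k_times_diff_on_subset:
  "k_times_diff_on k S f \<Longrightarrow> T \<subseteq> S \<Longrightarrow> k_times_diff_on k T f"
  by (induction k arbitrary: f) (auto intro: continuous_on_subset simp: k_times_diff_on.simps)

lemma k_times_diff_on_const: "k_times_diff_on k S (\<lambda>x. c)"
  by (induction k arbitrary: c) auto

declare k_times_diff_on.simps(2) [simp del]

lemma k_times_diff_on_bounded_linear:
  assumes "open S" "bounded_linear L" "k_times_diff_on k S f"
  shows "k_times_diff_on k S (\<lambda>x. L (f x))"
  using assms(3)
proof (induction k arbitrary: f)
  case 0
  then show ?case
    using assms(2) by (simp add: bounded_linear.continuous_on)
next
  case (Suc k)
  show ?case
    using bounded_linear.has_derivative[OF assms(2) k_times_diff_on_SucD(1)[OF Suc.prems]]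
      Suc.IH k_times_diff_on_SucD(2)[OF Suc.prems]
    by (intro k_times_diff_on_SucI[OF assms(1)]) auto
qed

lemma k_times_diff_on_linear:
  assumes "open S" "bounded_linear L"
  shows "k_times_diff_on k S L"
proof (cases k)
  case 0
  then show ?thesis
    using assms(2) by (simp add: linear_continuous_on)
next
  case (Suc j)
  then show ?thesis
    using assms k_times_diff_on_SucI[OF assms(1), of L "\<lambda>x. L" j]
    by (simp add: bounded_linear_imp_has_derivative k_times_diff_on_const)
qed

lemma k_times_diff_on_add:
  assumes "open S" "k_times_diff_on k S f" "k_times_diff_on k S g"
  shows "k_times_diff_on k S (\<lambda>x. f x + g x)"
  using assms(2,3)
proof (induction k arbitrary: f g)
  case 0
  then show ?case
    by (simp add: continuous_on_add)
next
  case (Suc k)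
  show ?case
    using has_derivative_add[OF k_times_diff_on_SucD(1)[OF Suc.prems(1)]
        k_times_diff_on_SucD(1)[OF Suc.prems(2)]]
      Suc.IH k_times_diff_on_SucD(2)[OF Suc.prems(1)] k_times_diff_on_SucD(2)[OF Suc.prems(2)]
    by (intro k_times_diff_on_SucI[OF assms(1)]) auto
qed

lemma k_times_diff_on_mult:
  fixes f g :: "'a::real_normed_vector \<Rightarrow> real"
  assumes "open S" "k_times_diff_on k S f" "k_times_diff_on k S g"
  shows "k_times_diff_on k S (\<lambda>x. f x * g x)"
  using assms(2,3)
proof (induction k arbitrary: f g)
  case 0
  then show ?case
    by (simp add: continuous_on_mult)
next
  case (Suc k)
  note f = k_times_diff_on_SucD[OF Suc.prems(1)] k_times_diff_on_Suc_imp[OF Suc.prems(1)]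
  note g = k_times_diff_on_SucD[OF Suc.prems(2)] k_times_diff_on_Suc_imp[OF Suc.prems(2)]
  show ?case
  proof (rule k_times_diff_on_SucI[OF assms(1)])
    show "((\<lambda>x. f x * g x) has_derivative (\<lambda>v. f x * frechet_derivative g (at x) v
        + frechet_derivative f (at x) v * g x)) (at x)" if "x \<in> S" for x
      by (rule has_derivative_mult[OF f(1)[OF that] g(1)[OF that]])
    show "k_times_diff_on k S (\<lambda>x. f x * frechet_derivative g (at x) v
        + frechet_derivative f (at x) v * g x)" for v
      by (intro k_times_diff_on_add Suc.IH assms(1) f g)
  qed
qed

lemma k_times_diff_on_inverse:
  fixes f :: "'a::real_normed_vector \<Rightarrow> real"
  assumes "open S" "k_times_diff_on k S f" "\<And>x. x \<in> S \<Longrightarrow> f x \<noteq> 0"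
  shows "k_times_diff_on k S (\<lambda>x. inverse (f x))"
  using assms(2,3)
proof (induction k arbitrary: f)
  case 0
  then show ?case
    by (simp add: continuous_on_inverse)
next
  case (Suc k)
  note f = k_times_diff_on_SucD[OF Suc.prems(1)] k_times_diff_on_Suc_imp[OF Suc.prems(1)]
  have i: "k_times_diff_on k S (\<lambda>x. inverse (f x))"
    using Suc f by blast
  have "k_times_diff_on k S
      (\<lambda>x. - (inverse (f x) * frechet_derivative f (at x) v * inverse (f x)))" for v
    by (rule k_times_diff_on_bounded_linear[OF assms(1) bounded_linear_minus[OF bounded_linear_ident]])
      (intro k_times_diff_on_mult assms(1) i f(2))
  moreover have "((\<lambda>x. inverse (f x)) has_derivative
      (\<lambda>v. - (inverse (f x) * frechet_derivative f (at x) v * inverse (f x)))) (at x)"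
    if "x \<in> S" for x
    using Suc.prems(2) f(1) that by (intro Deriv.has_derivative_inverse) auto
  ultimately show ?case
    by (intro k_times_diff_on_SucI[OF assms(1)]) auto
qed

lemma smooth_onD: "smooth_on S f \<Longrightarrow> k_times_diff_on k S f"
  by (simp add: smooth_on_def)

lemma smooth_on_has_derivative:
  "smooth_on S f \<Longrightarrow> x \<in> S \<Longrightarrow> (f has_derivative frechet_derivative f (at x)) (at x)"
  using k_times_diff_on_SucD(1) smooth_onD by blast

lemma smooth_on_frechet_derivative:
  "smooth_on S f \<Longrightarrow> smooth_on S (\<lambda>x. frechet_derivative f (at x) v)"
  using k_times_diff_on_SucD(2) by (metis smooth_on_def)

lemma smooth_on_imp_continuous_on: "smooth_on S f \<Longrightarrow> continuous_on S f"
  using smooth_onD[of S f 0] by simp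

lemma smooth_on_subset: "smooth_on S f \<Longrightarrow> T \<subseteq> S \<Longrightarrow> smooth_on T f"
  unfolding smooth_on_def using k_times_diff_on_subset by blast

lemma smooth_on_DERIV:
  fixes f :: "real \<Rightarrow> real"
  assumes "smooth_on S f" "x \<in> S"
  shows "(f has_real_derivative deriv f x) (at x)"
  using smooth_on_has_derivative[OF assms]
  by (simp add: DERIV_deriv_iff_real_differentiable differentiableI)

lemma smooth_on_deriv:
  fixes f :: "real \<Rightarrow> real"
  assumes "smooth_on S f" "open S"
  shows "smooth_on S (deriv f)"
proof -
  have "frechet_derivative f (at x) 1 = deriv f x" if "x \<in> S" for x
    using smooth_on_DERIV[OF assms(1) that]
    by (metis has_field_derivative_def frechet_derivative_at mult.right_neutral)
  then show ?thesis
    using smooth_on_frechet_derivative[OF assms(1), of 1] assms(2)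
    by (meson k_times_diff_on_cong smooth_on_def)
qed

lemma k_times_diff_on_SucI_DERIV:
  fixes f :: "real \<Rightarrow> real"
  assumes "open S" "\<And>x. x \<in> S \<Longrightarrow> (f has_real_derivative f' x) (at x)" "k_times_diff_on k S f'"
  shows "k_times_diff_on (Suc k) S f"
  using assms by (intro k_times_diff_on_SucI[OF assms(1), where f' = "\<lambda>x v. f' x * v"])
    (auto simp: has_field_derivative_def intro!: k_times_diff_on_mult k_times_diff_on_const)

text \<open>The derivative of the composite consists of partial derivatives of \<open>f\<close>
  along the same curve, so the induction quantifies over \<open>f\<close>. Only \<open>k\<close>
  derivatives of \<open>\<eta>\<close> go in: an \<open>\<eta>\<close> whose own derivative is built
  from such composites gains one order at each step.\<close>

lemma k_times_diff_on_compose_graph: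
  fixes \<eta> :: "real \<Rightarrow> real" and f :: "'a::real_normed_vector \<Rightarrow> real"
  assumes "open I" "k_times_diff_on k I \<eta>" "smooth_on U f"
    "\<And>x. x \<in> I \<Longrightarrow> p + x *\<^sub>R m + \<eta> x *\<^sub>R n \<in> U"
  shows "k_times_diff_on k I (\<lambda>x. f (p + x *\<^sub>R m + \<eta> x *\<^sub>R n))"
  using assms(2,3)
proof (induction k arbitrary: f)
  case 0
  then show ?case
    using assms(4) smooth_on_imp_continuous_on[of U f]
    by (auto intro!: continuous_intros continuous_on_compose2[of U f])
next
  case (Suc k)
  note \<eta> = k_times_diff_on_SucD[OF Suc.prems(1)] k_times_diff_on_Suc_imp[OF Suc.prems(1)]
  define \<gamma> where "\<gamma> = (\<lambda>x. p + x *\<^sub>R m + \<eta> x *\<^sub>R n)"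
  define D where "D = (\<lambda>x. frechet_derivative f (at (\<gamma> x)))"
  have der: "((\<lambda>x. f (\<gamma> x)) has_derivative (\<lambda>v. v * D x m + frechet_derivative \<eta> (at x) v * D x n)) (at x)"
    if x: "x \<in> I" for x
  proof -
    have f: "(f has_derivative D x) (at (\<gamma> x))"
      unfolding D_def using Suc.prems(2) assms(4) x smooth_on_has_derivative \<gamma>_def by blast
    then have lin: "D x (a *\<^sub>R m + b *\<^sub>R n) = a * D x m + b * D x n" for a b
      by (simp add: has_derivative_bounded_linear linear_simps)
    have "(\<gamma> has_derivative (\<lambda>v. v *\<^sub>R m + frechet_derivative \<eta> (at x) v *\<^sub>R n)) (at x)"
      unfolding \<gamma>_def using \<eta>(1)[OF x] by (auto intro!: derivative_eq_intros)
    from has_derivative_compose[OF this f] show ?thesis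
      by (simp add: lin)
  qed
  have "k_times_diff_on k I (\<lambda>x. v * D x m + frechet_derivative \<eta> (at x) v * D x n)" for v
    unfolding D_def \<gamma>_def
    by (intro k_times_diff_on_add k_times_diff_on_mult assms(1) k_times_diff_on_const \<eta>
        Suc.IH smooth_on_frechet_derivative Suc.prems(2))
  then show ?case
    using k_times_diff_on_SucI[OF assms(1) der] by (simp add: \<gamma>_def)
qed

section \<open>Graph charts of a smooth boundary\<close>

definition frame :: "plane \<Rightarrow> plane \<Rightarrow> bool" where
  "frame m n \<longleftrightarrow> norm m = 1 \<and> norm n = 1 \<and> m \<bullet> n = 0"

lemma frame_swap: "frame m n \<Longrightarrow> frame n m"
  by (simp add: frame_def inner_commute)

lemma frame_unit_dir: "frame (unit_dir \<theta>) (unit_dir (\<theta> + pi / 2))"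
  by (simp add: frame_def unit_dir_def norm_eq_sqrt_inner inner_vec_def sum_2 cos_add sin_add
      flip: power2_eq_square)

lemma frame_inner:
  assumes "frame m n"
  shows "m \<bullet> m = 1" "n \<bullet> n = 1" "m \<bullet> n = 0" "n \<bullet> m = 0"
  using assms by (auto simp: frame_def norm_eq_1 inner_commute)

lemma frame_expand:
  assumes "frame m n"
  shows "x = (x \<bullet> m) *\<^sub>R m + (x \<bullet> n) *\<^sub>R n"
proof -
  \<comment> \<open>The determinant of the frame. It is 1 or -1, and \<open>n\<close> is
    \<open>c\<close> times \<open>m\<close> rotated by a right angle, which leaves only polynomial
    identities.\<close>
  define c where "c = m$1 * n$2 - m$2 * n$1"
  have a: "m$1 * m$1 + m$2 * m$2 = 1" "n$1 * n$1 + n$2 * n$2 = 1" "m$1 * n$1 + m$2 * n$2 = 0"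
    using frame_inner[OF assms] by (auto simp: inner_vec_def sum_2)
  have n1: "n$1 = - c * m$2"
    unfolding c_def using a by algebra
  have n2: "n$2 = c * m$1"
    unfolding c_def using a by algebra
  have c: "c * c = 1"
    using a(1,2) unfolding n1 n2 by algebra
  have "x$1 = (x$1 * m$1 + x$2 * m$2) * m$1 + (x$1 * n$1 + x$2 * n$2) * n$1"
    unfolding n1 n2 using a(1) c by algebra
  moreover have "x$2 = (x$1 * m$1 + x$2 * m$2) * m$2 + (x$1 * n$1 + x$2 * n$2) * n$2"
    unfolding n1 n2 using a(1) c by algebra
  ultimately show ?thesis
    by (simp add: vec_eq_iff forall_2 inner_vec_def sum_2)
qed

lemma frame_expand_at:
  assumes "frame m n"
  shows "z = p + ((z - p) \<bullet> m) *\<^sub>R m + ((z - p) \<bullet> n) *\<^sub>R n"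
  using frame_expand[OF assms, of "z - p"] by (simp add: algebra_simps)

lemma frame_norm:
  assumes "frame m n"
  shows "(norm (a *\<^sub>R m + b *\<^sub>R n))\<^sup>2 = a\<^sup>2 + b\<^sup>2"
  unfolding power2_norm_eq_inner using frame_inner[OF assms]
  by (simp add: inner_add_left inner_add_right power2_eq_square)

lemma frame_norm_le:
  assumes "frame m n"
  shows "norm (a *\<^sub>R m + b *\<^sub>R n) \<le> \<bar>a\<bar> + \<bar>b\<bar>"
  using norm_triangle_ineq[of "a *\<^sub>R m" "b *\<^sub>R n"] assms by (simp add: frame_def)

lemma isCont_pos_near:
  fixes f :: "'a::metric_space \<Rightarrow> real"
  assumes "isCont f x0" "f x0 > 0"
  obtains d where "d > 0" "\<And>x. dist x x0 < d \<Longrightarrow> f x > 0"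
proof -
  obtain d where d: "d > 0" "\<And>x. dist x x0 < d \<Longrightarrow> dist (f x) (f x0) < f x0"
    using assms unfolding continuous_at_eps_delta by blast
  then show thesis
    by (intro that[of d]) (auto simp: dist_real_def abs_less_iff)
qed

text \<open>Room for moving a point of height \<open>a\<close> up or down inside a chart of height
  \<open>h\<close>.\<close>

lemma small_shift:
  fixes a h e :: real
  assumes "e > 0" "\<bar>a\<bar> < h"
  shows "\<exists>k>0. k < e \<and> \<bar>a + k\<bar> < h \<and> \<bar>a - k\<bar> < h"
proof (cases "e \<le> h - \<bar>a\<bar>")
  case True
  then show ?thesis
    using assms by (intro exI[of _ "e / 2"]) (auto simp: abs_if split: if_splits)
next
  case False
  then show ?thesis
    using assms by (intro exI[of _ "(h - \<bar>a\<bar>) / 2"]) (auto simp: abs_if field_simps split: if_splits)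
qed

text \<open>The frame is a parameter and \<open>\<eta>\<close> may have any slope at 0, so the axes
  can be those of a given line. Since \<open>\<eta>\<close> stays inside the height
  \<open>h\<close>, each vertical segment of the box crosses the boundary exactly once. With
  \<open>n\<close> pointing upwards, \<open>sg\<close> is 1 when \<open>\<Omega>\<close> lies below
  the graph and -1 when it lies above.\<close>

definition graph_chart ::
  "plane set \<Rightarrow> plane \<Rightarrow> plane \<Rightarrow> plane \<Rightarrow> real \<Rightarrow> real \<Rightarrow> real \<Rightarrow> (real \<Rightarrow> real) \<Rightarrow> bool" where
  "graph_chart \<Omega> p m n r h sg \<eta> \<longleftrightarrow> frame m n \<and> r > 0 \<and> h > 0 \<and> (sg = 1 \<or> sg = -1) \<and>
     smooth_on {-r<..<r} \<eta> \<and> \<eta> 0 = 0 \<and> (\<forall>x. \<bar>x\<bar> < r \<longrightarrow> \<bar>\<eta> x\<bar> < h) \<and>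
     (\<forall>x y. \<bar>x\<bar> < r \<longrightarrow> \<bar>y\<bar> < h \<longrightarrow> (p + x *\<^sub>R m + y *\<^sub>R n \<in> \<Omega> \<longleftrightarrow> sg * (y - \<eta> x) \<le> 0))"

text \<open>The implicit function theorem: \<open>\<eta>\<close> solves \<open>\<rho> (p + x m + \<eta> x n) = 0\<close>, and inherits its
  smoothness inductively from the formula for its derivative.\<close>

lemma graph_chart_exists:
  fixes \<rho> :: "plane \<Rightarrow> real"
  assumes fr: "frame m n" and U: "open U" "p \<in> U" "smooth_on U \<rho>"
    and \<Omega>: "\<Omega> \<inter> U = {x \<in> U. \<rho> x \<le> 0}" and p0: "\<rho> p = 0"
    and dn: "frechet_derivative \<rho> (at p) n \<noteq> 0"
  shows "\<exists>r h sg \<eta>. graph_chart \<Omega> p m n r h sg \<eta> \<and>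
    deriv \<eta> 0 * frechet_derivative \<rho> (at p) n = - frechet_derivative \<rho> (at p) m"
proof -
  define D where "D = (\<lambda>v x. frechet_derivative \<rho> (at x) v)"
  \<comment> \<open>With this sign, \<open>sg * \<rho>\<close> increases in the direction
    \<open>n\<close> near \<open>p\<close>, so both orientations of the gradient are treated at
    once.\<close>
  define sg where "sg = sgn (D n p)"
  have sg: "sg = 1 \<or> sg = -1"
    using dn by (auto simp: sg_def D_def sgn_if)
  have smD: "smooth_on U (D v)" for v
    unfolding D_def by (rule smooth_on_frechet_derivative[OF U(3)])
  have contD: "isCont (D v) x" if "x \<in> U" for v x
    using smooth_on_imp_continuous_on[OF smD] U(1) that continuous_on_eq_continuous_at by blast
  have "open (U \<inter> (\<lambda>x. sg * D n x) -` {0<..})"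
    using smooth_on_imp_continuous_on[OF smD] U(1)
    by (intro continuous_open_preimage) (auto intro!: continuous_intros)
  moreover have "sg * D n p > 0"
    using dn by (simp add: sg_def D_def sgn_if)
  ultimately obtain \<delta> where \<delta>: "\<delta> > 0" "ball p \<delta> \<subseteq> U \<inter> (\<lambda>x. sg * D n x) -` {0<..}"
    using U(2) by (auto elim: openE)
  define q where "q = (\<lambda>x y. p + x *\<^sub>R m + y *\<^sub>R n)"
  have qball: "q x y \<in> ball p \<delta>" if "\<bar>x\<bar> < \<delta>/2" "\<bar>y\<bar> < \<delta>/2" for x y
    using frame_norm_le[OF fr, of "-x" "-y"] that unfolding q_def by (simp add: dist_norm algebra_simps)
  have qU: "q x y \<in> U" "sg * D n (q x y) > 0" if "\<bar>x\<bar> < \<delta>/2" "\<bar>y\<bar> < \<delta>/2" for x y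
    using qball[OF that] \<delta>(2) by auto
  have \<rho>d: "(\<rho> has_derivative (\<lambda>v. D v z)) (at z)" if "z \<in> U" for z
    unfolding D_def using smooth_on_has_derivative[OF U(3) that] by simp
  have Dlin: "D (c *\<^sub>R v) z = c * D v z" if "z \<in> U" for c v z
    using linear_cmul[OF has_derivative_linear[OF \<rho>d[OF that]]] by simp
  have dery: "((\<lambda>y. \<rho> (q x y)) has_real_derivative D n (q x y)) (at y)"
    if "\<bar>x\<bar> < \<delta>/2" "\<bar>y\<bar> < \<delta>/2" for x y
  proof -
    have "((\<lambda>y. q x y) has_derivative (\<lambda>v. v *\<^sub>R n)) (at y)"
      unfolding q_def by (auto intro!: derivative_eq_intros)
    from has_derivative_compose[OF this \<rho>d[OF qU(1)[OF that]]] show ?thesis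
      using Dlin[OF qU(1)[OF that]] by (simp add: has_field_derivative_def mult_commute_abs)
  qed
  have derx: "((\<lambda>x. \<rho> (q x y)) has_real_derivative D m (q x y)) (at x)"
    if "\<bar>x\<bar> < \<delta>/2" "\<bar>y\<bar> < \<delta>/2" for x y
  proof -
    have "((\<lambda>x. q x y) has_derivative (\<lambda>v. v *\<^sub>R m)) (at x)"
      unfolding q_def by (auto intro!: derivative_eq_intros)
    from has_derivative_compose[OF this \<rho>d[OF qU(1)[OF that]]] show ?thesis
      using Dlin[OF qU(1)[OF that]] by (simp add: has_field_derivative_def mult_commute_abs)
  qed
  have mono: "sg * \<rho> (q x y1) < sg * \<rho> (q x y2)"
    if x: "\<bar>x\<bar> < \<delta>/2" and y: "\<bar>y1\<bar> < \<delta>/2" "\<bar>y2\<bar> < \<delta>/2" "y1 < y2" for x y1 y2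
  proof (rule DERIV_pos_imp_increasing[OF y(3)])
    fix y assume "y1 \<le> y" "y \<le> y2"
    then have y': "\<bar>y\<bar> < \<delta>/2"
      using y by linarith
    show "\<exists>d. ((\<lambda>y. sg * \<rho> (q x y)) has_real_derivative d) (at y) \<and> d > 0"
      using DERIV_cmult[OF dery[OF x y'], of sg] qU(2)[OF x y'] by blast
  qed
  \<comment> \<open>The mean value point \<open>\<xi> x\<close> below is only known to satisfy
    \<open>\<bar>\<xi> x - \<eta> x0\<bar> \<le> \<bar>\<eta> x - \<eta> x0\<bar>\<close>, hence
    \<open>\<bar>\<xi> x\<bar> < 3 * h\<close>. A sixth of \<open>\<delta>\<close> keeps it in the
    box of half-width \<open>\<delta>/2\<close>.\<close>
  define h where "h = \<delta>/6"
  have h: "0 < h" "h < \<delta>/2"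
    using \<delta>(1) by (auto simp: h_def)
  have contx: "isCont (\<lambda>x. c * \<rho> (q x y)) x" if "\<bar>x\<bar> < \<delta>/2" "\<bar>y\<bar> < \<delta>/2" for x y c
    using DERIV_isCont[OF derx[OF that]] by (intro continuous_intros)
  have q00: "q 0 0 = p"
    by (simp add: q_def)
  obtain r1 where r1: "r1 > 0" "\<And>x. dist x 0 < r1 \<Longrightarrow> sg * \<rho> (q x h) > 0"
  proof (rule isCont_pos_near)
    show "isCont (\<lambda>x. sg * \<rho> (q x h)) 0"
      using contx h by simp
    show "sg * \<rho> (q 0 h) > 0"
      using mono[of 0 0 h] h \<delta>(1) p0 q00 by simp
  qed blast
  obtain r2 where r2: "r2 > 0" "\<And>x. dist x 0 < r2 \<Longrightarrow> (- sg) * \<rho> (q x (- h)) > 0"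
  proof (rule isCont_pos_near)
    show "isCont (\<lambda>x. (- sg) * \<rho> (q x (- h))) 0"
      using contx[of 0 "-h" "- sg"] h by simp
    show "(- sg) * \<rho> (q 0 (- h)) > 0"
      using mono[of 0 "-h" 0] h \<delta>(1) p0 q00 by simp
  qed blast
  define r where "r = min (\<delta>/2) (min r1 r2)"
  have r: "r > 0" "r \<le> \<delta>/2" "r \<le> r1" "r \<le> r2"
    using r1 r2 \<delta> by (auto simp: r_def)
  have "\<exists>y. \<bar>y\<bar> < h \<and> \<rho> (q x y) = 0" if x: "\<bar>x\<bar> < r" for x
  proof -
    have e: "sg * \<rho> (q x (-h)) < 0" "0 < sg * \<rho> (q x h)"
      using r1(2)[of x] r2(2)[of x] x r by auto
    have "continuous_on {-h..h} (\<lambda>y. sg * \<rho> (q x y))"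
      using dery[of x] x r h
      by (intro continuous_at_imp_continuous_on ballI continuous_intros)
        (metis DERIV_isCont abs_le_iff abs_less_iff atLeastAtMost_iff minus_le_iff order_le_less_trans
          order_less_le_trans)
    then obtain y where y: "-h \<le> y" "y \<le> h" "sg * \<rho> (q x y) = 0"
      using IVT'[of "\<lambda>y. sg * \<rho> (q x y)" "-h" 0 h] e h by auto
    then have "y \<noteq> h" "y \<noteq> -h"
      using e by auto
    with y sg show ?thesis
      by (intro exI[of _ y]) auto
  qed
  then obtain \<eta> where \<eta>: "\<And>x. \<bar>x\<bar> < r \<Longrightarrow> \<bar>\<eta> x\<bar> < h \<and> \<rho> (q x (\<eta> x)) = 0"
    by metis
  have sgn1: "sg * \<rho> (q x y) < 0" if "\<bar>x\<bar> < r" "\<bar>y\<bar> < h" "y < \<eta> x" for x y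
    using mono[of x y "\<eta> x"] \<eta>[OF that(1)] that r h by auto
  have sgn2: "sg * \<rho> (q x y) > 0" if "\<bar>x\<bar> < r" "\<bar>y\<bar> < h" "y > \<eta> x" for x y
    using mono[of x "\<eta> x" y] \<eta>[OF that(1)] that r h by auto
  have sgn: "\<rho> (q x y) \<le> 0 \<longleftrightarrow> sg * (y - \<eta> x) \<le> 0" if "\<bar>x\<bar> < r" "\<bar>y\<bar> < h" for x y
    using sgn1[OF that] sgn2[OF that] \<eta>[OF that(1)] sg
    by (cases "y = \<eta> x"; cases "y < \<eta> x") auto
  have \<eta>0: "\<eta> 0 = 0"
    using sgn1[of 0 0] sgn2[of 0 0] r h p0 q00 by (cases "\<eta> 0" "0::real" rule: linorder_cases) auto
  have cont\<eta>: "isCont \<eta> x0" if x0: "\<bar>x0\<bar> < r" for x0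
    unfolding continuous_at_eps_delta
  proof (intro allI impI)
    fix e :: real assume e: "e > 0"
    \<comment> \<open>Barriers: \<open>\<rho>\<close> has strict opposite signs at the heights
      \<open>\<eta> x0 + k\<close> and \<open>\<eta> x0 - k\<close> and keeps them for nearby
      \<open>x\<close>, which traps \<open>\<eta> x\<close> in between.\<close>
    obtain k where k: "k > 0" "k < e" "\<bar>\<eta> x0 + k\<bar> < h" "\<bar>\<eta> x0 - k\<bar> < h"
      using small_shift[OF e] \<eta>[OF x0] by blast
    obtain d1 where d1: "d1 > 0" "\<And>x. dist x x0 < d1 \<Longrightarrow> sg * \<rho> (q x (\<eta> x0 + k)) > 0"
      by (rule isCont_pos_near[where f = "\<lambda>x. sg * \<rho> (q x (\<eta> x0 + k))" and ?x0.0 = x0])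
        (use contx[of x0 "\<eta> x0 + k"] sgn2[OF x0, of "\<eta> x0 + k"] k r h x0 in auto)
    obtain d2 where d2: "d2 > 0" "\<And>x. dist x x0 < d2 \<Longrightarrow> (- sg) * \<rho> (q x (\<eta> x0 - k)) > 0"
      by (rule isCont_pos_near[where f = "\<lambda>x. (- sg) * \<rho> (q x (\<eta> x0 - k))" and ?x0.0 = x0])
        (use contx[of x0 "\<eta> x0 - k" "- sg"] sgn1[OF x0, of "\<eta> x0 - k"] k r h x0 in auto)
    show "\<exists>d>0. \<forall>x. dist x x0 < d \<longrightarrow> dist (\<eta> x) (\<eta> x0) < e"
    proof (intro exI[of _ "min (r - \<bar>x0\<bar>) (min d1 d2)"] conjI allI impI)
      show "0 < min (r - \<bar>x0\<bar>) (min d1 d2)"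
        using d1 d2 x0 by auto
      fix x assume x: "dist x x0 < min (r - \<bar>x0\<bar>) (min d1 d2)"
      then have xr: "\<bar>x\<bar> < r"
        by (auto simp: dist_real_def)
      have "\<eta> x \<le> \<eta> x0 + k"
        using d1(2)[of x] sgn1[OF xr k(3)] x by force
      moreover have "\<eta> x0 - k \<le> \<eta> x"
        using d2(2)[of x] sgn2[OF xr k(4)] x by force
      ultimately show "dist (\<eta> x) (\<eta> x0) < e"
        using k by (auto simp: dist_real_def)
    qed
  qed
  have der\<eta>: "(\<eta> has_real_derivative - (D m (q x0 (\<eta> x0)) * inverse (D n (q x0 (\<eta> x0))))) (at x0)"
    if x0: "\<bar>x0\<bar> < r" for x0
  proof -
    have b0: "\<bar>x0\<bar> < \<delta>/2" "\<bar>\<eta> x0\<bar> < \<delta>/2"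
      using x0 r \<eta>[OF x0] h by auto
    \<comment> \<open>Mean value theorem in the direction \<open>n\<close>, using that
      \<open>\<rho>\<close> vanishes at height \<open>\<eta> x\<close>. It turns the difference
      quotient of \<open>\<eta>\<close> into that of \<open>\<rho>\<close> in \<open>x\<close>,
      divided by the normal derivative at \<open>\<xi> x\<close>, and \<open>\<xi> x\<close> tends
      to \<open>\<eta> x0\<close> by continuity of \<open>\<eta>\<close>.\<close>
    have "\<exists>\<xi>. \<bar>\<xi> - \<eta> x0\<bar> \<le> \<bar>\<eta> x - \<eta> x0\<bar> \<and> - \<rho> (q x (\<eta> x0)) = (\<eta> x - \<eta> x0) * D n (q x \<xi>)"
      if x: "\<bar>x\<bar> < r" for x
    proof -
      have xd: "\<bar>x\<bar> < \<delta>/2" "\<bar>\<eta> x\<bar> < \<delta>/2"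
        using x r \<eta>[OF x] h by auto
      note \<rho>0 = conjunct2[OF \<eta>[OF x]]
      consider "\<eta> x = \<eta> x0" | "\<eta> x < \<eta> x0" | "\<eta> x > \<eta> x0"
        by linarith
      then show ?thesis
      proof cases
        case 1
        then show ?thesis
          using \<rho>0 by auto
      next
        case 2
        have "\<exists>z>\<eta> x. z < \<eta> x0 \<and> \<rho> (q x (\<eta> x0)) - \<rho> (q x (\<eta> x)) = (\<eta> x0 - \<eta> x) * D n (q x z)"
          using 2 dery[OF xd(1)] xd b0 by (intro MVT2) auto
        then obtain z where "\<eta> x < z" "z < \<eta> x0"
            "\<rho> (q x (\<eta> x0)) - \<rho> (q x (\<eta> x)) = (\<eta> x0 - \<eta> x) * D n (q x z)"
          by blast
        then show ?thesis
          using \<rho>0 by (intro exI[of _ z]) (auto simp: algebra_simps)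
      next
        case 3
        have "\<exists>z>\<eta> x0. z < \<eta> x \<and> \<rho> (q x (\<eta> x)) - \<rho> (q x (\<eta> x0)) = (\<eta> x - \<eta> x0) * D n (q x z)"
          using 3 dery[OF xd(1)] xd b0 by (intro MVT2) auto
        then obtain z where "\<eta> x0 < z" "z < \<eta> x"
            "\<rho> (q x (\<eta> x)) - \<rho> (q x (\<eta> x0)) = (\<eta> x - \<eta> x0) * D n (q x z)"
          by blast
        then show ?thesis
          using \<rho>0 by (intro exI[of _ z]) (auto simp: algebra_simps)
      qed
    qed
    then obtain \<xi> where \<xi>: "\<And>x. \<bar>x\<bar> < r \<Longrightarrow> \<bar>\<xi> x - \<eta> x0\<bar> \<le> \<bar>\<eta> x - \<eta> x0\<bar> \<and>
        - \<rho> (q x (\<eta> x0)) = (\<eta> x - \<eta> x0) * D n (q x (\<xi> x))"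
      by metis
    have "eventually (\<lambda>x. x \<in> {-r<..<r} - {x0}) (at x0)"
      using x0 by (intro eventually_at_in_open) auto
    then have ev: "eventually (\<lambda>x. \<bar>x\<bar> < r) (at x0)"
      by (rule eventually_mono) auto
    have "((\<lambda>x. \<eta> x - \<eta> x0) \<longlongrightarrow> 0) (at x0)"
      using cont\<eta>[OF x0] by (simp add: isCont_def LIM_zero_iff)
    then have "((\<lambda>x. \<xi> x - \<eta> x0) \<longlongrightarrow> 0) (at x0)"
      by (rule Lim_transform_bound[rotated]) (use ev \<xi> in \<open>auto elim!: eventually_mono\<close>)
    then have \<xi>lim: "(\<xi> \<longlongrightarrow> \<eta> x0) (at x0)"
      by (simp add: LIM_zero_iff)
    have "((\<lambda>x. q x (\<xi> x)) \<longlongrightarrow> q x0 (\<eta> x0)) (at x0)"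
      unfolding q_def by (intro tendsto_intros \<xi>lim)
    then have Dlim: "((\<lambda>x. D n (q x (\<xi> x))) \<longlongrightarrow> D n (q x0 (\<eta> x0))) (at x0)"
      using contD[OF qU(1)[OF b0]] isCont_tendsto_compose by blast
    have "((\<lambda>x. (\<rho> (q x (\<eta> x0)) - \<rho> (q x0 (\<eta> x0))) / (x - x0)) \<longlongrightarrow> D m (q x0 (\<eta> x0))) (at x0)"
      using derx[OF b0] by (simp add: has_field_derivative_iff)
    then have "((\<lambda>x. - ((\<rho> (q x (\<eta> x0)) - \<rho> (q x0 (\<eta> x0))) / (x - x0) * inverse (D n (q x (\<xi> x)))))
        \<longlongrightarrow> - (D m (q x0 (\<eta> x0)) * inverse (D n (q x0 (\<eta> x0))))) (at x0)"
      using qU(2)[OF b0] by (intro tendsto_intros Dlim) auto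
    moreover have "eventually (\<lambda>x. - ((\<rho> (q x (\<eta> x0)) - \<rho> (q x0 (\<eta> x0))) / (x - x0) * inverse (D n (q x (\<xi> x))))
        = (\<eta> x - \<eta> x0) / (x - x0)) (at x0)"
      using ev
    proof (rule eventually_mono)
      fix x assume x: "\<bar>x\<bar> < r"
      have "\<bar>\<xi> x\<bar> < \<delta>/2"
        using conjunct1[OF \<xi>[OF x]] conjunct1[OF \<eta>[OF x]] conjunct1[OF \<eta>[OF x0]] \<delta>(1)
        unfolding h_def by linarith
      then have "D n (q x (\<xi> x)) \<noteq> 0"
        using qU(2)[of x "\<xi> x"] x r by auto
      then show "- ((\<rho> (q x (\<eta> x0)) - \<rho> (q x0 (\<eta> x0))) / (x - x0) * inverse (D n (q x (\<xi> x))))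
          = (\<eta> x - \<eta> x0) / (x - x0)"
        using conjunct2[OF \<eta>[OF x0]]
        by (simp add: minus_equation_iff[THEN iffD1, OF conjunct2[OF \<xi>[OF x]], symmetric])
    qed
    ultimately show ?thesis
      unfolding has_field_derivative_iff by (rule Lim_transform_eventually)
  qed
  have "k_times_diff_on k {-r<..<r} \<eta>" for k
  proof (induction k)
    case 0
    then show ?case
      using cont\<eta> by (auto intro!: continuous_at_imp_continuous_on)
  next
    case (Suc k)
    have qx: "p + x *\<^sub>R m + \<eta> x *\<^sub>R n \<in> U" "D n (p + x *\<^sub>R m + \<eta> x *\<^sub>R n) \<noteq> 0" if "x \<in> {-r<..<r}" for x
    proof -
      have x: "\<bar>x\<bar> < r"
        using that by auto
      then have "\<bar>x\<bar> < \<delta>/2" "\<bar>\<eta> x\<bar> < \<delta>/2"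
        using \<eta>[OF x] h r by auto
      from qU[OF this] show "p + x *\<^sub>R m + \<eta> x *\<^sub>R n \<in> U" "D n (p + x *\<^sub>R m + \<eta> x *\<^sub>R n) \<noteq> 0"
        by (auto simp: q_def)
    qed
    show ?case
    proof (rule k_times_diff_on_SucI_DERIV)
      show "(\<eta> has_real_derivative - (D m (q x (\<eta> x)) * inverse (D n (q x (\<eta> x))))) (at x)"
        if "x \<in> {-r<..<r}" for x
        using der\<eta> that by auto
      show "k_times_diff_on k {-r<..<r} (\<lambda>x. - (D m (q x (\<eta> x)) * inverse (D n (q x (\<eta> x)))))"
        unfolding q_def
        by (intro k_times_diff_on_bounded_linear[OF _ bounded_linear_minus[OF bounded_linear_ident]]
            k_times_diff_on_mult k_times_diff_on_inverse open_greaterThanLessThan)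
          (use qx Suc smD in \<open>auto intro!: k_times_diff_on_compose_graph[of _ _ _ U]\<close>)
    qed auto
  qed
  then have sm: "smooth_on {-r<..<r} \<eta>"
    by (simp add: smooth_on_def)
  have "q x y \<in> \<Omega> \<longleftrightarrow> sg * (y - \<eta> x) \<le> 0" if "\<bar>x\<bar> < r" "\<bar>y\<bar> < h" for x y
    using sgn[OF that] \<Omega> qU(1)[of x y] that r h by (auto simp: set_eq_iff)
  then have "graph_chart \<Omega> p m n r h sg \<eta>"
    unfolding graph_chart_def using fr r(1) h(1) sg sm \<eta>0 \<eta> by (simp add: q_def)
  moreover have "deriv \<eta> 0 * D n p = - D m p"
    using DERIV_imp_deriv[OF der\<eta>[of 0]] r(1) \<eta>0 q00 dn by (simp add: D_def)
  ultimately show ?thesis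
    unfolding D_def by blast
qed

lemma frame_coord_le:
  assumes "frame m n"
  shows "\<bar>z \<bullet> m\<bar> \<le> norm z" "\<bar>z \<bullet> n\<bar> \<le> norm z"
  using Cauchy_Schwarz_ineq2[of z m] Cauchy_Schwarz_ineq2[of z n] assms by (auto simp: frame_def)

lemma graph_chartD:
  assumes "graph_chart \<Omega> p m n r h sg \<eta>"
  shows "frame m n" "r > 0" "h > 0" "sg = 1 \<or> sg = -1" "smooth_on {-r<..<r} \<eta>" "\<eta> 0 = 0"
    and "\<And>x. \<bar>x\<bar> < r \<Longrightarrow> \<bar>\<eta> x\<bar> < h"
    and "\<And>x y. \<bar>x\<bar> < r \<Longrightarrow> \<bar>y\<bar> < h \<Longrightarrow> p + x *\<^sub>R m + y *\<^sub>R n \<in> \<Omega> \<longleftrightarrow> sg * (y - \<eta> x) \<le> 0"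
  using assms by (auto simp: graph_chart_def)

lemma graph_chart_DERIV:
  assumes "graph_chart \<Omega> p m n r h sg \<eta>" "\<bar>x\<bar> < r"
  shows "(\<eta> has_real_derivative deriv \<eta> x) (at x)"
    "(deriv \<eta> has_real_derivative deriv (deriv \<eta>) x) (at x)"
    "isCont (deriv (deriv \<eta>)) x"
proof -
  note sm = graph_chartD(5)[OF assms(1)]
  have x: "x \<in> {-r<..<r}"
    using assms(2) by auto
  note sm1 = smooth_on_deriv[OF sm open_greaterThanLessThan]
  note sm2 = smooth_on_deriv[OF sm1 open_greaterThanLessThan]
  show "(\<eta> has_real_derivative deriv \<eta> x) (at x)"
    by (rule smooth_on_DERIV[OF sm x])
  show "(deriv \<eta> has_real_derivative deriv (deriv \<eta>) x) (at x)"
    by (rule smooth_on_DERIV[OF sm1 x])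
  show "isCont (deriv (deriv \<eta>)) x"
    using smooth_on_DERIV[OF sm2 x] DERIV_isCont by blast
qed

text \<open>The side function \<open>G\<close> is continuous on the open box, so its strict sides
  are open: one lies in \<open>\<Omega>\<close>, the other misses it. A point of the graph belongs
  to \<open>\<Omega>\<close>, but arbitrarily small shifts by \<open>sg * k\<close> along
  \<open>n\<close> leave it.\<close>

lemma graph_chart_sides:
  assumes ch: "graph_chart \<Omega> p m n r h sg \<eta>" and x: "\<bar>x\<bar> < r" and y: "\<bar>y\<bar> < h"
  shows "sg * (y - \<eta> x) < 0 \<Longrightarrow> p + x *\<^sub>R m + y *\<^sub>R n \<in> interior \<Omega>"
    and "sg * (y - \<eta> x) > 0 \<Longrightarrow> p + x *\<^sub>R m + y *\<^sub>R n \<notin> closure \<Omega>"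
    and "p + x *\<^sub>R m + y *\<^sub>R n \<in> frontier \<Omega> \<longleftrightarrow> y = \<eta> x"
proof -
  note c = graph_chartD[OF ch]
  define B where "B = {z. \<bar>(z - p) \<bullet> m\<bar> < r \<and> \<bar>(z - p) \<bullet> n\<bar> < h}"
  define G where "G = (\<lambda>z. sg * ((z - p) \<bullet> n - \<eta> ((z - p) \<bullet> m)))"
  let ?q = "p + x *\<^sub>R m + y *\<^sub>R n"
  have B: "open B"
    unfolding B_def by (intro open_Collect_conj open_Collect_less continuous_intros)
  have G: "continuous_on B G"
    unfolding G_def B_def
    by (intro continuous_intros continuous_on_compose2[OF smooth_on_imp_continuous_on[OF c(5)]])
      (auto simp: abs_less_iff)
  have mem: "z \<in> \<Omega> \<longleftrightarrow> G z \<le> 0" if "z \<in> B" for z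
    using that c(8)[of "(z - p) \<bullet> m" "(z - p) \<bullet> n", folded frame_expand_at[OF c(1)]]
    by (simp add: B_def G_def)
  have qB: "?q \<in> B" "G ?q = sg * (y - \<eta> x)"
    using x y frame_inner[OF c(1)] by (auto simp: B_def G_def inner_add_left)
  have o1: "open (B \<inter> G -` {..<0})" and o2: "open (B \<inter> G -` {0<..})"
    using B G by (auto intro!: continuous_open_preimage)
  show i: "?q \<in> interior \<Omega>" if "sg * (y - \<eta> x) < 0"
    using that qB mem by (intro interiorI[OF o1]) auto
  show e: "?q \<notin> closure \<Omega>" if "sg * (y - \<eta> x) > 0"
  proof -
    have "(B \<inter> G -` {0<..}) \<inter> \<Omega> = {}"
      using mem by auto
    then have "(B \<inter> G -` {0<..}) \<inter> closure \<Omega> = {}"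
      using open_Int_closure_eq_empty[OF o2] by blast
    then show ?thesis
      using that qB by auto
  qed
  have "?q \<in> frontier \<Omega>" if yx: "y = \<eta> x"
  proof -
    have "?q \<in> \<Omega>"
      using c(8)[OF x y] yx by simp
    moreover have "?q \<notin> interior \<Omega>"
    proof
      assume "?q \<in> interior \<Omega>"
      then obtain e where e: "e > 0" "ball ?q e \<subseteq> \<Omega>"
        by (meson mem_interior)
      obtain k where k: "k > 0" "k < e" "\<bar>y + k\<bar> < h" "\<bar>y - k\<bar> < h"
        using small_shift[OF e(1) y] by blast
      then have k3: "\<bar>y + sg * k\<bar> < h"
        using c(4) by auto
      have "dist ?q (p + x *\<^sub>R m + (y + sg * k) *\<^sub>R n) = \<bar>sg * k\<bar> * norm n"
        by (simp add: dist_norm algebra_simps)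
      also have "\<dots> < e"
        using k c(1,4) by (auto simp: frame_def)
      finally have "p + x *\<^sub>R m + (y + sg * k) *\<^sub>R n \<in> \<Omega>"
        using e(2) by auto
      then have "sg * (y + sg * k - \<eta> x) \<le> 0"
        using c(8)[OF x k3] by blast
      then show False
        using k(1) c(4) yx by auto
    qed
    ultimately show ?thesis
      using closure_subset by (auto simp: frontier_def)
  qed
  then show "?q \<in> frontier \<Omega> \<longleftrightarrow> y = \<eta> x"
    using i e c(4) by (cases "y = \<eta> x"; cases "y < \<eta> x") (auto simp: frontier_def)
qed

lemma graph_chart_on_frontier:
  assumes ch: "graph_chart \<Omega> p m n r h sg \<eta>" and x: "\<bar>x\<bar> < r"
  shows "p + x *\<^sub>R m + \<eta> x *\<^sub>R n \<in> frontier \<Omega>"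
  using graph_chart_sides(3)[OF ch x graph_chartD(7)[OF ch x]] by simp

lemma graph_chart_box:
  assumes ch: "graph_chart \<Omega> p m n r h sg \<eta>"
    and z: "z \<in> frontier \<Omega>" "\<bar>(z - p) \<bullet> m\<bar> < r" "\<bar>(z - p) \<bullet> n\<bar> < h"
  shows "z = p + ((z - p) \<bullet> m) *\<^sub>R m + \<eta> ((z - p) \<bullet> m) *\<^sub>R n"
proof -
  note fr = graph_chartD(1)[OF ch]
  have eq: "(z - p) \<bullet> n = \<eta> ((z - p) \<bullet> m)"
    using graph_chart_sides(3)[OF ch z(2,3), folded frame_expand_at[OF fr]] z(1) by simp
  show ?thesis
    by (subst eq[symmetric]) (rule frame_expand_at[OF fr])
qed

lemma graph_chart_frontierD:
  assumes ch: "graph_chart \<Omega> p m n r h sg \<eta>" and z: "z \<in> frontier \<Omega>" "dist z p < r" "dist z p < h"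
  shows "\<bar>(z - p) \<bullet> m\<bar> < r" "z = p + ((z - p) \<bullet> m) *\<^sub>R m + \<eta> ((z - p) \<bullet> m) *\<^sub>R n"
proof -
  have *: "\<bar>(z - p) \<bullet> m\<bar> < r" "\<bar>(z - p) \<bullet> n\<bar> < h"
    using frame_coord_le[OF graph_chartD(1)[OF ch], of "z - p"] z by (simp_all add: dist_norm)
  then show "\<bar>(z - p) \<bullet> m\<bar> < r" "z = p + ((z - p) \<bullet> m) *\<^sub>R m + \<eta> ((z - p) \<bullet> m) *\<^sub>R n"
    using graph_chart_box[OF ch z(1) *] by auto
qed

lemma graph_chart_shrink:
  assumes ch: "graph_chart \<Omega> p m n r h sg \<eta>" and d: "d > 0"
  obtains r' h' where "graph_chart \<Omega> p m n r' h' sg \<eta>" "r' \<le> r" "h' \<le> h" "r' \<le> d" "h' \<le> d"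
proof -
  note c = graph_chartD[OF ch]
  define h' where "h' = min h d"
  have h': "h' > 0" "h' \<le> h" "h' \<le> d"
    using c d by (auto simp: h'_def)
  have "isCont \<eta> 0"
    using graph_chart_DERIV(1)[OF ch, of 0] c(2) DERIV_isCont by simp
  then obtain e where e: "e > 0" "\<And>x. dist x 0 < e \<Longrightarrow> dist (\<eta> x) (\<eta> 0) < h'"
    using h' unfolding continuous_at_eps_delta by blast
  define r' where "r' = min r (min e d)"
  have r': "r' > 0" "r' \<le> r" "r' \<le> d" "r' \<le> e"
    using c d e by (auto simp: r'_def)
  have "smooth_on {-r'<..<r'} \<eta>"
    by (rule smooth_on_subset[OF c(5)]) (use r' in auto)
  moreover have "\<bar>\<eta> x\<bar> < h'" if "\<bar>x\<bar> < r'" for x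
    using e(2)[of x] that r' c(6) by simp
  ultimately have "graph_chart \<Omega> p m n r' h' sg \<eta>"
    unfolding graph_chart_def using c r' h' by auto
  then show thesis
    using that r' h' by blast
qed

section \<open>Charts, boundary parametrizations and tangency\<close>

lemma graph_chart_curve_derivative:
  assumes ch: "graph_chart \<Omega> p m n r h sg \<eta>" and x: "\<bar>x\<bar> < r"
  shows "((\<lambda>x. p + x *\<^sub>R m + \<eta> x *\<^sub>R n) has_vector_derivative m + deriv \<eta> x *\<^sub>R n) (at x)"
  using graph_chart_DERIV(1)[OF ch x]
  by (auto intro!: derivative_eq_intros simp: has_real_derivative_iff_has_vector_derivative
      has_vector_derivative_def algebra_simps)

text \<open>\<open>boundary_param\<close> and \<open>tangency_set\<close> look only at parameter 0,
  hence the shift of the chart curve by \<open>x\<close>.\<close>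

lemma boundary_param_graph_chart:
  assumes ch: "graph_chart \<Omega> p m n r h sg \<eta>" and x: "\<bar>x\<bar> < r"
  defines "c \<equiv> \<lambda>t. p + (x + t) *\<^sub>R m + \<eta> (x + t) *\<^sub>R n"
  shows "boundary_param \<Omega> c (p + x *\<^sub>R m + \<eta> x *\<^sub>R n)"
    and "vector_derivative c (at 0) = m + deriv \<eta> x *\<^sub>R n"
proof -
  note c = graph_chartD[OF ch]
  define \<delta> where "\<delta> = r - \<bar>x\<bar>"
  have \<delta>: "\<delta> > 0" "\<And>t. t \<in> {-\<delta><..<\<delta>} \<Longrightarrow> \<bar>x + t\<bar> < r"
    using x by (auto simp: \<delta>_def)
  have der: "(c has_vector_derivative m + deriv \<eta> (x + t) *\<^sub>R n) (at t)" if "\<bar>x + t\<bar> < r" for t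
  proof -
    have "((\<lambda>t. x + t) has_real_derivative 1) (at t)"
      by (auto intro!: derivative_eq_intros)
    from vector_diff_chain_at[OF this[unfolded has_real_derivative_iff_has_vector_derivative]
      graph_chart_curve_derivative[OF ch that]]
    show ?thesis
      by (simp add: o_def c_def)
  qed
  then have vd: "vector_derivative c (at t) = m + deriv \<eta> (x + t) *\<^sub>R n" if "\<bar>x + t\<bar> < r" for t
    using that vector_derivative_at by blast
  then show "vector_derivative c (at 0) = m + deriv \<eta> x *\<^sub>R n"
    using x by simp
  have "k_times_diff_on k {-\<delta><..<\<delta>} (\<lambda>t. \<eta> (x + t *\<^sub>R 1 + 0 *\<^sub>R 0))" for k
    by (rule k_times_diff_on_compose_graph[OF _ k_times_diff_on_const c(5)])
      (use \<delta>(2) in \<open>force simp: abs_less_iff\<close>)+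
  then have \<eta>: "k_times_diff_on k {-\<delta><..<\<delta>} (\<lambda>t. \<eta> (x + t))" for k
    by simp
  have "k_times_diff_on k {-\<delta><..<\<delta>} (\<lambda>t. (p + x *\<^sub>R m) + (t *\<^sub>R m + \<eta> (x + t) *\<^sub>R n))" for k
    by (intro k_times_diff_on_add open_greaterThanLessThan k_times_diff_on_const
        k_times_diff_on_linear bounded_linear_scaleR_left
        k_times_diff_on_bounded_linear[OF open_greaterThanLessThan bounded_linear_scaleR_left \<eta>])
  then have sm: "smooth_on {-\<delta><..<\<delta>} c"
    by (simp add: smooth_on_def c_def algebra_simps)
  have nz: "m + a *\<^sub>R n \<noteq> 0" for a
    using frame_inner[OF c(1)] by (metis add.right_neutral inner_add_left inner_scaleR_left
        inner_zero_left mult_zero_right zero_neq_one)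
  show "boundary_param \<Omega> c (p + x *\<^sub>R m + \<eta> x *\<^sub>R n)"
    unfolding boundary_param_def
  proof (intro conjI exI[of _ \<delta>] ballI)
    show "c 0 = p + x *\<^sub>R m + \<eta> x *\<^sub>R n"
      by (simp add: c_def)
    fix t assume t: "t \<in> {-\<delta><..<\<delta>}"
    show "c t \<in> frontier \<Omega>"
      unfolding c_def using graph_chart_on_frontier[OF ch \<delta>(2)[OF t]] .
    show "vector_derivative c (at t) \<noteq> 0"
      using vd[OF \<delta>(2)[OF t]] nz by simp
  qed (use \<delta> sm in auto)
qed

text \<open>\<open>tangency_set\<close> allows any regular parametrization. For small times such a
  curve stays in the box, so its normal coordinate is \<open>\<eta>\<close> of its tangential one,
  and the chain rule makes its velocity a nonzero multiple of
  \<open>m + deriv \<eta> x *\<^sub>R n\<close>. Tangency thus becomes an equation in the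
  chart.\<close>

lemma graph_chart_tangency:
  assumes ch: "graph_chart \<Omega> p m n r h sg \<eta>" and x: "\<bar>x\<bar> < r"
  shows "p + x *\<^sub>R m + \<eta> x *\<^sub>R n \<in> tangency_set \<Omega> s \<theta> \<longleftrightarrow>
    (p + x *\<^sub>R m + \<eta> x *\<^sub>R n) \<bullet> unit_dir \<theta> = s \<and> (m + deriv \<eta> x *\<^sub>R n) \<bullet> unit_dir \<theta> = 0"
    (is "?q \<in> _ \<longleftrightarrow> ?R")
proof
  assume ?R
  then show "?q \<in> tangency_set \<Omega> s \<theta>"
    using boundary_param_graph_chart[OF ch x] graph_chart_on_frontier[OF ch x]
    unfolding tangency_set_def Line_def by auto
next
  note cd = graph_chartD[OF ch]
  note fi = frame_inner[OF cd(1)]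
  assume "?q \<in> tangency_set \<Omega> s \<theta>"
  then obtain c where L: "?q \<bullet> unit_dir \<theta> = s" and bp: "boundary_param \<Omega> c ?q"
      and v0: "vector_derivative c (at 0) \<bullet> unit_dir \<theta> = 0"
    by (auto simp: tangency_set_def Line_def)
  obtain \<delta> where \<delta>: "\<delta> > 0" "smooth_on {-\<delta><..<\<delta>} c"
      "\<And>t. t \<in> {-\<delta><..<\<delta>} \<Longrightarrow> c t \<in> frontier \<Omega> \<and> vector_derivative c (at t) \<noteq> 0"
      and c0: "c 0 = ?q"
    using bp by (auto simp: boundary_param_def)
  define v where "v = vector_derivative c (at 0)"
  have v: "(c has_vector_derivative v) (at 0)" "v \<noteq> 0"
    unfolding v_def using smooth_on_has_derivative[OF \<delta>(2), of 0] \<delta>(1) \<delta>(3)[of 0]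
    by (simp_all add: differentiableI vector_derivative_works[THEN iffD1])
  define \<xi> where "\<xi> = (\<lambda>t. (c t - p) \<bullet> m)"
  define \<upsilon> where "\<upsilon> = (\<lambda>t. (c t - p) \<bullet> n)"
  have d\<xi>: "(\<xi> has_real_derivative v \<bullet> m) (at 0)" and d\<upsilon>: "(\<upsilon> has_real_derivative v \<bullet> n) (at 0)"
    using v(1) unfolding \<xi>_def \<upsilon>_def has_vector_derivative_def has_field_derivative_def
    by (auto intro!: derivative_eq_intros simp: mult.commute)
  have \<xi>0: "\<xi> 0 = x" "\<upsilon> 0 = \<eta> x"
    using fi by (simp_all add: \<xi>_def \<upsilon>_def c0 inner_add_left)
  have "isCont (\<lambda>t. r - \<bar>\<xi> t\<bar>) 0" "isCont (\<lambda>t. h - \<bar>\<upsilon> t\<bar>) 0"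
    using DERIV_isCont[OF d\<xi>] DERIV_isCont[OF d\<upsilon>] by (auto intro!: continuous_intros)
  moreover have "r - \<bar>\<xi> 0\<bar> > 0" "h - \<bar>\<upsilon> 0\<bar> > 0"
    using \<xi>0 x cd(7)[OF x] by auto
  ultimately obtain d1 d2 where d1: "d1 > 0" "\<And>t. dist t 0 < d1 \<Longrightarrow> r - \<bar>\<xi> t\<bar> > 0"
      and d2: "d2 > 0" "\<And>t. dist t 0 < d2 \<Longrightarrow> h - \<bar>\<upsilon> t\<bar> > 0"
    using isCont_pos_near[where f = "\<lambda>t. r - \<bar>\<xi> t\<bar>"] isCont_pos_near[where f = "\<lambda>t. h - \<bar>\<upsilon> t\<bar>"]
    by (metis (no_types, lifting))
  define d where "d = min \<delta> (min d1 d2)"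
  have d: "d > 0"
    using \<delta> d1 d2 by (simp add: d_def)
  have eq: "\<upsilon> t = \<eta> (\<xi> t)" if "t \<in> ball 0 d" for t
  proof -
    have "c t \<in> frontier \<Omega>"
      using \<delta>(3)[of t] that by (auto simp: d_def abs_less_iff)
    moreover have "c t = p + \<xi> t *\<^sub>R m + \<upsilon> t *\<^sub>R n"
      unfolding \<xi>_def \<upsilon>_def by (rule frame_expand_at[OF cd(1)])
    ultimately show ?thesis
      using graph_chart_sides(3)[OF ch, of "\<xi> t" "\<upsilon> t"] d1(2)[of t] d2(2)[of t] that
      by (simp add: d_def)
  qed
  have "((\<lambda>t. \<eta> (\<xi> t)) has_real_derivative deriv \<eta> x * (v \<bullet> m)) (at 0)"
    using DERIV_chain2[of \<eta> "deriv \<eta> x" \<xi> 0 "v \<bullet> m" UNIV] graph_chart_DERIV(1)[OF ch x] d\<xi> \<xi>0 by simp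
  then have "(\<upsilon> has_real_derivative deriv \<eta> x * (v \<bullet> m)) (at 0)"
    by (rule has_field_derivative_transform_within_open[of _ _ _ "ball 0 d"]) (use d eq in auto)
  then have vn: "v \<bullet> n = deriv \<eta> x * (v \<bullet> m)"
    using d\<upsilon> DERIV_unique by blast
  have "v = (v \<bullet> m) *\<^sub>R m + (deriv \<eta> x * (v \<bullet> m)) *\<^sub>R n"
    using frame_expand[OF cd(1), of v] vn by metis
  also have "\<dots> = (v \<bullet> m) *\<^sub>R (m + deriv \<eta> x *\<^sub>R n)"
    by (simp add: algebra_simps)
  finally have ve: "v = (v \<bullet> m) *\<^sub>R (m + deriv \<eta> x *\<^sub>R n)" .
  have "v \<bullet> m \<noteq> 0"
    using arg_cong[OF ve, of norm] v(2) by auto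
  moreover have "v \<bullet> unit_dir \<theta> = 0"
    using v0 by (simp add: v_def)
  then have "(v \<bullet> m) * ((m + deriv \<eta> x *\<^sub>R n) \<bullet> unit_dir \<theta>) = 0"
    using arg_cong[OF ve, of "\<lambda>z. z \<bullet> unit_dir \<theta>"] by (simp only: inner_scaleR_left)
  ultimately show ?R
    using L by simp
qed

text \<open>The gradient of the defining function at \<open>p\<close> either has a component along
  \<open>n\<close>, and the boundary is a graph over \<open>m\<close>, or it is parallel to
  \<open>m\<close>, and the boundary is a graph over \<open>n\<close> with slope 0. When
  \<open>m\<close> is normal to a line through \<open>p\<close> and \<open>n\<close> runs along it,
  the second alternative is tangency of that line.\<close>

lemma graph_chart_cases:
  assumes sb: "smooth_boundary \<Omega>" and cl: "closed \<Omega>" and p: "p \<in> frontier \<Omega>" and fr: "frame m n"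
  obtains r h sg \<eta> where "graph_chart \<Omega> p m n r h sg \<eta>"
  | r h sg \<eta> where "graph_chart \<Omega> p n m r h sg \<eta>" "deriv \<eta> 0 = 0"
proof -
  from sb[unfolded smooth_boundary_def, THEN bspec, OF p]
  obtain U and \<rho> :: "plane \<Rightarrow> real" where *: "open U \<and> p \<in> U \<and> smooth_on U \<rho> \<and>
      (\<forall>x\<in>U. \<exists>v. frechet_derivative \<rho> (at x) v \<noteq> 0) \<and> \<Omega> \<inter> U = {x \<in> U. \<rho> x \<le> 0}"
    by (elim exE)
  then have U: "open U" "p \<in> U" "smooth_on U \<rho>" and \<Omega>: "\<Omega> \<inter> U = {x \<in> U. \<rho> x \<le> 0}"
      and nz: "\<exists>v. frechet_derivative \<rho> (at p) v \<noteq> 0"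
    by auto
  have "p \<in> \<Omega>"
    using p cl frontier_subset_eq by blast
  then have "p \<in> {x \<in> U. \<rho> x \<le> 0}"
    using U(2) unfolding \<Omega>[symmetric] by simp
  then have "\<rho> p \<le> 0"
    by simp
  moreover have "\<not> \<rho> p < 0"
  proof
    assume neg: "\<rho> p < 0"
    have "open (U \<inter> \<rho> -` {..<0})"
      by (rule continuous_open_preimage[OF smooth_on_imp_continuous_on[OF U(3)] U(1) open_lessThan])
    moreover have "x \<in> \<Omega>" if "x \<in> U \<inter> \<rho> -` {..<0}" for x
    proof -
      have "x \<in> {x \<in> U. \<rho> x \<le> 0}"
        using that by simp
      then show ?thesis
        unfolding \<Omega>[symmetric] by simp
    qed
    ultimately have "p \<in> interior \<Omega>"
      using neg U(2) by (intro interiorI[of "U \<inter> \<rho> -` {..<0}"] subsetI) simp_all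
    then show False
      using p by (simp add: frontier_def)
  qed
  ultimately have p0: "\<rho> p = 0"
    by simp
  define D where "D = frechet_derivative \<rho> (at p)"
  show thesis
  proof (cases "D n = 0")
    case False
    from graph_chart_exists[OF fr U \<Omega> p0 this[unfolded D_def]]
    obtain r h sg \<eta> where "graph_chart \<Omega> p m n r h sg \<eta>"
      by (elim exE conjE)
    then show thesis
      by (rule that(1))
  next
    case True
    have lin: "linear D"
      unfolding D_def using smooth_on_has_derivative[OF U(3,2)] has_derivative_linear by blast
    have "D m \<noteq> 0"
    proof
      assume "D m = 0"
      then have "D v = 0" for v
        by (subst frame_expand[OF fr, of v]) (simp add: linear_add[OF lin] linear_cmul[OF lin] True)
      then show False
        using nz by (simp add: D_def)
    qed
    from graph_chart_exists[OF frame_swap[OF fr] U \<Omega> p0 this[unfolded D_def]]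
    obtain r h sg \<eta> where *: "graph_chart \<Omega> p n m r h sg \<eta>" "deriv \<eta> 0 * D m = - D n"
      unfolding D_def by (elim exE conjE)
    then have "deriv \<eta> 0 = 0"
      using True \<open>D m \<noteq> 0\<close> by simp
    with *(1) show thesis
      by (rule that(2))
  qed
qed

section \<open>Line integrals across the boundary\<close>

definition line_point :: "real \<Rightarrow> real \<Rightarrow> real \<Rightarrow> plane" where
  "line_point \<theta> s t = s *\<^sub>R unit_dir \<theta> + t *\<^sub>R unit_dir (\<theta> + pi / 2)"

lemma line_point_shift:
  "line_point \<theta> s t + x *\<^sub>R unit_dir \<theta> + y *\<^sub>R unit_dir (\<theta> + pi / 2) = line_point \<theta> (s + x) (t + y)"
  by (simp add: line_point_def algebra_simps)

lemma line_point_inner: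
  "line_point \<theta> s t \<bullet> unit_dir \<theta> = s" "line_point \<theta> s t \<bullet> unit_dir (\<theta> + pi / 2) = t"
  using frame_inner[OF frame_unit_dir[of \<theta>]] by (simp_all add: line_point_def inner_add_left)

lemma line_point_eq: "x = line_point \<theta> (x \<bullet> unit_dir \<theta>) (x \<bullet> unit_dir (\<theta> + pi / 2))"
  unfolding line_point_def by (rule frame_expand[OF frame_unit_dir])

lemma dist_line_point: "dist (line_point \<theta> s t) (line_point \<theta> s' t') \<le> \<bar>s - s'\<bar> + \<bar>t - t'\<bar>"
proof -
  have "line_point \<theta> s t - line_point \<theta> s' t' =
      (s - s') *\<^sub>R unit_dir \<theta> + (t - t') *\<^sub>R unit_dir (\<theta> + pi / 2)"
    by (simp add: line_point_def algebra_simps)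
  then show ?thesis
    using frame_norm_le[OF frame_unit_dir] by (simp add: dist_norm)
qed

lemma line_point_ball:
  assumes "line_point \<theta> s t \<in> ball 0 R"
  shows "\<bar>s\<bar> < R" "\<bar>t\<bar> < R"
  using frame_coord_le[OF frame_unit_dir, of "line_point \<theta> s t" \<theta>] assms
  by (auto simp: line_point_inner)

lemma continuous_on_line_point: "continuous_on A (line_point \<theta> s)"
  unfolding line_point_def by (intro continuous_intros)

lemma integrable_line:
  fixes H :: "plane \<Rightarrow> real"
  assumes "continuous_on UNIV H" "compact \<Omega>"
  shows "integrable lborel (\<lambda>t. H (line_point \<theta> s t) * indicator \<Omega> (line_point \<theta> s t))"
proof -
  define S where "S = line_point \<theta> s -` \<Omega>"
  obtain B where B: "\<And>x. x \<in> \<Omega> \<Longrightarrow> norm x < B"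
    using compact_imp_bounded[OF assms(2)] by (meson bounded_pos_less)
  have "closed S"
    unfolding S_def using assms(2)
    by (intro continuous_closed_vimage compact_imp_closed)
      (auto intro: continuous_on_line_point[of UNIV, THEN continuous_on_interior])
  moreover have "S \<subseteq> {-B..B}"
    using B line_point_ball(2)[of \<theta> s _ B] by (force simp: S_def)
  ultimately have "compact S"
    by (metis bounded_closed_interval bounded_subset compact_eq_bounded_closed)
  moreover have "continuous_on S (\<lambda>t. H (line_point \<theta> s t))"
    by (rule continuous_on_compose2[OF assms(1) continuous_on_line_point subset_UNIV])
  ultimately have "integrable lborel (\<lambda>t. indicator S t *\<^sub>R H (line_point \<theta> s t))"
    by (rule borel_integrable_compact)
  then show ?thesis
    by (simp add: S_def indicator_def if_distrib mult.commute cong: if_cong)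
qed

lemma line_integral_eq:
  "line_integral s \<theta> g = (LINT t|lborel. g (line_point \<theta> s t))"
  by (simp add: line_integral_def line_point_def)

lemma DERIV_linear_bound:
  fixes f :: "real \<Rightarrow> real"
  assumes "(f has_real_derivative D) (at 0)" "f 0 = 0" "\<epsilon> > 0"
  obtains d where "d > 0" "\<And>x. \<bar>x\<bar> < d \<Longrightarrow> \<bar>f x - D * x\<bar> \<le> \<epsilon> * \<bar>x\<bar>"
proof -
  have "(f has_derivative (*) D) (at 0)"
    using assms(1) by (simp add: has_field_derivative_def)
  then obtain d where "d > 0" "\<And>y. norm (y - 0) < d \<Longrightarrow> norm (f y - f 0 - D * (y - 0)) \<le> \<epsilon> * norm (y - 0)"
    unfolding has_derivative_at_alt using assms(3) by blast
  then show thesis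
    using that assms(2) by auto
qed

abbreviation differ :: "plane set \<Rightarrow> real \<Rightarrow> real \<Rightarrow> real \<Rightarrow> real \<Rightarrow> bool" where
  "differ \<Omega> \<theta> s0 \<sigma> t \<equiv> (line_point \<theta> (s0 + \<sigma>) t \<in> \<Omega>) \<noteq> (line_point \<theta> (s0 - \<sigma>) t \<in> \<Omega>)"

lemma transversal_graph_chart:
  assumes "closed \<Omega>" "smooth_boundary \<Omega>" and fp: "line_point \<theta> s t \<in> frontier \<Omega>"
    and nt: "line_point \<theta> s t \<notin> tangency_set \<Omega> s \<theta>"
  shows "\<exists>r h sg \<eta>. graph_chart \<Omega> (line_point \<theta> s t) (unit_dir \<theta>) (unit_dir (\<theta> + pi / 2)) r h sg \<eta>"
proof (rule graph_chart_cases[OF assms(2,1) fp frame_unit_dir[of \<theta>]])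
  fix r h sg \<eta>
  assume c: "graph_chart \<Omega> (line_point \<theta> s t) (unit_dir (\<theta> + pi / 2)) (unit_dir \<theta>) r h sg \<eta>"
    "deriv \<eta> 0 = 0"
  have "line_point \<theta> s t \<in> tangency_set \<Omega> s \<theta>"
    using graph_chart_tangency[OF c(1), of 0 s \<theta>] graph_chartD[OF c(1)] c(2)
      frame_inner[OF frame_unit_dir[of \<theta>]] by (simp add: line_point_inner)
  then show ?thesis
    using nt by simp
qed blast

text \<open>In the chart the offset \<open>\<sigma>\<close> is the abscissa and
  \<open>t - t1\<close> the ordinate. The two lines can differ only for \<open>t - t1\<close>
  between \<open>\<eta> (-\<sigma>)\<close> and \<open>\<eta> \<sigma>\<close>, and both are at most
  \<open>K * \<sigma>\<close> in absolute value with \<open>K\<close> one more than the absolute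
  slope. Off the frontier nothing differs.\<close>

lemma transversal_local:
  assumes "closed \<Omega>"
    and ch: "line_point \<theta> s0 t1 \<in> frontier \<Omega> \<Longrightarrow>
      \<exists>r h sg \<eta>. graph_chart \<Omega> (line_point \<theta> s0 t1) (unit_dir \<theta>) (unit_dir (\<theta> + pi / 2)) r h sg \<eta>"
  shows "\<exists>d>0. \<exists>K\<ge>0. \<forall>\<sigma> t. 0 < \<sigma> \<and> \<sigma> < d \<and> \<bar>t - t1\<bar> < d \<and>
    differ \<Omega> \<theta> s0 \<sigma> t \<longrightarrow> \<bar>t - t1\<bar> \<le> K * \<sigma>"
proof (cases "line_point \<theta> s0 t1 \<in> frontier \<Omega>")
  case False
  define p where "p = line_point \<theta> s0 t1"
  have "p \<in> interior \<Omega> \<or> p \<in> - \<Omega>"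
    using False closure_subset by (auto simp: frontier_def p_def)
  then have "\<exists>e>0. ball p e \<subseteq> interior \<Omega> \<or> ball p e \<subseteq> - \<Omega>"
    using open_contains_ball_eq[OF open_interior, of p \<Omega>]
      open_contains_ball_eq[of "- \<Omega>" p] assms(1) by auto
  then obtain e where e: "e > 0" "ball p e \<subseteq> interior \<Omega> \<or> ball p e \<subseteq> - \<Omega>"
    by blast
  have near: "line_point \<theta> (s0 + \<sigma>) t \<in> ball p e" if "\<bar>\<sigma>\<bar> < e/2" "\<bar>t - t1\<bar> < e/2" for \<sigma> t
    using dist_line_point[of \<theta> "s0 + \<sigma>" t s0 t1] that by (simp add: p_def dist_commute)
  have "\<bar>t - t1\<bar> \<le> 0 * \<sigma>" if "0 < \<sigma>" "\<sigma> < e/2" "\<bar>t - t1\<bar> < e/2"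
    "differ \<Omega> \<theta> s0 \<sigma> t" for \<sigma> t
    using near[of \<sigma> t] near[of "-\<sigma>" t] that e(2) interior_subset[of \<Omega>] by auto
  then show ?thesis
    using e(1) by (intro exI[of _ "e/2"] conjI exI[of _ 0]) auto
next
  case True
  then obtain r h sg \<eta> where
    ch: "graph_chart \<Omega> (line_point \<theta> s0 t1) (unit_dir \<theta>) (unit_dir (\<theta> + pi / 2)) r h sg \<eta>"
    using assms(2) by blast
  note c = graph_chartD[OF ch]
  obtain d where d: "d > 0" "\<And>x. \<bar>x\<bar> < d \<Longrightarrow> \<bar>\<eta> x - deriv \<eta> 0 * x\<bar> \<le> 1 * \<bar>x\<bar>"
    using DERIV_linear_bound[OF graph_chart_DERIV(1)[OF ch, of 0] c(6), of 1] c(2) by auto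
  define K where "K = \<bar>deriv \<eta> 0\<bar> + 1"
  have K: "\<bar>\<eta> x\<bar> \<le> K * \<bar>x\<bar>" if "\<bar>x\<bar> < d" for x
    using d(2)[OF that] abs_triangle_ineq[of "\<eta> x - deriv \<eta> 0 * x" "deriv \<eta> 0 * x"]
    by (simp add: K_def algebra_simps abs_mult)
  define d' where "d' = min d (min r h)"
  have "\<bar>t - t1\<bar> \<le> K * \<sigma>" if "0 < \<sigma>" "\<sigma> < d'" "\<bar>t - t1\<bar> < d'"
    "differ \<Omega> \<theta> s0 \<sigma> t" for \<sigma> t
  proof -
    have m: "line_point \<theta> (s0 + x) t \<in> \<Omega> \<longleftrightarrow> sg * ((t - t1) - \<eta> x) \<le> 0" if "\<bar>x\<bar> < d'" for x
      using c(8)[of x "t - t1"] that \<open>\<bar>t - t1\<bar> < d'\<close>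
      by (simp add: line_point_shift d'_def)
    have "(sg * ((t - t1) - \<eta> \<sigma>) \<le> 0) \<noteq> (sg * ((t - t1) - \<eta> (-\<sigma>)) \<le> 0)"
      using m[of \<sigma>] m[of "-\<sigma>"] that by auto
    moreover have "\<bar>\<eta> \<sigma>\<bar> \<le> K * \<sigma>" "\<bar>\<eta> (-\<sigma>)\<bar> \<le> K * \<sigma>"
      using K[of \<sigma>] K[of "-\<sigma>"] that by (auto simp: d'_def)
    ultimately show ?thesis
      using c(4) by auto
  qed
  moreover have "d' > 0" "K \<ge> 0"
    using c d by (auto simp: d'_def K_def)
  ultimately show ?thesis
    by blast
qed

text \<open>Compactness of the remaining part of \<open>{-1..1}\<close> reduces the local estimates
  to finitely many centres. \<open>E\<close> is the exempted part of the line: empty for a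
  transversal line, an interval around the contact point for a tangent one.\<close>

lemma differ_cover:
  assumes "closed \<Omega>" "\<Omega> \<subseteq> ball 0 1" "open E"
    and ch: "\<And>t. t \<notin> E \<Longrightarrow> line_point \<theta> s0 t \<in> frontier \<Omega> \<Longrightarrow>
      \<exists>r h sg \<eta>. graph_chart \<Omega> (line_point \<theta> s0 t) (unit_dir \<theta>) (unit_dir (\<theta> + pi / 2)) r h sg \<eta>"
  obtains d K T where "d > 0" "K \<ge> 0" "finite T"
    "\<And>\<sigma> t. 0 < \<sigma> \<Longrightarrow> \<sigma> < d \<Longrightarrow> t \<notin> E \<Longrightarrow>
      differ \<Omega> \<theta> s0 \<sigma> t \<Longrightarrow> \<exists>t1\<in>T. \<bar>t - t1\<bar> \<le> K * \<sigma>"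
proof -
  define C where "C = {-1..1} - E"
  define P where "P = (\<lambda>t1 d K. d > 0 \<and> K \<ge> 0 \<and> (\<forall>\<sigma> t. 0 < \<sigma> \<and> \<sigma> < d \<and> \<bar>t - t1\<bar> < d \<and>
    differ \<Omega> \<theta> s0 \<sigma> t \<longrightarrow> \<bar>t - t1\<bar> \<le> K * \<sigma>))"
  have "\<exists>d K. P t1 d K" if "t1 \<in> C" for t1
  proof -
    have "t1 \<notin> E"
      using that by (simp add: C_def)
    from transversal_local[OF assms(1) ch[OF this]] show ?thesis
      by (auto simp: P_def)
  qed
  then obtain d K where "\<And>t1. t1 \<in> C \<Longrightarrow> P t1 (d t1) (K t1)"
    by metis
  then have dK: "\<And>t1. t1 \<in> C \<Longrightarrow> d t1 > (0::real)" "\<And>t1. t1 \<in> C \<Longrightarrow> K t1 \<ge> (0::real)"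
    "\<And>t1 \<sigma> t. t1 \<in> C \<Longrightarrow> 0 < \<sigma> \<Longrightarrow> \<sigma> < d t1 \<Longrightarrow> \<bar>t - t1\<bar> < d t1 \<Longrightarrow>
      differ \<Omega> \<theta> s0 \<sigma> t \<Longrightarrow> \<bar>t - t1\<bar> \<le> K t1 * \<sigma>"
    by (simp_all add: P_def)
  have "compact C"
    unfolding C_def using assms(3) by (intro compact_diff) auto
  moreover have "C \<subseteq> (\<Union>t\<in>C. ball t (d t))"
    using dK(1) by force
  ultimately obtain T where T: "T \<subseteq> C" "finite T" "C \<subseteq> (\<Union>t\<in>T. ball t (d t))"
    by (elim compactE_image) auto
  \<comment> \<open>\<open>T\<close> may be empty, so the minimum gets the default 1 and the maximum
    the default 0.\<close>
  define d' where "d' = Min (insert 1 (d ` T))"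
  define K' where "K' = Max (insert 0 (K ` T))"
  have d': "d' > 0" "\<And>t. t \<in> T \<Longrightarrow> d' \<le> d t"
    using T dK(1) by (auto simp: d'_def Min_gr_iff)
  have K': "K' \<ge> 0" "\<And>t. t \<in> T \<Longrightarrow> K t \<le> K'"
    using T by (auto simp: K'_def)
  show thesis
  proof (rule that[OF d'(1) K'(1) T(2)])
    fix \<sigma> t assume \<sigma>: "0 < \<sigma>" "\<sigma> < d'" and t: "t \<notin> E"
      and differ: "differ \<Omega> \<theta> s0 \<sigma> t"
    then have "\<bar>t\<bar> < 1"
      using assms(2) line_point_ball(2) by blast
    then have "t \<in> C"
      using t by (auto simp: C_def)
    then obtain t1 where t1: "t1 \<in> T" "\<bar>t - t1\<bar> < d t1"
      using T(3) by (auto simp: dist_real_def abs_minus_commute)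
    have "\<bar>t - t1\<bar> \<le> K t1 * \<sigma>"
      using dK(3)[of t1 \<sigma> t] t1 T(1) \<sigma> d'(2)[OF t1(1)] differ by auto
    also have "\<dots> \<le> K' * \<sigma>"
      using K'(2)[OF t1(1)] \<sigma>(1) by (simp add: mult_right_mono)
    finally show "\<exists>t1\<in>T. \<bar>t - t1\<bar> \<le> K' * \<sigma>"
      using t1(1) by blast
  qed
qed

definition sym_lipschitz :: "(real \<Rightarrow> real) \<Rightarrow> real \<Rightarrow> bool" where
  "sym_lipschitz F s0 \<longleftrightarrow>
     (\<exists>C d. d > 0 \<and> (\<forall>\<sigma>. 0 < \<sigma> \<and> \<sigma> < d \<longrightarrow> \<bar>F (s0 + \<sigma>) - F (s0 - \<sigma>)\<bar> \<le> C * \<sigma>))"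

lemma integral_box_sum:
  assumes "finite T" "k \<ge> 0"
  shows "integrable lborel (\<lambda>t::real. \<Sum>t1\<in>T. indicator {t1 - k..t1 + k} t :: real)"
    and "(LINT t|lborel. (\<Sum>t1\<in>T. indicator {t1 - k..t1 + k} t)) = 2 * k * card T"
  using assms by (simp_all add: algebra_simps)

lemma integral_box_bound:
  fixes A B k :: real
  assumes "finite T" "k \<ge> 0"
  shows "integrable lborel (\<lambda>t. A * indicator {-1..1} t + B * (\<Sum>t1\<in>T. indicator {t1 - k..t1 + k} t))"
    (is ?I)
    and "(LINT t|lborel. A * indicator {-1..1} t + B * (\<Sum>t1\<in>T. indicator {t1 - k..t1 + k} t))
      = 2 * A + 2 * B * k * card T" (is ?E)
proof -
  have i: "integrable lborel (\<lambda>t::real. A * indicator {-1..1} t)"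
    by (intro integrable_mult_right) simp
  note j = integrable_mult_right[OF integral_box_sum(1)[OF assms], of B]
  show ?I
    by (rule Bochner_Integration.integrable_add[OF i j])
  have "(LINT t|lborel. A * indicator {-1..1} (t::real)) = 2 * A"
    by simp
  moreover have "(LINT t|lborel. B * (\<Sum>t1\<in>T. indicator {t1 - k..t1 + k} t)) = 2 * B * k * card T"
    unfolding Bochner_Integration.integral_mult_right_zero integral_box_sum(2)[OF assms] by simp
  ultimately show ?E
    unfolding Bochner_Integration.integral_add[OF i j] by simp
qed

lemma sum_box_ge:
  fixes t k :: real
  assumes "finite T" "\<exists>t1\<in>T. \<bar>t - t1\<bar> \<le> k"
  shows "(\<Sum>t1\<in>T. indicator {t1 - k..t1 + k} t :: real) \<ge> 1"
proof -
  obtain t1 where t1: "t1 \<in> T" "\<bar>t - t1\<bar> \<le> k"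
    using assms by blast
  then have "t \<in> {t1 - k..t1 + k}"
    using abs_le_D1[OF t1(2)] abs_le_D2[OF t1(2)] by simp
  then have "(1::real) = indicator {t1 - k..t1 + k} t"
    by simp
  also have "\<dots> \<le> (\<Sum>t1\<in>T. indicator {t1 - k..t1 + k} t)"
    using assms t1 by (intro member_le_sum) auto
  finally show ?thesis .
qed

section \<open>Lipschitz behaviour at transversal and at tangent lines\<close>

context
  fixes \<Omega> :: "plane set" and H :: "plane \<Rightarrow> real" and L M :: real
  assumes \<Omega>: "compact \<Omega>" "\<Omega> \<subseteq> ball 0 1" "smooth_boundary \<Omega>"
    and H: "continuous_on UNIV H" "\<And>x y. x \<in> ball 0 1 \<Longrightarrow> y \<in> ball 0 1 \<Longrightarrow> \<bar>H x - H y\<bar> \<le> L * dist x y"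
      "\<And>x. x \<in> ball 0 1 \<Longrightarrow> \<bar>H x\<bar> \<le> M" "L \<ge> 0" "M \<ge> 0"
begin

private definition "G \<theta> s0 \<sigma> t =
  H (line_point \<theta> (s0 + \<sigma>) t) * indicator \<Omega> (line_point \<theta> (s0 + \<sigma>) t)
  - H (line_point \<theta> (s0 - \<sigma>) t) * indicator \<Omega> (line_point \<theta> (s0 - \<sigma>) t)"

private lemma integrable_G: "integrable lborel (G \<theta> s0 \<sigma>)"
  unfolding G_def by (intro Bochner_Integration.integrable_diff integrable_line H \<Omega>)

private lemma integral_G:
  "line_integral (s0 + \<sigma>) \<theta> (\<lambda>x. H x * indicator \<Omega> x) - line_integral (s0 - \<sigma>) \<theta> (\<lambda>x. H x * indicator \<Omega> x)
    = (LINT t|lborel. G \<theta> s0 \<sigma> t)"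
  unfolding line_integral_eq G_def
  by (intro Bochner_Integration.integral_diff[symmetric] integrable_line H \<Omega>)

private lemma G_same:
  assumes "\<not> differ \<Omega> \<theta> s0 \<sigma> t" "\<sigma> > 0"
  shows "\<bar>G \<theta> s0 \<sigma> t\<bar> \<le> 2 * L * \<sigma> * indicator {-1..1} t"
proof (cases "line_point \<theta> (s0 + \<sigma>) t \<in> \<Omega>")
  case True
  then have i: "line_point \<theta> (s0 + \<sigma>) t \<in> ball 0 1" "line_point \<theta> (s0 - \<sigma>) t \<in> ball 0 1"
    using assms \<Omega>(2) by auto
  have "\<bar>G \<theta> s0 \<sigma> t\<bar> \<le> L * dist (line_point \<theta> (s0 + \<sigma>) t) (line_point \<theta> (s0 - \<sigma>) t)"
    using H(2)[OF i] True assms(1) by (simp add: G_def)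
  also have "\<dots> \<le> L * (2 * \<sigma>)"
    using dist_line_point[of \<theta> "s0 + \<sigma>" t "s0 - \<sigma>" t] assms(2) H(4) by (intro mult_left_mono) auto
  finally show ?thesis
    using line_point_ball(2)[OF i(1)] by (simp add: abs_less_iff)
next
  case False
  then show ?thesis
    using assms H(4) by (simp add: G_def indicator_def)
qed

private lemma G_le: "\<bar>G \<theta> s0 \<sigma> t\<bar> \<le> M"
  if "differ \<Omega> \<theta> s0 \<sigma> t"
  using that H(3)[of "line_point \<theta> (s0 + \<sigma>) t"] H(3)[of "line_point \<theta> (s0 - \<sigma>) t"] \<Omega>(2)
  by (auto simp: G_def indicator_def)

text \<open>Where the two lines agree about \<open>\<Omega>\<close>, the integrands differ by at
  most \<open>2 * L * \<sigma>\<close>; where they disagree, by at most \<open>M\<close>, and only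
  on a set of measure at most \<open>2 * K * \<sigma> * card T\<close>.\<close>

lemma transversal_sym_lipschitz:
  assumes "tangency_set \<Omega> s0 \<theta> = {}"
  shows "sym_lipschitz (\<lambda>s. line_integral s \<theta> (\<lambda>x. H x * indicator \<Omega> x)) s0"
proof -
  have cl: "closed \<Omega>"
    using \<Omega>(1) by (rule compact_imp_closed)
  obtain d K T where d: "d > 0" "K \<ge> 0" "finite T"
    "\<And>\<sigma> t. 0 < \<sigma> \<Longrightarrow> \<sigma> < d \<Longrightarrow> t \<notin> {} \<Longrightarrow>
      differ \<Omega> \<theta> s0 \<sigma> t \<Longrightarrow> \<exists>t1\<in>T. \<bar>t - t1\<bar> \<le> K * \<sigma>"
    by (rule differ_cover[OF cl \<Omega>(2) open_empty, of \<theta> s0])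
      (use transversal_graph_chart[OF cl \<Omega>(3)] assms in auto)
  show ?thesis
    unfolding sym_lipschitz_def integral_G
  proof (intro exI conjI allI impI)
    fix \<sigma> assume \<sigma>: "0 < \<sigma> \<and> \<sigma> < d"
    let ?B = "\<lambda>t. 2 * L * \<sigma> * indicator {-1..1} t + M * (\<Sum>t1\<in>T. indicator {t1 - K * \<sigma>..t1 + K * \<sigma>} t)"
    have K\<sigma>: "K * \<sigma> \<ge> 0"
      using d(2) \<sigma> by simp
    have "\<bar>G \<theta> s0 \<sigma> t\<bar> \<le> ?B t" for t
    proof (cases "\<not> differ \<Omega> \<theta> s0 \<sigma> t")
      case True
      have "0 \<le> M * (\<Sum>t1\<in>T. indicator {t1 - K * \<sigma>..t1 + K * \<sigma>} t)"
        using H(5) by (intro mult_nonneg_nonneg sum_nonneg) auto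
      then show ?thesis
        using G_same[OF True] \<sigma> by linarith
    next
      case False
      have "M * 1 \<le> M * (\<Sum>t1\<in>T. indicator {t1 - K * \<sigma>..t1 + K * \<sigma>} t)"
        using d(4)[of \<sigma> t] \<sigma> False H(5) by (intro mult_left_mono sum_box_ge d(3)) auto
      moreover have "0 \<le> 2 * L * \<sigma> * indicator {-1..1} t"
        using H(4) \<sigma> by simp
      ultimately show ?thesis
        using G_le[OF notnotD[OF False]] by linarith
    qed
    note bound = this
    have iB: "integrable lborel ?B"
      by (rule integral_box_bound(1)[OF d(3) K\<sigma>])
    have "\<bar>LINT t|lborel. G \<theta> s0 \<sigma> t\<bar> \<le> (LINT t|lborel. \<bar>G \<theta> s0 \<sigma> t\<bar>)"
      by (rule integral_abs_bound)
    also have "\<dots> \<le> (LINT t|lborel. ?B t)"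
      by (rule integral_mono[OF integrable_abs[OF integrable_G] iB bound])
    also have "\<dots> = 2 * (2 * L * \<sigma>) + 2 * M * (K * \<sigma>) * card T"
      by (rule integral_box_bound(2)[OF d(3) K\<sigma>])
    also have "\<dots> = (4 * L + 2 * M * K * card T) * \<sigma>"
      by (simp add: algebra_simps)
    finally show "\<bar>LINT t|lborel. G \<theta> s0 \<sigma> t\<bar> \<le> (4 * L + 2 * M * K * card T) * \<sigma>" .
  qed (rule d(1))
qed

text \<open>Since \<open>\<eta> x = o(x)\<close> at the tangency point, the set of \<open>t\<close> on which the two lines at distance
  \<open>\<sigma>\<close> differ contains intervals of length \<open>K \<sigma>\<close> for every \<open>K\<close>, and all contributions near that
  point have the same sign.\<close>

lemma tangent_not_sym_lipschitz:
  assumes "tangency_set \<Omega> s0 \<theta> = {p}" and pos: "\<mu> > 0" "\<And>x. x \<in> \<Omega> \<Longrightarrow> H x \<ge> \<mu>"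
  shows "\<not> sym_lipschitz (\<lambda>s. line_integral s \<theta> (\<lambda>x. H x * indicator \<Omega> x)) s0"
proof
  assume "sym_lipschitz (\<lambda>s. line_integral s \<theta> (\<lambda>x. H x * indicator \<Omega> x)) s0"
  then obtain C dC where dC: "dC > 0" "\<And>\<sigma>. 0 < \<sigma> \<Longrightarrow> \<sigma> < dC \<Longrightarrow> \<bar>LINT t|lborel. G \<theta> s0 \<sigma> t\<bar> \<le> C * \<sigma>"
    unfolding sym_lipschitz_def integral_G by blast
  have cl: "closed \<Omega>"
    using \<Omega>(1) by (rule compact_imp_closed)
  note fi = frame_inner[OF frame_unit_dir[of \<theta>]]
  define t0 where "t0 = p \<bullet> unit_dir (\<theta> + pi / 2)"
  have pT: "p \<in> frontier \<Omega>" "p \<bullet> unit_dir \<theta> = s0"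
    using assms(1) by (auto simp: tangency_set_def Line_def)
  then have p: "p = line_point \<theta> s0 t0"
    using line_point_eq[of p \<theta>] by (simp add: t0_def)
  \<comment> \<open>A chart over the normal direction of the line would have a tangent transversal
    to it. Hence the boundary is a graph over the direction of the line, with slope 0 at
    \<open>p\<close>.\<close>
  obtain r h sg \<eta> where ch0: "graph_chart \<Omega> p (unit_dir (\<theta> + pi / 2)) (unit_dir \<theta>) r h sg \<eta>"
    and \<eta>0: "deriv \<eta> 0 = 0"
  proof (rule graph_chart_cases[OF \<Omega>(3) cl pT(1) frame_unit_dir[of \<theta>]])
    fix r h sg \<eta> assume c: "graph_chart \<Omega> p (unit_dir \<theta>) (unit_dir (\<theta> + pi / 2)) r h sg \<eta>"
    then have False
      using graph_chart_tangency[OF c, of 0 s0 \<theta>] graph_chartD[OF c] assms(1) fi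
      by (simp add: inner_add_left)
    then show thesis ..
  qed blast
  note c = graph_chartD[OF ch0]
  \<comment> \<open>The whole chart interval is exempted; outside it the line is transversal, since
    \<open>p\<close> is its only point of tangency.\<close>
  define E where "E = ball t0 r"
  have ch: "\<exists>r h sg \<eta>. graph_chart \<Omega> (line_point \<theta> s0 t) (unit_dir \<theta>) (unit_dir (\<theta> + pi / 2)) r h sg \<eta>"
    if tE: "t \<notin> E" and fp: "line_point \<theta> s0 t \<in> frontier \<Omega>" for t
  proof (rule transversal_graph_chart[OF cl \<Omega>(3) fp], rule notI)
    assume "line_point \<theta> s0 t \<in> tangency_set \<Omega> s0 \<theta>"
    then have "t = t0"
      using assms(1) by (auto simp: t0_def line_point_inner)
    then show False
      using tE c(2) by (simp add: E_def)
  qed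
  obtain d K T where d: "d > 0" "K \<ge> 0" "finite T"
    "\<And>\<sigma> t. 0 < \<sigma> \<Longrightarrow> \<sigma> < d \<Longrightarrow> t \<notin> E \<Longrightarrow>
      differ \<Omega> \<theta> s0 \<sigma> t \<Longrightarrow> \<exists>t1\<in>T. \<bar>t - t1\<bar> \<le> K * \<sigma>"
    by (rule differ_cover[OF cl \<Omega>(2), of E \<theta> s0]) (use ch in \<open>auto simp: E_def\<close>)
  \<comment> \<open>The contact interval of length \<open>2 * N * \<sigma>\<close> gains
    \<open>2 * \<mu> * N * \<sigma>\<close>. The losses are \<open>4 * L * \<sigma>\<close> where
    the lines agree and \<open>2 * M * K * card T * \<sigma>\<close> at transversal crossings;
    \<open>\<mu> * N\<close> alone exceeds their coefficients together with
    \<open>\<bar>C\<bar>\<close>. The summand 1 keeps \<open>N\<close> positive.\<close>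
  define N where "N = (\<bar>C\<bar> + 4 * L + 2 * M * K * card T + 1) / \<mu>"
  have "0 \<le> 2 * M * K * card T"
    using H(5) d(2) by simp
  then have "\<bar>C\<bar> + 4 * L + 2 * M * K * card T + 1 > 0"
    using H(4) by linarith
  then have N: "N > 0" "\<mu> * N = \<bar>C\<bar> + 4 * L + 2 * M * K * card T + 1"
    using pos(1) unfolding N_def by (auto intro: divide_pos_pos)
  \<comment> \<open>With slope bound \<open>1 / (N + 1)\<close> the graph stays strictly between the
    lines at offsets \<open>-\<sigma>\<close> and \<open>\<sigma>\<close> over the whole interval
    \<open>\<bar>x\<bar> \<le> N * \<sigma>\<close>.\<close>
  obtain e where e: "e > 0" "\<And>x. \<bar>x\<bar> < e \<Longrightarrow> \<bar>\<eta> x - deriv \<eta> 0 * x\<bar> \<le> (1 / (N + 1)) * \<bar>x\<bar>"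
    using DERIV_linear_bound[OF graph_chart_DERIV(1)[OF ch0, of 0] c(6), of "1 / (N + 1)"] c(2) N(1) by auto
  have "\<exists>\<sigma>>0. \<sigma> < dC \<and> \<sigma> < d \<and> \<sigma> < h \<and> N * \<sigma> < r \<and> N * \<sigma> < e"
  proof -
    define m where "m = min (min dC d) (min h (min (r/N) (e/N)))"
    have "m > 0"
      using dC(1) d(1) c(2,3) e(1) N(1) by (simp add: m_def)
    moreover have "m \<le> dC" "m \<le> d" "m \<le> h" "m \<le> r/N" "m \<le> e/N"
      by (auto simp: m_def)
    ultimately show ?thesis
      using N(1) c(2) e(1) by (intro exI[of _ "m/2"]) (auto simp: field_simps)
  qed
  then obtain \<sigma> where \<sigma>: "\<sigma> > 0" "\<sigma> < dC" "\<sigma> < d" "\<sigma> < h" "N * \<sigma> < r" "N * \<sigma> < e"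
    by blast
  have K\<sigma>: "K * \<sigma> \<ge> 0"
    using d(2) \<sigma> by simp
  \<comment> \<open>A pointwise lower bound for \<open>- sg * G\<close>. This sign makes the
    contributions near the contact point positive: for \<open>sg = 1\<close> it is the line at
    offset \<open>-\<sigma>\<close> that lies in \<open>\<Omega>\<close> there.\<close>
  let ?B = "\<lambda>t. \<mu> * indicator {t0 - N * \<sigma>..t0 + N * \<sigma>} t
    - (2 * L * \<sigma> * indicator {-1..1} t + M * (\<Sum>t1\<in>T. indicator {t1 - K * \<sigma>..t1 + K * \<sigma>} t))"
  have memE: "line_point \<theta> (s0 + y) t \<in> \<Omega> \<longleftrightarrow> sg * (y - \<eta> (t - t0)) \<le> 0" if "t \<in> E" "\<bar>y\<bar> < h" for y t
  proof -
    have "p + (t - t0) *\<^sub>R unit_dir (\<theta> + pi / 2) + y *\<^sub>R unit_dir \<theta> = line_point \<theta> (s0 + y) t"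
      by (simp add: p line_point_def algebra_simps)
    then show ?thesis
      using c(8)[of "t - t0" y] that by (simp add: E_def dist_real_def abs_minus_commute)
  qed
  have "?B t \<le> - sg * G \<theta> s0 \<sigma> t" for t
  proof -
    have S0: "0 \<le> M * (\<Sum>t1\<in>T. indicator {t1 - K * \<sigma>..t1 + K * \<sigma>} t)"
      using H(5) by (intro mult_nonneg_nonneg sum_nonneg) auto
    have L0: "0 \<le> 2 * L * \<sigma> * indicator {-1..1} t"
      using H(4) \<sigma> by simp
    have sgG: "- sg * G \<theta> s0 \<sigma> t \<ge> - \<bar>G \<theta> s0 \<sigma> t\<bar>"
      using c(4) by auto
    have I1: "\<mu> * indicator {t0 - N * \<sigma>..t0 + N * \<sigma>} t \<le> \<mu>"
      using pos(1) by (simp add: indicator_def)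
    have in_E: "t \<in> E \<and> differ \<Omega> \<theta> s0 \<sigma> t"
      if "t \<in> {t0 - N * \<sigma>..t0 + N * \<sigma>}"
    proof -
      have tt: "\<bar>t - t0\<bar> \<le> N * \<sigma>"
        using that by auto
      then have tE: "t \<in> E"
        using \<sigma> by (simp add: E_def dist_real_def abs_minus_commute)
      have "\<bar>\<eta> (t - t0)\<bar> \<le> (1 / (N + 1)) * \<bar>t - t0\<bar>"
        using e(2)[of "t - t0"] tt \<sigma> \<eta>0 by simp
      also have "\<dots> \<le> (1 / (N + 1)) * (N * \<sigma>)"
        using tt N(1) by (intro mult_left_mono) auto
      also have "\<dots> < \<sigma>"
        using N(1) \<sigma>(1) by (simp add: field_simps)
      finally have "\<bar>\<eta> (t - t0)\<bar> < \<sigma>" .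
      then show ?thesis
        using tE memE[OF tE, of \<sigma>] memE[OF tE, of "-\<sigma>"] \<sigma> c(4) by auto
    qed
    show ?thesis
    proof (cases "\<not> differ \<Omega> \<theta> s0 \<sigma> t")
      case True
      then have "t \<notin> {t0 - N * \<sigma>..t0 + N * \<sigma>}"
        using in_E by blast
      then have "indicator {t0 - N * \<sigma>..t0 + N * \<sigma>} t = (0::real)"
        by (simp add: indicator_def)
      then show ?thesis
        using G_same[OF True \<sigma>(1)] S0 sgG by simp
    next
      case False
      show ?thesis
      proof (cases "t \<in> E")
        case True
        have "- sg * G \<theta> s0 \<sigma> t \<ge> \<mu>"
          using memE[OF True, of \<sigma>] memE[OF True, of "-\<sigma>"] False c(4) \<sigma>
            pos(2)[of "line_point \<theta> (s0 + \<sigma>) t"] pos(2)[of "line_point \<theta> (s0 - \<sigma>) t"]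
          by (auto simp: G_def)
        then show ?thesis
          using I1 S0 L0 by linarith
      next
        case nE: False
        have "M * 1 \<le> M * (\<Sum>t1\<in>T. indicator {t1 - K * \<sigma>..t1 + K * \<sigma>} t)"
          using d(4)[of \<sigma> t] \<sigma> False nE H(5) by (intro mult_left_mono sum_box_ge d(3)) auto
        moreover have "indicator {t0 - N * \<sigma>..t0 + N * \<sigma>} t = (0::real)"
          using in_E nE by (auto simp: indicator_def)
        ultimately show ?thesis
          using G_le[OF notnotD[OF False]] L0 sgG by simp
      qed
    qed
  qed
  moreover have i1: "integrable lborel (\<lambda>t. 2 * L * \<sigma> * indicator {-1..1} t
      + M * (\<Sum>t1\<in>T. indicator {t1 - K * \<sigma>..t1 + K * \<sigma>} t) :: real)"
    by (rule integral_box_bound(1)[OF d(3) K\<sigma>])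
  moreover have i2: "integrable lborel (\<lambda>t. \<mu> * indicator {t0 - N * \<sigma>..t0 + N * \<sigma>} t :: real)"
    using integral_box_sum(1)[of "{t0}" "N * \<sigma>"] N(1) \<sigma>(1) by simp
  ultimately have "(LINT t|lborel. ?B t) \<le> (LINT t|lborel. - sg * G \<theta> s0 \<sigma> t)"
    by (intro integral_mono Bochner_Integration.integrable_diff integrable_mult_right integrable_G) auto
  also have "\<dots> \<le> \<bar>LINT t|lborel. G \<theta> s0 \<sigma> t\<bar>"
    using c(4) by auto
  also have "\<dots> \<le> C * \<sigma>"
    by (rule dC(2)[OF \<sigma>(1,2)])
  also have "\<dots> \<le> \<bar>C\<bar> * \<sigma>"
    using \<sigma>(1) by (simp add: mult_right_mono)
  finally have "(LINT t|lborel. ?B t) \<le> \<bar>C\<bar> * \<sigma>" .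
  moreover have "(LINT t|lborel. 2 * L * \<sigma> * indicator {-1..1} t
      + M * (\<Sum>t1\<in>T. indicator {t1 - K * \<sigma>..t1 + K * \<sigma>} t)) = 2 * (2 * L * \<sigma>) + 2 * M * (K * \<sigma>) * card T"
    by (rule integral_box_bound(2)[OF d(3) K\<sigma>])
  moreover have "(LINT t|lborel. \<mu> * indicator {t0 - N * \<sigma>..t0 + N * \<sigma>} t) = \<mu> * (2 * (N * \<sigma>))"
    using N(1) \<sigma>(1) by simp
  ultimately have "\<mu> * (2 * (N * \<sigma>)) - (2 * (2 * L * \<sigma>) + 2 * M * (K * \<sigma>) * card T) \<le> \<bar>C\<bar> * \<sigma>"
    using Bochner_Integration.integral_diff[OF i2 i1] by linarith
  then have "(2 * (\<mu> * N)) * \<sigma> \<le> (\<bar>C\<bar> + 4 * L + 2 * M * K * card T) * \<sigma>"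
    by (simp add: algebra_simps)
  then have "2 * (\<mu> * N) \<le> \<bar>C\<bar> + 4 * L + 2 * M * K * card T"
    using \<sigma>(1) by simp
  moreover have "\<mu> * N > 0"
    using pos(1) N(1) by simp
  ultimately show False
    using N(2) by linarith
qed

end

section \<open>Tangent lines and Sard's theorem\<close>

text \<open>Sard's theorem in dimension one, passed through \<open>real^1\<close> because
  \<open>baby_Sard\<close> speaks about cartesian spaces. The derivative is relative to
  \<open>S\<close>, as the leaf parameter to which this is applied is defined on an arbitrary set
  only.\<close>

lemma negligible_zero_derivative_image:
  fixes \<alpha> :: "real \<Rightarrow> real"
  assumes "\<And>y. y \<in> S \<Longrightarrow> (\<alpha> has_real_derivative 0) (at y within S)"
  shows "negligible ((vec :: real \<Rightarrow> real^1) ` \<alpha> ` S)"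
proof -
  define f where "f = (\<lambda>v::real^1. vec (\<alpha> (v $ 1)) :: real^1)"
  have d: "(f has_derivative (\<lambda>_. 0)) (at v within vec ` S)" if v: "v \<in> vec ` S" for v
  proof -
    have "v $ 1 \<in> S"
      using v by auto
    then have a: "(\<alpha> has_derivative (\<lambda>_. 0)) (at (v $ 1) within S)"
      using assms[of "v $ 1"] by (simp add: has_field_derivative_def lambda_zero)
    have n1: "norm w = \<bar>w $ 1\<bar>" for w :: "real^1"
      by (simp add: norm_vec_def L2_set_def)
    show ?thesis
      unfolding has_derivative_within_alt
    proof (intro conjI allI impI)
      fix e :: real assume "e > 0"
      then obtain d where d: "d > 0" "\<And>y. y \<in> S \<Longrightarrow> norm (y - v $ 1) < d \<Longrightarrow>
          norm (\<alpha> y - \<alpha> (v $ 1) - 0) \<le> e * norm (y - v $ 1)"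
        using a unfolding has_derivative_within_alt by blast
      then show "\<exists>d>0. \<forall>y\<in>vec ` S. norm (y - v) < d \<longrightarrow> norm (f y - f v - 0) \<le> e * norm (y - v)"
        by (intro exI[of _ d]) (auto simp: f_def n1)
    qed simp
  qed
  have "negligible (f ` vec ` S)"
  proof (rule baby_Sard[where f' = "\<lambda>_ _. 0"])
    show "rank (matrix (\<lambda>_::real^1. 0::real^1)) < CARD(1)"
    proof -
      have "matrix (\<lambda>_::real^1. 0::real^1) = 0"
        by (simp add: matrix_def vec_eq_iff)
      then show ?thesis
        by (simp add: rank_0)
    qed
  qed (use d in auto)
  moreover have "f ` vec ` S = vec ` \<alpha> ` S"
    by (auto simp: f_def image_image)
  ultimately show ?thesis
    by simp
qed

lemma not_negligible_interval_vec:
  assumes "a < b"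
  shows "\<not> negligible ((vec :: real \<Rightarrow> real^1) ` {a..b})"
proof -
  have "(vec :: real \<Rightarrow> real^1) ` {a..b} = cbox (vec a) (vec b)"
  proof (intro equalityI subsetI)
    fix x :: "real^1" assume x: "x \<in> cbox (vec a) (vec b)"
    have "x = vec (x $ 1)"
      by (simp add: vec_eq_iff)
    moreover have "x $ 1 \<in> {a..b}"
      using x by (simp add: mem_box_cart)
    ultimately show "x \<in> vec ` {a..b}"
      by (rule image_eqI)
  qed (auto simp: mem_box_cart)
  moreover have "vec ((a + b) / 2) \<in> box (vec a :: real^1) (vec b)"
    using assms by (simp add: mem_box_cart)
  ultimately show ?thesis
    using negligible_interval(1) by (metis empty_iff)
qed

text \<open>A Sard argument: near the curve, the family of lines \<open>(z - q a) \<bullet> N a = 0\<close> foliates the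
  plane, and the lines tangent to the curve are the critical values of the leaf parameter \<open>a\<close>.\<close>

lemma negligible_tangent_lines:
  fixes c c' q N :: "real \<Rightarrow> 'a::euclidean_space"
  assumes \<mu>: "\<mu> > 0" "\<And>z a1 a2. z \<in> V \<Longrightarrow> a1 \<in> W \<Longrightarrow> a2 \<in> W \<Longrightarrow>
      \<mu> * \<bar>a1 - a2\<bar> \<le> \<bar>(z - q a1) \<bullet> N a1 - (z - q a2) \<bullet> N a2\<bar>"
    and c: "\<And>y. y \<in> Y \<Longrightarrow> (c has_vector_derivative c' y) (at y)"
  shows "negligible ((vec :: real \<Rightarrow> real^1) `
    {a \<in> W. \<exists>y\<in>Y. c y \<in> V \<and> (c y - q a) \<bullet> N a = 0 \<and> c' y \<bullet> N a = 0})"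
proof -
  define P where "P = (\<lambda>y a. a \<in> W \<and> y \<in> Y \<and> c y \<in> V \<and> (c y - q a) \<bullet> N a = 0 \<and> c' y \<bullet> N a = 0)"
  define S where "S = {y. \<exists>a. P y a}"
  define \<alpha> where "\<alpha> = (\<lambda>y. SOME a. P y a)"
  have \<alpha>: "P y (\<alpha> y)" if "y \<in> S" for y
    using that unfolding S_def \<alpha>_def by (auto intro: someI)
  have uniq: "a1 = a2" if "P y a1" "P y a2" for y a1 a2
  proof -
    have "\<mu> * \<bar>a1 - a2\<bar> \<le> 0"
      using \<mu>(2)[of "c y" a1 a2] that by (simp add: P_def)
    then show ?thesis
      using \<mu>(1) by (simp add: mult_le_0_iff)
  qed
  \<comment> \<open>By \<open>\<mu>\<close> the change of \<open>\<alpha>\<close> is controlled by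
    the change of \<open>G\<close>, the height of the curve over the fixed line with parameter
    \<open>a1\<close>, and \<open>G\<close> is stationary at \<open>y1\<close> because that line is
    tangent to the curve there.\<close>
  have "(\<alpha> has_derivative (\<lambda>_. 0)) (at y1 within S)" if y1: "y1 \<in> S" for y1
    unfolding has_derivative_within_alt
  proof (intro conjI allI impI)
    fix e :: real assume e: "e > 0"
    define a1 where "a1 = \<alpha> y1"
    define G where "G = (\<lambda>y. (c y - q a1) \<bullet> N a1)"
    have P1: "P y1 a1"
      using \<alpha>[OF y1] by (simp add: a1_def)
    have "(G has_derivative (\<lambda>v. v *\<^sub>R c' y1 \<bullet> N a1)) (at y1)"
      using c[of y1] P1 unfolding G_def P_def has_vector_derivative_def
      by (auto intro!: derivative_eq_intros)
    then have "(G has_derivative (\<lambda>_. 0)) (at y1)"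
      using P1 by (simp add: P_def)
    then obtain d where d: "d > 0" "\<And>y. norm (y - y1) < d \<Longrightarrow> norm (G y - G y1 - 0) \<le> (\<mu> * e) * norm (y - y1)"
      unfolding has_derivative_at_alt using e \<mu>(1) by (metis mult_pos_pos)
    show "\<exists>d>0. \<forall>y\<in>S. norm (y - y1) < d \<longrightarrow> norm (\<alpha> y - \<alpha> y1 - 0) \<le> e * norm (y - y1)"
    proof (intro exI[of _ d] conjI ballI impI d(1))
      fix y assume y: "y \<in> S" "norm (y - y1) < d"
      note Py = \<alpha>[OF y(1)]
      have "\<mu> * \<bar>\<alpha> y - a1\<bar> \<le> \<bar>(c y - q (\<alpha> y)) \<bullet> N (\<alpha> y) - (c y - q a1) \<bullet> N a1\<bar>"
        using \<mu>(2)[of "c y" "\<alpha> y" a1] Py P1 by (simp add: P_def)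
      also have "\<dots> = \<bar>G y - G y1\<bar>"
        using Py P1 by (simp add: P_def G_def)
      also have "\<dots> \<le> (\<mu> * e) * norm (y - y1)"
        using d(2)[OF y(2)] by simp
      finally show "norm (\<alpha> y - \<alpha> y1 - 0) \<le> e * norm (y - y1)"
        using \<mu>(1) by (simp add: a1_def mult.assoc)
    qed
  qed simp
  then have "negligible ((vec :: real \<Rightarrow> real^1) ` \<alpha> ` S)"
    by (intro negligible_zero_derivative_image) (simp add: has_field_derivative_def lambda_zero)
  moreover have "{a \<in> W. \<exists>y\<in>Y. c y \<in> V \<and> (c y - q a) \<bullet> N a = 0 \<and> c' y \<bullet> N a = 0} \<subseteq> \<alpha> ` S"
  proof
    fix a assume "a \<in> {a \<in> W. \<exists>y\<in>Y. c y \<in> V \<and> (c y - q a) \<bullet> N a = 0 \<and> c' y \<bullet> N a = 0}"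
    then obtain y where "P y a"
      by (auto simp: P_def)
    then have "y \<in> S" "a = \<alpha> y"
      using \<alpha>[of y] uniq[of y a "\<alpha> y"] by (auto simp: S_def)
    then show "a \<in> \<alpha> ` S"
      by blast
  qed
  ultimately show ?thesis
    by (rule negligible_subset[OF _ image_mono])
qed

lemma ex_unit_dir:
  assumes "norm v = 1"
  obtains \<theta> where "0 \<le> \<theta>" "\<theta> < 2 * pi" "unit_dir \<theta> = v"
proof -
  have "(v$1)\<^sup>2 + (v$2)\<^sup>2 = 1"
    using assms by (simp add: norm_eq_1 inner_vec_def sum_2 power2_eq_square)
  from sincos_total_2pi[OF this]
  obtain \<theta> where "0 \<le> \<theta>" "\<theta> < 2 * pi" "v$1 = cos \<theta>" "v$2 = sin \<theta>"
    by metis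
  moreover from this have "unit_dir \<theta> = v"
    by (simp add: unit_dir_def vec_eq_iff forall_2)
  ultimately show thesis
    using that by blast
qed

lemma connected_isolated_point:
  fixes x :: "'a::t1_space"
  assumes "connected S" "x \<in> S" "open W" "S \<inter> W = {x}"
  shows "S = {x}"
proof (rule ccontr)
  assume "S \<noteq> {x}"
  moreover have "W \<inter> (- {x}) \<inter> S = {}" "S \<subseteq> W \<union> - {x}"
    using assms(2,4) by auto
  ultimately show False
    using connectedD[OF assms(1,3) open_Compl[OF closed_singleton[of x]]] assms(2,4) by auto
qed

lemma graph_chart_ex:
  assumes "smooth_boundary \<Omega>" "closed \<Omega>" "p \<in> frontier \<Omega>"
  obtains m n r h sg \<eta> where "graph_chart \<Omega> p m n r h sg \<eta>"
  by (rule graph_chart_cases[OF assms frame_unit_dir]) (rule that, assumption)+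

lemma dist_Pair_le: "dist (a, b) (c, d) \<le> dist a c + dist b d"
  by (simp add: dist_Pair_Pair sqrt_sum_squares_le_sum)

text \<open>The foliation rests on the formula that \<open>(z - q a) \<bullet> N a\<close> has
  derivative \<open>- deriv (deriv \<eta>) a * ((z - q a) \<bullet> m)\<close> in \<open>a\<close>,
  because \<open>q\<close> moves perpendicularly to \<open>N\<close>. It is nonzero where the arc is
  curved and \<open>z\<close> is on its tangent line but is not the contact point itself.
  \<open>link\<close> carries everything that the transform contributes.\<close>

lemma curved_in_frontier:
  assumes ch: "graph_chart \<Omega> p m n r h sg \<eta>" and x1: "\<bar>x1\<bar> < r" and curved: "deriv (deriv \<eta>) x1 \<noteq> 0"
    and fin: "finite (degenerate_tangents \<Omega>)"
    and link: "\<And>s \<theta> z. tangency_set \<Omega> s \<theta> = {z} \<Longrightarrow> tangency_set \<Omega>' s \<theta> \<noteq> {}"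
    and \<Omega>': "compact \<Omega>'" "smooth_boundary \<Omega>'"
  shows "p + x1 *\<^sub>R m + \<eta> x1 *\<^sub>R n \<in> frontier \<Omega>'"
proof (rule ccontr)
  define q where "q = (\<lambda>x. p + x *\<^sub>R m + \<eta> x *\<^sub>R n)"
  define T where "T = (\<lambda>x. m + deriv \<eta> x *\<^sub>R n)"
  define N where "N = (\<lambda>x. n - deriv \<eta> x *\<^sub>R m)"
  assume "p + x1 *\<^sub>R m + \<eta> x1 *\<^sub>R n \<notin> frontier \<Omega>'"
  then have qx1: "q x1 \<in> - frontier \<Omega>'"
    by (simp add: q_def)
  note c = graph_chartD[OF ch]
  note fi = frame_inner[OF c(1)]
  have TN: "T x \<bullet> N x = 0" for x
    by (simp add: T_def N_def inner_add_left inner_diff_right fi)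
  have NN: "N x \<noteq> 0" for x
  proof
    assume "N x = 0"
    then have "N x \<bullet> n = 0"
      by simp
    then show False
      by (simp add: N_def inner_diff_left fi)
  qed
  have cq: "isCont q x" if "\<bar>x\<bar> < r" for x
    using DERIV_isCont[OF graph_chart_DERIV(1)[OF ch that]] unfolding q_def by (intro continuous_intros)
  have "open (- frontier \<Omega>')"
    by (simp add: open_Compl)
  then obtain e where e: "e > 0" "ball (q x1) e \<subseteq> - frontier \<Omega>'"
    using qx1 by (rule openE)
  obtain d1 where d1: "d1 > 0" "\<And>x. dist x x1 < d1 \<Longrightarrow> dist (q x) (q x1) < e"
    using cq[OF x1] e(1) unfolding continuous_at_eps_delta by blast
  obtain d2 where d2: "d2 > 0" "\<And>x. dist x x1 < d2 \<Longrightarrow> \<bar>deriv (deriv \<eta>) x\<bar> > 0"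
    by (rule isCont_pos_near[where f = "\<lambda>x. \<bar>deriv (deriv \<eta>) x\<bar>" and ?x0.0 = x1])
      (use curved graph_chart_DERIV(3)[OF ch x1] in \<open>auto intro!: continuous_intros\<close>)
  define d where "d = min (r - \<bar>x1\<bar>) (min d1 d2)"
  have d: "d > 0" "d \<le> r - \<bar>x1\<bar>" "d \<le> d1" "d \<le> d2"
    using d1(1) d2(1) x1 by (auto simp: d_def)
  define I where "I = ball x1 d"
  have I: "\<bar>x\<bar> < r" "q x \<notin> frontier \<Omega>'" "deriv (deriv \<eta>) x \<noteq> 0" if "x \<in> I" for x
  proof -
    have x: "dist x x1 < d"
      using that by (simp add: I_def dist_commute)
    then show "\<bar>x\<bar> < r"
      using d(2) by (simp add: dist_real_def)
    show "q x \<notin> frontier \<Omega>'"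
    proof -
      have "q x \<in> ball (q x1) e"
        using d1(2)[of x] x d(3) by (simp add: dist_commute)
      then show ?thesis
        using e(2) by blast
    qed
    show "deriv (deriv \<eta>) x \<noteq> 0"
      using d2(2)[of x] x d(4) by auto
  qed
  have oI: "open I"
    by (auto simp: I_def)
  have noeq: "deriv \<eta> a \<noteq> deriv \<eta> b" if ab: "a \<in> I" "b \<in> I" "a < b" for a b
  proof
    assume eq: "deriv \<eta> a = deriv \<eta> b"
    have sub: "x \<in> I" if "a \<le> x" "x \<le> b" for x
      using that ab by (auto simp: I_def dist_real_def abs_if split: if_splits)
    have "\<exists>z>a. z < b \<and> deriv \<eta> b - deriv \<eta> a = (b - a) * deriv (deriv \<eta>) z"
      using ab(3) graph_chart_DERIV(2)[OF ch I(1)[OF sub]] by (intro MVT2) auto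
    then show False
      using eq ab(3) I(3)[OF sub] by auto
  qed
  then have inj: "a = b" if "a \<in> I" "b \<in> I" "deriv \<eta> a = deriv \<eta> b" for a b
    using that by (metis linorder_neqE)
  \<comment> \<open>The angle is normalized to the range in which \<open>degenerate_tangents\<close>
    counts.\<close>
  have "\<exists>\<theta>. 0 \<le> \<theta> \<and> \<theta> < 2 * pi \<and> unit_dir \<theta> = N a /\<^sub>R norm (N a)" for a
    using ex_unit_dir[of "N a /\<^sub>R norm (N a)"] NN[of a] by auto
  then obtain \<theta> where \<theta>: "\<And>a. 0 \<le> \<theta> a \<and> \<theta> a < 2 * pi \<and> unit_dir (\<theta> a) = N a /\<^sub>R norm (N a)"
    by metis
  define s where "s = (\<lambda>a. q a \<bullet> unit_dir (\<theta> a))"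
  have perp: "v \<bullet> unit_dir (\<theta> a) = 0 \<longleftrightarrow> v \<bullet> N a = 0" for v a
    using \<theta>[of a] NN[of a] by simp
  have tan: "q x \<in> tangency_set \<Omega> (s a) (\<theta> a) \<longleftrightarrow> (q x - q a) \<bullet> N a = 0 \<and> T x \<bullet> N a = 0"
    if "\<bar>x\<bar> < r" for x a
  proof -
    have "q x \<in> tangency_set \<Omega> (s a) (\<theta> a) \<longleftrightarrow> q x \<bullet> unit_dir (\<theta> a) = s a \<and> T x \<bullet> unit_dir (\<theta> a) = 0"
      using graph_chart_tangency[OF ch that, of "s a" "\<theta> a"] by (simp add: q_def T_def)
    moreover have "q x \<bullet> unit_dir (\<theta> a) = s a \<longleftrightarrow> (q x - q a) \<bullet> unit_dir (\<theta> a) = 0"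
      by (simp add: s_def inner_diff_left)
    ultimately show ?thesis
      unfolding perp by simp
  qed
  have \<theta>inj: "a = b" if "a \<in> I" "b \<in> I" "\<theta> a = \<theta> b" for a b
  proof -
    have u: "unit_dir (\<theta> a) = N b /\<^sub>R norm (N b)"
      using \<theta>[of b] that(3) by simp
    have "T a \<bullet> N b = 0"
      using perp[of "T a" a] perp[of "T a" b] TN that(3) by simp
    then have "deriv \<eta> a = deriv \<eta> b"
      by (simp add: T_def N_def inner_add_left inner_diff_right fi)
    then show ?thesis
      using inj that by blast
  qed
  \<comment> \<open>The slope is injective on \<open>I\<close>, so different arc points have
    different tangent directions and the finitely many degenerate lines exclude only finitely many
    parameters.\<close>
  define Bad where "Bad = {a \<in> I. (s a, \<theta> a) \<in> degenerate_tangents \<Omega>}"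
  have finBad: "finite Bad"
  proof (rule finite_imageD)
    show "finite ((\<lambda>a. (s a, \<theta> a)) ` Bad)"
      by (rule finite_subset[OF _ fin]) (auto simp: Bad_def)
    show "inj_on (\<lambda>a. (s a, \<theta> a)) Bad"
      using \<theta>inj by (auto simp: inj_on_def Bad_def)
  qed
  \<comment> \<open>Outside \<open>Bad\<close> the tangency set is connected, and injectivity of the
    slope isolates \<open>q a\<close> in it; a connected set with an isolated point is that point
    alone. This is the form that \<open>link\<close> requires.\<close>
  have single: "tangency_set \<Omega> (s a) (\<theta> a) = {q a}" if a: "a \<in> I" "a \<notin> Bad" for a
  proof (rule connected_isolated_point)
    show "connected (tangency_set \<Omega> (s a) (\<theta> a))"
      using a \<theta>[of a] by (auto simp: Bad_def degenerate_tangents_def)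
    show qa: "q a \<in> tangency_set \<Omega> (s a) (\<theta> a)"
      using tan[OF I(1)[OF a(1)]] TN by simp
    let ?W = "{z. dist x1 ((z - p) \<bullet> m) < d \<and> \<bar>(z - p) \<bullet> n\<bar> < h}"
    show "open ?W"
      by (intro open_Collect_conj open_Collect_less continuous_intros)
    have qW: "q a \<in> ?W"
      using a(1) c(7)[OF I(1)[OF a(1)]] by (simp add: q_def I_def inner_add_left fi)
    have zq: "z = q a" if z: "z \<in> tangency_set \<Omega> (s a) (\<theta> a)" "z \<in> ?W" for z
    proof -
      define x where "x = (z - p) \<bullet> m"
      have xI: "x \<in> I"
        using z(2) by (simp add: x_def I_def)
      have "z \<in> frontier \<Omega>"
        using z(1) by (simp add: tangency_set_def)
      then have zq: "z = q x"
        using graph_chart_box[OF ch, of z] I(1)[OF xI] z(2) by (simp add: x_def q_def)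
      then have "T x \<bullet> N a = 0"
        using tan[OF I(1)[OF xI]] z(1) by simp
      then have "deriv \<eta> x = deriv \<eta> a"
        by (simp add: T_def N_def inner_add_left inner_diff_right fi)
      then show ?thesis
        using inj[OF xI a(1)] zq by simp
    qed
    show "tangency_set \<Omega> (s a) (\<theta> a) \<inter> ?W = {q a}"
    proof (intro equalityI subsetI)
      fix z assume z: "z \<in> tangency_set \<Omega> (s a) (\<theta> a) \<inter> ?W"
      show "z \<in> {q a}"
        using zq[OF IntD1[OF z] IntD2[OF z]] by simp
    next
      fix z assume "z \<in> {q a}"
      then have "z = q a"
        by simp
      then show "z \<in> tangency_set \<Omega> (s a) (\<theta> a) \<inter> ?W"
        using IntI[OF qa qW] by (simp only:)
    qed
  qed
  define J where "J = {x1 - d/2..x1 + d/2}"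
  have JI: "J \<subseteq> I"
    using d(1) by (auto simp: J_def I_def dist_real_def abs_if)
  define A where "A = (\<lambda>V W. {a \<in> W. \<exists>z\<in>V. z \<in> tangency_set \<Omega>' (s a) (\<theta> a)})"
  have cl': "closed \<Omega>'"
    using \<Omega>'(1) by (rule compact_imp_closed)
  have tanD: "z \<in> frontier \<Omega>'" "(z - q a) \<bullet> N a = 0" if "z \<in> tangency_set \<Omega>' (s a) (\<theta> a)" for z a
    using that perp[of "z - q a" a] by (auto simp: tangency_set_def Line_def s_def inner_diff_left)
  \<comment> \<open>A point \<open>z0\<close> off the line with parameter \<open>a0\<close> stays
    off all nearby lines, so the set is empty; for \<open>z0\<close> on that line the Sard argument
    applies.\<close>
  have local: "\<exists>\<epsilon>>0. negligible ((vec :: real \<Rightarrow> real^1) ` A (ball z0 \<epsilon>) (ball a0 \<epsilon>))"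
    if z0: "z0 \<in> frontier \<Omega>'" and a0: "a0 \<in> J" for z0 a0
  proof -
    have a0I: "a0 \<in> I"
      using a0 JI by blast
    have cont1: "isCont (\<lambda>a. deriv \<eta> a) a0" "isCont (\<lambda>a. deriv (deriv \<eta>) a) a0" "isCont q a0"
      using graph_chart_DERIV(2,3)[OF ch I(1)[OF a0I]] DERIV_isCont cq[OF I(1)[OF a0I]] by auto
    have iso: "isCont (\<lambda>u. f (snd u)) (z0, a0)" if "isCont f a0" for f :: "real \<Rightarrow> 'x::topological_space"
      using that by (intro isCont_o2[where f = snd and g = f]) auto
    have cont2: "isCont (\<lambda>u. deriv \<eta> (snd u)) (z0, a0)" "isCont (\<lambda>u. deriv (deriv \<eta>) (snd u)) (z0, a0)"
      "isCont (\<lambda>u. q (snd u)) (z0, a0)" "isCont fst (z0, a0)"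
      using iso cont1 by (auto intro: continuous_intros)
    show ?thesis
    proof (cases "(z0 - q a0) \<bullet> N a0 = 0")
      case False
      obtain \<epsilon> where \<epsilon>: "\<epsilon> > 0" "\<And>u. dist u (z0, a0) < \<epsilon> \<Longrightarrow> \<bar>(fst u - q (snd u)) \<bullet> N (snd u)\<bar> > 0"
        by (rule isCont_pos_near[where f = "\<lambda>u. \<bar>(fst u - q (snd u)) \<bullet> N (snd u)\<bar>" and ?x0.0 = "(z0, a0)"])
          (use False cont2 in \<open>auto simp: N_def intro!: continuous_intros\<close>)
      have "A (ball z0 (\<epsilon>/2)) (ball a0 (\<epsilon>/2)) = {}"
      proof -
        have False if "a \<in> ball a0 (\<epsilon>/2)" "z \<in> ball z0 (\<epsilon>/2)" "z \<in> tangency_set \<Omega>' (s a) (\<theta> a)" for a z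
        proof -
          have "dist (z, a) (z0, a0) < \<epsilon>"
            using that(1,2) dist_Pair_le[of z a z0 a0] by (simp add: dist_commute)
          then show False
            using \<epsilon>(2)[of "(z, a)"] tanD(2)[OF that(3)] by simp
        qed
        then show ?thesis
          by (auto simp: A_def)
      qed
      then show ?thesis
        using \<epsilon>(1) by (intro exI[of _ "\<epsilon>/2"]) simp
    next
      case True
      define k where "k = (\<lambda>u. - deriv (deriv \<eta>) (snd u) * ((fst u - q (snd u)) \<bullet> m))"
      \<comment> \<open>A point of the tangent line with the same \<open>m\<close> coordinate as the
        contact point is the contact point, and that one is not on the second boundary. So the leaf
        derivative \<open>k\<close> does not vanish here.\<close>
      have "(z0 - q a0) \<bullet> m \<noteq> 0"
      proof
        assume m0: "(z0 - q a0) \<bullet> m = 0"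
        then have "(z0 - q a0) \<bullet> n = 0"
          using True by (simp add: N_def inner_diff_right)
        then have "z0 - q a0 = 0"
          using frame_expand[OF c(1), of "z0 - q a0"] m0 by simp
        then show False
          using I(2)[OF a0I] z0 by simp
      qed
      then have k0: "\<bar>k (z0, a0)\<bar> > 0"
        using I(3)[OF a0I] by (simp add: k_def)
      define \<mu> where "\<mu> = \<bar>k (z0, a0)\<bar> / 2"
      have \<mu>: "\<mu> > 0"
        using k0 by (simp add: \<mu>_def)
      obtain \<epsilon>1 where \<epsilon>1: "\<epsilon>1 > 0" "\<And>u. dist u (z0, a0) < \<epsilon>1 \<Longrightarrow> \<bar>k u\<bar> - \<mu> > 0"
        by (rule isCont_pos_near[where f = "\<lambda>u. \<bar>k u\<bar> - \<mu>" and ?x0.0 = "(z0, a0)"])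
          (use k0 cont2 in \<open>auto simp: k_def \<mu>_def intro!: continuous_intros\<close>)
      obtain m' n' r' h' sg' \<zeta> where ch': "graph_chart \<Omega>' z0 m' n' r' h' sg' \<zeta>"
        by (rule graph_chart_ex[OF \<Omega>'(2) cl' z0])
      note c' = graph_chartD[OF ch']
      obtain \<epsilon>2 where \<epsilon>2: "\<epsilon>2 > 0" "ball a0 \<epsilon>2 \<subseteq> I"
        using openE[OF oI a0I] by blast
      \<comment> \<open>Half of \<open>\<epsilon>1\<close> because the distance of pairs is bounded
        by a sum of two distances; \<open>\<epsilon>2\<close> keeps the parameters in
        \<open>I\<close>, while \<open>r'\<close> and \<open>h'\<close> keep the points in the chart
        box of the second boundary.\<close>
      define \<epsilon> where "\<epsilon> = min (min (\<epsilon>1/2) \<epsilon>2) (min r' h')"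
      have \<epsilon>: "\<epsilon> > 0" "\<epsilon> \<le> \<epsilon>1/2" "\<epsilon> \<le> \<epsilon>2" "\<epsilon> \<le> r'" "\<epsilon> \<le> h'"
        using \<epsilon>1(1) \<epsilon>2(1) c'(2,3) by (auto simp: \<epsilon>_def)
      define g where "g = (\<lambda>z a. (z - q a) \<bullet> N a)"
      have gd: "((\<lambda>a. g z a) has_real_derivative k (z, a)) (at a)" if "a \<in> I" for z a
      proof -
        have dq: "(q has_derivative (\<lambda>v. v *\<^sub>R T a)) (at a)"
          using graph_chart_curve_derivative[OF ch I(1)[OF that]]
          by (simp add: q_def T_def has_vector_derivative_def)
        have dN: "(N has_derivative (\<lambda>v. - (deriv (deriv \<eta>) a * v) *\<^sub>R m)) (at a)"
          using graph_chart_DERIV(2)[OF ch I(1)[OF that]] unfolding N_def has_field_derivative_def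
          by (auto intro!: derivative_eq_intros)
        have "((\<lambda>a. g z a) has_derivative (\<lambda>v. (z - q a) \<bullet> (- (deriv (deriv \<eta>) a * v) *\<^sub>R m)
            + (- (v *\<^sub>R T a)) \<bullet> N a)) (at a)"
          unfolding g_def by (rule has_derivative_inner[OF _ dN]) (auto intro!: derivative_eq_intros dq)
        moreover have "(\<lambda>v. (z - q a) \<bullet> (- (deriv (deriv \<eta>) a * v) *\<^sub>R m) + (- (v *\<^sub>R T a)) \<bullet> N a) = (*) (k (z, a))"
          by (rule ext) (simp add: TN k_def)
        ultimately show ?thesis
          by (simp only: has_field_derivative_def)
      qed
      have mono: "\<mu> * \<bar>a1 - a2\<bar> \<le> \<bar>g z a1 - g z a2\<bar>"
        if z: "z \<in> ball z0 \<epsilon>" and a: "a1 \<in> ball a0 \<epsilon>" "a2 \<in> ball a0 \<epsilon>" for z a1 a2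
      proof -
        have *: "\<mu> * \<bar>b - a\<bar> \<le> \<bar>g z b - g z a\<bar>" if ab: "a \<in> ball a0 \<epsilon>" "b \<in> ball a0 \<epsilon>" "a < b" for a b
        proof -
          have sub: "x \<in> ball a0 \<epsilon>" if "a \<le> x" "x \<le> b" for x
            using that ab by (auto simp: dist_real_def abs_if split: if_splits)
          have subI: "x \<in> I" if "a \<le> x" "x \<le> b" for x
            using sub[OF that] \<epsilon>2(2) \<epsilon>(3) by auto
          have "\<exists>x>a. x < b \<and> g z b - g z a = (b - a) * k (z, x)"
            using ab(3) gd[OF subI] by (intro MVT2) auto
          then obtain x where x: "a < x" "x < b" "g z b - g z a = (b - a) * k (z, x)"
            by blast
          have "dist (z, x) (z0, a0) < \<epsilon>1"
            using sub[of x] x z \<epsilon>(2) dist_Pair_le[of z x z0 a0] by (simp add: dist_commute)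
          then have "\<mu> \<le> \<bar>k (z, x)\<bar>"
            using \<epsilon>1(2)[of "(z, x)"] by simp
          then show ?thesis
            using x(3) ab(3) by (simp add: abs_mult mult.commute mult_right_mono)
        qed
        show ?thesis
          using *[of a1 a2] *[of a2 a1] a by (cases a1 a2 rule: linorder_cases) (auto simp: abs_minus_commute)
      qed
      define B where "B = {a \<in> ball a0 \<epsilon>. \<exists>y\<in>{-r'<..<r'}.
          z0 + y *\<^sub>R m' + \<zeta> y *\<^sub>R n' \<in> ball z0 \<epsilon> \<and> (z0 + y *\<^sub>R m' + \<zeta> y *\<^sub>R n' - q a) \<bullet> N a = 0 \<and>
          (m' + deriv \<zeta> y *\<^sub>R n') \<bullet> N a = 0}"
      have neg: "negligible ((vec :: real \<Rightarrow> real^1) ` B)"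
        unfolding B_def by (rule negligible_tangent_lines[OF \<mu> mono[unfolded g_def] graph_chart_curve_derivative[OF ch']])
          auto
      have sub: "A (ball z0 \<epsilon>) (ball a0 \<epsilon>) \<subseteq> B"
      proof
        fix a assume "a \<in> A (ball z0 \<epsilon>) (ball a0 \<epsilon>)"
        then obtain z where a: "a \<in> ball a0 \<epsilon>" and z: "z \<in> ball z0 \<epsilon>" "z \<in> tangency_set \<Omega>' (s a) (\<theta> a)"
          by (auto simp: A_def)
        define y where "y = (z - z0) \<bullet> m'"
        have dz: "dist z z0 < r'" "dist z z0 < h'"
          using z(1) \<epsilon>(4,5) by (auto simp: dist_commute)
        have y: "\<bar>y\<bar> < r'" "z = z0 + y *\<^sub>R m' + \<zeta> y *\<^sub>R n'"
          using graph_chart_frontierD[OF ch' tanD(1)[OF z(2)] dz] by (simp_all add: y_def)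
        have "(m' + deriv \<zeta> y *\<^sub>R n') \<bullet> N a = 0"
          using graph_chart_tangency[OF ch' y(1)] z(2) y(2) perp by metis
        then show "a \<in> B"
          unfolding B_def using a z(1) tanD(2)[OF z(2)] y by (auto intro!: bexI[of _ y])
      qed
      show ?thesis
        by (intro exI[of _ \<epsilon>] conjI \<epsilon>(1) negligible_subset[OF neg image_mono[OF sub]])
    qed
  qed
  \<comment> \<open>All pairs of a possible contact point on the second boundary and a parameter.
    Compactness leaves finitely many local null sets, which together with \<open>Bad\<close> would
    cover an interval.\<close>
  define K where "K = frontier \<Omega>' \<times> J"
  have "\<exists>\<epsilon>. \<forall>u\<in>K. \<epsilon> u > 0 \<and> negligible ((vec :: real \<Rightarrow> real^1) ` A (ball (fst u) (\<epsilon> u)) (ball (snd u) (\<epsilon> u)))"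
    using local by (intro bchoice) (auto simp: K_def)
  then obtain \<epsilon> where \<epsilon>: "\<And>u. u \<in> K \<Longrightarrow> \<epsilon> u > 0"
    "\<And>u. u \<in> K \<Longrightarrow> negligible ((vec :: real \<Rightarrow> real^1) ` A (ball (fst u) (\<epsilon> u)) (ball (snd u) (\<epsilon> u)))"
    by blast
  have "compact K"
    unfolding K_def J_def using \<Omega>'(1) by (intro compact_Times compact_frontier) auto
  moreover have "K \<subseteq> (\<Union>u\<in>K. ball (fst u) (\<epsilon> u) \<times> ball (snd u) (\<epsilon> u))"
  proof
    fix u assume u: "u \<in> K"
    then have "u \<in> ball (fst u) (\<epsilon> u) \<times> ball (snd u) (\<epsilon> u)"
      using \<epsilon>(1) by (simp add: mem_Times_iff)
    with u show "u \<in> (\<Union>u\<in>K. ball (fst u) (\<epsilon> u) \<times> ball (snd u) (\<epsilon> u))"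
      by blast
  qed
  ultimately obtain F where F: "F \<subseteq> K" "finite F" "K \<subseteq> (\<Union>u\<in>F. ball (fst u) (\<epsilon> u) \<times> ball (snd u) (\<epsilon> u))"
    by (elim compactE_image) (auto intro: open_Times)
  have "J \<subseteq> Bad \<union> (\<Union>u\<in>F. A (ball (fst u) (\<epsilon> u)) (ball (snd u) (\<epsilon> u)))"
  proof
    fix a assume a: "a \<in> J"
    show "a \<in> Bad \<union> (\<Union>u\<in>F. A (ball (fst u) (\<epsilon> u)) (ball (snd u) (\<epsilon> u)))"
    proof (cases "a \<in> Bad")
      case False
      then have "tangency_set \<Omega>' (s a) (\<theta> a) \<noteq> {}"
        using link single a JI by blast
      then obtain z where z: "z \<in> tangency_set \<Omega>' (s a) (\<theta> a)"
        by blast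
      then have "(z, a) \<in> K"
        using tanD(1) a by (simp add: K_def)
      then obtain u where "u \<in> F" "z \<in> ball (fst u) (\<epsilon> u)" "a \<in> ball (snd u) (\<epsilon> u)"
        using F(3) by blast
      then show ?thesis
        using z unfolding A_def by blast
    qed simp
  qed
  then have "(vec :: real \<Rightarrow> real^1) ` J \<subseteq>
      vec ` Bad \<union> (\<Union>u\<in>F. vec ` A (ball (fst u) (\<epsilon> u)) (ball (snd u) (\<epsilon> u)))"
    by blast
  moreover have "negligible ((vec :: real \<Rightarrow> real^1) ` Bad \<union>
      (\<Union>u\<in>F. vec ` A (ball (fst u) (\<epsilon> u)) (ball (snd u) (\<epsilon> u))))"
    by (intro negligible_Un negligible_finite[OF finite_imageI[OF finBad]] negligible_Union
        finite_imageI[OF F(2)]) (use F(1) \<epsilon>(2) in blast)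
  ultimately have "negligible ((vec :: real \<Rightarrow> real^1) ` J)"
    by (rule negligible_subset[rotated])
  then show False
    using not_negligible_interval_vec[of "x1 - d/2" "x1 + d/2"] d(1) by (simp add: J_def)
qed

section \<open>Comparing two domains\<close>

lemma graph_chart_curve_near:
  assumes ch: "graph_chart \<Omega> p m n r h sg \<eta>" and e: "e > 0"
  obtains d where "d > 0" "d \<le> r" "\<And>x. \<bar>x\<bar> < d \<Longrightarrow> dist (p + x *\<^sub>R m + \<eta> x *\<^sub>R n) p < e"
proof -
  note c = graph_chartD[OF ch]
  have "isCont (\<lambda>x. p + x *\<^sub>R m + \<eta> x *\<^sub>R n) 0"
    using DERIV_isCont[OF graph_chart_DERIV(1)[OF ch, of 0]] c(2) by (intro continuous_intros) auto
  then obtain d where d: "d > 0"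
    "\<And>x. dist x 0 < d \<Longrightarrow> dist (p + x *\<^sub>R m + \<eta> x *\<^sub>R n) (p + 0 *\<^sub>R m + \<eta> 0 *\<^sub>R n) < e"
    using e unfolding continuous_at_eps_delta by blast
  show thesis
    by (rule that[of "min d r"]) (use d c(2,6) in auto)
qed

lemma graph_chart_value_near:
  assumes ch: "graph_chart \<Omega> p m n r h sg \<eta>" and e: "e > 0"
  obtains d where "d > 0" "d \<le> r" "\<And>x. \<bar>x\<bar> < d \<Longrightarrow> \<bar>\<eta> x\<bar> < e"
proof -
  note c = graph_chartD[OF ch]
  obtain d where d: "d > 0" "\<And>x. dist x 0 < d \<Longrightarrow> dist (\<eta> x) (\<eta> 0) < e"
    using DERIV_isCont[OF graph_chart_DERIV(1)[OF ch, of 0]] c(2) e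
    unfolding continuous_at_eps_delta by auto
  show thesis
    by (rule that[of "min d r"]) (use d c(2,6) in auto)
qed

lemma nonzero_derivative_isolated_zero:
  fixes f :: "real \<Rightarrow> real"
  assumes "(f has_real_derivative D) (at 0)" "f 0 = 0" "D \<noteq> 0"
  obtains d where "d > 0" "\<And>x. 0 < \<bar>x\<bar> \<Longrightarrow> \<bar>x\<bar> < d \<Longrightarrow> f x \<noteq> 0"
proof -
  obtain d where d: "d > 0" "\<And>x. \<bar>x\<bar> < d \<Longrightarrow> \<bar>f x - D * x\<bar> \<le> (\<bar>D\<bar> / 2) * \<bar>x\<bar>"
    using DERIV_linear_bound[OF assms(1,2), of "\<bar>D\<bar> / 2"] assms(3) by auto
  show thesis
  proof (rule that[OF d(1)])
    fix x :: real assume x: "0 < \<bar>x\<bar>" "\<bar>x\<bar> < d"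
    show "f x \<noteq> 0"
    proof
      assume "f x = 0"
      then have "\<bar>D\<bar> * \<bar>x\<bar> \<le> (\<bar>D\<bar> / 2) * \<bar>x\<bar>"
        using d(2)[OF x(2)] by (simp add: abs_mult)
      moreover have "\<bar>D\<bar> * \<bar>x\<bar> > 0"
        using x(1) assms(3) by simp
      ultimately show False
        by (simp add: field_simps)
    qed
  qed
qed

text \<open>Both functions vanish at 0, so their difference has an isolated zero there: two
  boundaries crossing at \<open>p\<close> have no other common point nearby.\<close>

lemma graph_charts_different_slope:
  assumes ch: "graph_chart \<Omega> p m n r h sg \<eta>" and ch': "graph_chart \<Omega>' p m n r' h' sg' \<zeta>"
    and "deriv \<eta> 0 \<noteq> deriv \<zeta> 0"
  obtains d where "d > 0" "d \<le> r"
    "\<And>x. 0 < \<bar>x\<bar> \<Longrightarrow> \<bar>x\<bar> < d \<Longrightarrow> p + x *\<^sub>R m + \<eta> x *\<^sub>R n \<notin> frontier \<Omega>'"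
proof -
  note c = graph_chartD[OF ch] and c' = graph_chartD[OF ch']
  have r0: "\<bar>0::real\<bar> < r" "\<bar>0::real\<bar> < r'"
    using c(2) c'(2) by auto
  have "((\<lambda>x. \<eta> x - \<zeta> x) has_real_derivative deriv \<eta> 0 - deriv \<zeta> 0) (at 0)"
    by (intro DERIV_diff graph_chart_DERIV(1)[OF ch r0(1)] graph_chart_DERIV(1)[OF ch' r0(2)])
  then obtain d1 where d1: "d1 > 0" "\<And>x. 0 < \<bar>x\<bar> \<Longrightarrow> \<bar>x\<bar> < d1 \<Longrightarrow> \<eta> x - \<zeta> x \<noteq> 0"
    by (rule nonzero_derivative_isolated_zero) (use assms(3) c(6) c'(6) in auto)
  obtain d2 where d2: "d2 > 0" "d2 \<le> r" "\<And>x. \<bar>x\<bar> < d2 \<Longrightarrow> \<bar>\<eta> x\<bar> < h'"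
    using graph_chart_value_near[OF ch c'(3)] by blast
  show thesis
  proof (rule that[of "min (min d1 d2) r'"])
    fix x assume x: "0 < \<bar>x\<bar>" "\<bar>x\<bar> < min (min d1 d2) r'"
    have "\<bar>\<eta> x\<bar> < h'"
      using d2(3)[of x] x by simp
    then show "p + x *\<^sub>R m + \<eta> x *\<^sub>R n \<notin> frontier \<Omega>'"
      using graph_chart_sides(3)[OF ch', of x "\<eta> x"] d1(2)[of x] x by auto
  qed (use d1 d2 c'(2) in auto)
qed

text \<open>A point of the first graph is on the second boundary only if
  \<open>x = \<zeta> (\<eta> x)\<close>. Since \<open>\<zeta>\<close> has slope 0,
  \<open>x - \<zeta> (\<eta> x)\<close> has derivative 1 at 0, hence an isolated zero.\<close>

lemma graph_charts_swapped:
  assumes ch: "graph_chart \<Omega> p m n r h sg \<eta>" and ch': "graph_chart \<Omega>' p n m r' h' sg' \<zeta>"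
    and "deriv \<zeta> 0 = 0"
  obtains d where "d > 0" "d \<le> r"
    "\<And>x. 0 < \<bar>x\<bar> \<Longrightarrow> \<bar>x\<bar> < d \<Longrightarrow> p + x *\<^sub>R m + \<eta> x *\<^sub>R n \<notin> frontier \<Omega>'"
proof -
  note c = graph_chartD[OF ch] and c' = graph_chartD[OF ch']
  have r0: "\<bar>0::real\<bar> < r" "\<bar>0::real\<bar> < r'"
    using c(2) c'(2) by auto
  have "((\<lambda>x. \<zeta> (\<eta> x)) has_real_derivative deriv \<zeta> 0 * deriv \<eta> 0) (at 0)"
    by (rule DERIV_chain2) (use graph_chart_DERIV(1)[OF ch r0(1)] graph_chart_DERIV(1)[OF ch' r0(2)] c(6) in auto)
  then have "((\<lambda>x. x - \<zeta> (\<eta> x)) has_real_derivative 1 - 0) (at 0)"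
    using assms(3) by (intro DERIV_diff DERIV_ident) simp
  then obtain d1 where d1: "d1 > 0" "\<And>x. 0 < \<bar>x\<bar> \<Longrightarrow> \<bar>x\<bar> < d1 \<Longrightarrow> x - \<zeta> (\<eta> x) \<noteq> 0"
    by (rule nonzero_derivative_isolated_zero) (use c(6) c'(6) in auto)
  obtain d2 where d2: "d2 > 0" "d2 \<le> r" "\<And>x. \<bar>x\<bar> < d2 \<Longrightarrow> \<bar>\<eta> x\<bar> < r'"
    using graph_chart_value_near[OF ch c'(2)] by blast
  show thesis
  proof (rule that[of "min (min d1 d2) h'"])
    fix x assume x: "0 < \<bar>x\<bar>" "\<bar>x\<bar> < min (min d1 d2) h'"
    have "\<bar>\<eta> x\<bar> < r'"
      using d2(3)[of x] x by simp
    then have "p + \<eta> x *\<^sub>R n + x *\<^sub>R m \<in> frontier \<Omega>' \<longleftrightarrow> x = \<zeta> (\<eta> x)"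
      using graph_chart_sides(3)[OF ch', of "\<eta> x" x] x by simp
    moreover have "p + \<eta> x *\<^sub>R n + x *\<^sub>R m = p + x *\<^sub>R m + \<eta> x *\<^sub>R n"
      by (simp add: algebra_simps)
    ultimately show "p + x *\<^sub>R m + \<eta> x *\<^sub>R n \<notin> frontier \<Omega>'"
      using d1(2)[of x] x by auto
  qed (use d1 d2 c'(3) in auto)
qed

lemma second_derivative_zero_imp_linear:
  fixes f f1 f2 :: "real \<Rightarrow> real"
  assumes f: "\<And>x. \<bar>x\<bar> < d \<Longrightarrow> (f has_real_derivative f1 x) (at x)"
    "\<And>x. \<bar>x\<bar> < d \<Longrightarrow> (f1 has_real_derivative f2 x) (at x)"
    and z: "\<And>x. \<bar>x\<bar> < d \<Longrightarrow> f2 x = 0" and x: "\<bar>x\<bar> < d"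
  shows "f x = f 0 + f1 0 * x"
proof -
  have d: "0 < d"
    using x by linarith
  have c1: "f1 x = f1 0" if "x \<in> {-d<..<d}" for x
  proof (rule DERIV_isconst3[where a = "-d" and b = d and f = f1])
    show "(f1 has_real_derivative 0) (at y)" if "y \<in> {-d<..<d}" for y
      using f(2)[of y] z[of y] that by auto
  qed (use d that in auto)
  have "f x - f1 0 * x = f 0 - f1 0 * 0"
  proof (rule DERIV_isconst3[where a = "-d" and b = d and f = "\<lambda>x. f x - f1 0 * x"])
    show "((\<lambda>x. f x - f1 0 * x) has_real_derivative 0) (at y)" if "y \<in> {-d<..<d}" for y
      using f(1)[of y] c1[OF that] that by (auto intro!: derivative_eq_intros)
  qed (use d x in auto)
  then show ?thesis
    by simp
qed

text \<open>Let \<open>e\<close> be farthest from 0 in the closure of the exceptional set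
  \<open>Z\<close>. If the two boundaries separate at \<open>e\<close>, then near \<open>e\<close>
  the first one lies in \<open>Z\<close> apart from \<open>e\<close>, is therefore straight, and
  \<open>e\<close> is not farthest. If they are tangent at \<open>e\<close>, the two graphs turn out
  to coincide near \<open>e\<close>, which contradicts that \<open>e\<close> is a limit of points of
  \<open>Z\<close>. The tangent case uses the hypotheses in both directions.\<close>

lemma frontier_subset_of_curved:
  assumes \<Omega>: "compact \<Omega>" "smooth_boundary \<Omega>" and \<Omega>': "compact \<Omega>'" "smooth_boundary \<Omega>'"
    and cv: "\<And>p m n r h sg \<eta> x. graph_chart \<Omega> p m n r h sg \<eta> \<Longrightarrow> \<bar>x\<bar> < r \<Longrightarrow>
      deriv (deriv \<eta>) x \<noteq> 0 \<Longrightarrow> p + x *\<^sub>R m + \<eta> x *\<^sub>R n \<in> frontier \<Omega>'"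
    and cv': "\<And>p m n r h sg \<eta> x. graph_chart \<Omega>' p m n r h sg \<eta> \<Longrightarrow> \<bar>x\<bar> < r \<Longrightarrow>
      deriv (deriv \<eta>) x \<noteq> 0 \<Longrightarrow> p + x *\<^sub>R m + \<eta> x *\<^sub>R n \<in> frontier \<Omega>"
  shows "frontier \<Omega> \<subseteq> frontier \<Omega>'"
proof (rule ccontr)
  define Z where "Z = frontier \<Omega> - frontier \<Omega>'"
  assume "\<not> frontier \<Omega> \<subseteq> frontier \<Omega>'"
  then have Z: "Z \<noteq> {}"
    by (auto simp: Z_def)
  have KF: "closure Z \<subseteq> frontier \<Omega>"
    by (rule closure_minimal) (auto simp: Z_def)
  have "bounded (frontier \<Omega>)"
    using compact_imp_bounded[OF compact_frontier[OF \<Omega>(1)]] .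
  then have "compact (closure Z)"
    using KF bounded_subset by (simp add: compact_eq_bounded_closed) blast
  moreover have "closure Z \<noteq> {}"
    using Z by simp
  ultimately obtain e where e: "e \<in> closure Z" "\<And>y. y \<in> closure Z \<Longrightarrow> norm y \<le> norm e"
    using continuous_attains_sup[of "closure Z" norm] continuous_on_norm_id by blast
  have eF: "e \<in> frontier \<Omega>"
    using e(1) KF by blast
  have cl: "closed \<Omega>" "closed \<Omega>'"
    using \<Omega>(1) \<Omega>'(1) compact_imp_closed by auto
  obtain m n r h sg \<eta> where ch: "graph_chart \<Omega> e m n r h sg \<eta>"
    by (rule graph_chart_ex[OF \<Omega>(2) cl(1) eF])
  note c = graph_chartD[OF ch]
  define q where "q = (\<lambda>x. e + x *\<^sub>R m + \<eta> x *\<^sub>R n)"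
  have qF: "q x \<in> frontier \<Omega>" if "\<bar>x\<bar> < r" for x
    using graph_chart_on_frontier[OF ch that] by (simp add: q_def)
  text \<open>If the boundary is straight around \<open>e\<close> and in \<open>closure Z\<close>, then \<open>e\<close> is not farthest from 0.\<close>
  have claim: False if d: "d > 0" "d \<le> r" "\<And>x. 0 < \<bar>x\<bar> \<Longrightarrow> \<bar>x\<bar> < d \<Longrightarrow> q x \<notin> frontier \<Omega>'" for d
  proof -
    have z: "deriv (deriv \<eta>) x = 0" if "0 < \<bar>x\<bar>" "\<bar>x\<bar> < d" for x
      using cv[OF ch, of x] d(2) d(3)[OF that] that by (auto simp: q_def)
    \<comment> \<open>\<open>e\<close> itself may be on the second boundary, so the second
      derivative at 0 is reached only by continuity.\<close>
    have z0: "deriv (deriv \<eta>) 0 = 0"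
    proof (rule ccontr)
      assume "deriv (deriv \<eta>) 0 \<noteq> 0"
      then obtain d' where d': "d' > 0" "\<And>x. dist x 0 < d' \<Longrightarrow> \<bar>deriv (deriv \<eta>) x\<bar> > 0"
        using isCont_pos_near[where f = "\<lambda>x. \<bar>deriv (deriv \<eta>) x\<bar>" and ?x0.0 = 0]
          graph_chart_DERIV(3)[OF ch, of 0] c(2) by (auto intro: continuous_intros)
      have "\<bar>deriv (deriv \<eta>) (min d d' / 2)\<bar> > 0" "deriv (deriv \<eta>) (min d d' / 2) = 0"
        using d(1) d'(1) by (intro d'(2) z; simp add: min_def)+
      then show False
        by simp
    qed
    have lin: "\<eta> x = \<eta> 0 + deriv \<eta> 0 * x" if "\<bar>x\<bar> < d" for x
    proof (rule second_derivative_zero_imp_linear[OF _ _ _ that])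
      fix y assume "\<bar>y\<bar> < d"
      then show "(\<eta> has_real_derivative deriv \<eta> y) (at y)"
        "(deriv \<eta> has_real_derivative deriv (deriv \<eta>) y) (at y)" "deriv (deriv \<eta>) y = 0"
        using graph_chart_DERIV[OF ch, of y] d(2) z[of y] z0 by (cases "y = 0"; simp)+
    qed
    define v where "v = m + deriv \<eta> 0 *\<^sub>R n"
    have qv: "q x = e + x *\<^sub>R v" if "\<bar>x\<bar> < d" for x
      using lin[OF that] c(6) by (simp add: q_def v_def algebra_simps)
    have "v \<bullet> m = 1"
      using frame_inner[OF c(1)] by (simp add: v_def inner_add_left)
    then have v: "v \<bullet> v > 0"
      by (metis inner_gt_zero_iff inner_zero_left zero_neq_one)
    have le: "2 * x * (e \<bullet> v) + x\<^sup>2 * (v \<bullet> v) \<le> 0" if "0 < \<bar>x\<bar>" "\<bar>x\<bar> < d" for x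
    proof -
      have "q x \<in> Z"
        using qF[of x] d(2) d(3)[OF that] that by (simp add: Z_def)
      then have "norm (q x) \<le> norm e"
        using e(2) closure_subset by blast
      then have "(norm (q x))\<^sup>2 \<le> (norm e)\<^sup>2"
        by simp
      then show ?thesis
        unfolding power2_norm_eq_inner qv[OF that(2)]
        by (simp add: inner_add_left inner_add_right inner_commute power2_eq_square)
    qed
    \<comment> \<open>Adding the inequalities for \<open>d/2\<close> and \<open>-(d/2)\<close>
      cancels the term linear in \<open>x\<close>.\<close>
    have "(d/2)\<^sup>2 * (v \<bullet> v) \<le> 0"
      using le[of "d/2"] le[of "-(d/2)"] d(1) by simp
    moreover have "(d/2)\<^sup>2 * (v \<bullet> v) > 0"
      using v d(1) by simp
    ultimately show False
      by linarith
  qed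
  show False
  proof (cases "e \<in> frontier \<Omega>'")
    case False
    have "e \<in> - frontier \<Omega>'" "open (- frontier \<Omega>')"
      using False by (auto simp: open_Compl)
    then obtain e0 where e0: "e0 > 0" "ball e e0 \<subseteq> - frontier \<Omega>'"
      by (meson openE)
    obtain d where d: "d > 0" "d \<le> r" "\<And>x. \<bar>x\<bar> < d \<Longrightarrow> dist (e + x *\<^sub>R m + \<eta> x *\<^sub>R n) e < e0"
      using graph_chart_curve_near[OF ch e0(1)] by blast
    show False
    proof (rule claim[OF d(1,2)])
      fix x assume "\<bar>x\<bar> < d"
      then have "q x \<in> ball e e0"
        using d(3) by (simp add: dist_commute q_def)
      then show "q x \<notin> frontier \<Omega>'"
        using e0(2) by blast
    qed
  next
    case True
    show False
    proof (rule graph_chart_cases[OF \<Omega>'(2) cl(2) True c(1)])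
      fix r' h' sg' \<zeta> assume ch': "graph_chart \<Omega>' e n m r' h' sg' \<zeta>" and \<zeta>0: "deriv \<zeta> 0 = 0"
      obtain d where "d > 0" "d \<le> r" "\<And>x. 0 < \<bar>x\<bar> \<Longrightarrow> \<bar>x\<bar> < d \<Longrightarrow> q x \<notin> frontier \<Omega>'"
        using graph_charts_swapped[OF ch ch' \<zeta>0] unfolding q_def by blast
      then show False
        by (rule claim)
    next
      fix r' h' sg' \<zeta> assume ch': "graph_chart \<Omega>' e m n r' h' sg' \<zeta>"
      note c' = graph_chartD[OF ch']
      show False
      proof (cases "deriv \<eta> 0 = deriv \<zeta> 0")
        case False
        obtain d where "d > 0" "d \<le> r" "\<And>x. 0 < \<bar>x\<bar> \<Longrightarrow> \<bar>x\<bar> < d \<Longrightarrow> q x \<notin> frontier \<Omega>'"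
          using graph_charts_different_slope[OF ch ch' False] unfolding q_def by blast
        then show False
          by (rule claim)
      next
        case True
        obtain d1 where d1: "d1 > 0" "d1 \<le> r" "\<And>x. \<bar>x\<bar> < d1 \<Longrightarrow> \<bar>\<eta> x\<bar> < h'"
          using graph_chart_value_near[OF ch c'(3)] by blast
        obtain d2 where d2: "d2 > 0" "d2 \<le> r'" "\<And>x. \<bar>x\<bar> < d2 \<Longrightarrow> \<bar>\<zeta> x\<bar> < h"
          using graph_chart_value_near[OF ch' c(3)] by blast
        define d where "d = min d1 d2"
        have d: "d > 0" "d \<le> d1" "d \<le> d2"
          using d1 d2 by (auto simp: d_def)
        have \<eta>h: "\<bar>\<eta> x\<bar> < h'" and \<zeta>h: "\<bar>\<zeta> x\<bar> < h" if "\<bar>x\<bar> < d" for x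
          using that d d1(3)[of x] d2(3)[of x] by auto
        have xr: "\<bar>x\<bar> < r" "\<bar>x\<bar> < r'" if "\<bar>x\<bar> < d" for x
          using that d d1(2) d2(2) by auto
        define \<phi> where "\<phi> = (\<lambda>x. \<eta> x - \<zeta> x)"
        define \<phi>1 where "\<phi>1 = (\<lambda>x. deriv \<eta> x - deriv \<zeta> x)"
        define \<phi>2 where "\<phi>2 = (\<lambda>x. deriv (deriv \<eta>) x - deriv (deriv \<zeta>) x)"
        have D: "(\<phi> has_real_derivative \<phi>1 x) (at x)" "(\<phi>1 has_real_derivative \<phi>2 x) (at x)" "isCont \<phi>2 x"
          if "\<bar>x\<bar> < d" for x
          using graph_chart_DERIV[OF ch xr(1)[OF that]] graph_chart_DERIV[OF ch' xr(2)[OF that]]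
          unfolding \<phi>_def \<phi>1_def \<phi>2_def by (auto intro!: DERIV_diff continuous_intros)
        \<comment> \<open>Where the graphs differ, each point is off the other boundary, so by
          contraposition of \<open>cv\<close> and \<open>cv'\<close> both graphs have second
          derivative 0. The bounds \<open>\<eta>h\<close> and \<open>\<zeta>h\<close> put each graph
          into the box of the other chart.\<close>
        have nz: "\<phi>2 x = 0" if x: "\<bar>x\<bar> < d" and "\<phi> x \<noteq> 0" for x
        proof -
          have ne: "\<eta> x \<noteq> \<zeta> x"
            using \<open>\<phi> x \<noteq> 0\<close> by (simp add: \<phi>_def)
          have "e + x *\<^sub>R m + \<eta> x *\<^sub>R n \<notin> frontier \<Omega>'"
            using graph_chart_sides(3)[OF ch' xr(2)[OF x] \<eta>h[OF x]] ne by simp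
          then have "deriv (deriv \<eta>) x = 0"
            using cv[OF ch xr(1)[OF x]] by blast
          moreover have "e + x *\<^sub>R m + \<zeta> x *\<^sub>R n \<notin> frontier \<Omega>"
            using graph_chart_sides(3)[OF ch xr(1)[OF x] \<zeta>h[OF x]] ne by simp
          then have "deriv (deriv \<zeta>) x = 0"
            using cv'[OF ch' xr(2)[OF x]] by blast
          ultimately show ?thesis
            by (simp add: \<phi>2_def)
        qed
        \<comment> \<open>If \<open>\<phi>2 x\<close> were nonzero, it would be nonzero around
          \<open>x\<close>, so by \<open>nz\<close> the graphs would agree around \<open>x\<close>,
          and then \<open>\<phi>2 x = 0\<close> after all. Continuity of \<open>\<phi>2\<close> thus
          covers both the set of agreement and its complement.\<close>
        have zz: "\<phi>2 x = 0" if x: "\<bar>x\<bar> < d" for x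
        proof (rule ccontr)
          assume "\<phi>2 x \<noteq> 0"
          then obtain d' where d': "d' > 0" "\<And>y. dist y x < d' \<Longrightarrow> \<bar>\<phi>2 y\<bar> > 0"
            using isCont_pos_near[where f = "\<lambda>x. \<bar>\<phi>2 x\<bar>" and ?x0.0 = x] D(3)[OF x]
            by (auto intro: continuous_intros)
          let ?W = "ball x (min d' (d - \<bar>x\<bar>))"
          have W: "\<bar>y\<bar> < d" "\<phi> y = 0" if "y \<in> ?W" for y
          proof -
            show y: "\<bar>y\<bar> < d"
              using that by (auto simp: dist_real_def)
            show "\<phi> y = 0"
              using nz[OF y] d'(2)[of y] that by (auto simp: dist_commute)
          qed
          have xW: "x \<in> ?W"
            using d' x by simp
          have "\<phi>1 y = 0" if "y \<in> ?W" for y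
          proof -
            have "((\<lambda>_. 0) has_real_derivative \<phi>1 y) (at y)"
              by (rule has_field_derivative_transform_within_open[OF D(1)[OF W(1)[OF that]] open_ball that])
                (use W(2) in auto)
            then show ?thesis
              using DERIV_unique[OF _ DERIV_const] by blast
          qed
          then have "((\<lambda>_. 0) has_real_derivative \<phi>2 x) (at x)"
            by (intro has_field_derivative_transform_within_open[OF D(2)[OF x] open_ball xW]) auto
          then have "\<phi>2 x = 0"
            using DERIV_unique[OF _ DERIV_const] by blast
          then show False
            using \<open>\<phi>2 x \<noteq> 0\<close> by simp
        qed
        have "\<phi> x = \<phi> 0 + \<phi>1 0 * x" if "\<bar>x\<bar> < d" for x
          by (rule second_derivative_zero_imp_linear[OF D(1,2) zz that])
        then have eq: "\<eta> x = \<zeta> x" if "\<bar>x\<bar> < d" for x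
          using that True c(6) c'(6) by (simp add: \<phi>_def \<phi>1_def)
        obtain z where z: "z \<in> Z" "dist z e < min d h"
          using e(1) d(1) c(3) by (metis closure_approachable min_less_iff_conj)
        define x where "x = (z - e) \<bullet> m"
        have zF: "z \<in> frontier \<Omega>"
          using z(1) by (simp add: Z_def)
        have xd: "\<bar>x\<bar> < d"
          using frame_coord_le(1)[OF c(1), of "z - e"] z(2) by (simp add: x_def dist_norm)
        have "dist z e < r" "dist z e < h"
          using z(2) d d1(2) by auto
        then have "z = e + x *\<^sub>R m + \<eta> x *\<^sub>R n"
          using graph_chart_frontierD(2)[OF ch zF] by (simp add: x_def)
        then have "z \<in> frontier \<Omega>'"
          using graph_chart_on_frontier[OF ch' xr(2)[OF xd]] eq[OF xd] by simp
        then show False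
          using z(1) by (simp add: Z_def)
      qed
    qed
  qed
qed

section \<open>From equal boundaries to equal domains\<close>

text \<open>A vertical tangent of the second boundary would separate it from the first, so one frame
  serves both. In a common box each vertical segment meets the boundary once, which forces the same
  \<open>\<eta>\<close>; only the sides \<open>sg\<close> and \<open>sg'\<close> can still
  differ.\<close>

lemma common_graph_chart:
  assumes \<Omega>: "closed \<Omega>" "smooth_boundary \<Omega>" and \<Omega>': "closed \<Omega>'" "smooth_boundary \<Omega>'"
    and eq: "frontier \<Omega> = frontier \<Omega>'" and p: "p \<in> frontier \<Omega>"
  obtains m n r h sg sg' \<eta> where "graph_chart \<Omega> p m n r h sg \<eta>" "graph_chart \<Omega>' p m n r h sg' \<eta>"
proof -
  obtain m n r h sg \<eta> where ch: "graph_chart \<Omega> p m n r h sg \<eta>"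
    by (rule graph_chart_ex[OF \<Omega>(2,1) p])
  note c = graph_chartD[OF ch]
  have p': "p \<in> frontier \<Omega>'"
    using p eq by simp
  obtain r' h' sg' \<zeta> where ch': "graph_chart \<Omega>' p m n r' h' sg' \<zeta>"
  proof (rule graph_chart_cases[OF \<Omega>'(2,1) p' c(1)])
    fix r' h' sg' \<zeta> assume ch': "graph_chart \<Omega>' p n m r' h' sg' \<zeta>" and \<zeta>0: "deriv \<zeta> 0 = 0"
    obtain d where d: "d > 0" "d \<le> r"
      "\<And>x. 0 < \<bar>x\<bar> \<Longrightarrow> \<bar>x\<bar> < d \<Longrightarrow> p + x *\<^sub>R m + \<eta> x *\<^sub>R n \<notin> frontier \<Omega>'"
      using graph_charts_swapped[OF ch ch' \<zeta>0] by blast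
    then have False
      using graph_chart_on_frontier[OF ch, of "d/2"] d(3)[of "d/2"] eq by simp
    then show thesis ..
  qed blast
  note c' = graph_chartD[OF ch']
  have "min r' h' > 0"
    using c'(2,3) by simp
  then obtain r1 h1 where ch1: "graph_chart \<Omega> p m n r1 h1 sg \<eta>" "r1 \<le> min r' h'" "h1 \<le> min r' h'"
    using graph_chart_shrink[OF ch] by metis
  note c1 = graph_chartD[OF ch1(1)]
  have "\<eta> x = \<zeta> x" if x: "\<bar>x\<bar> < r1" for x
  proof -
    have "\<bar>x\<bar> < r'" "\<bar>\<eta> x\<bar> < h'"
      using x c1(7)[OF x] ch1(2,3) by auto
    then show ?thesis
      using graph_chart_sides(3)[OF ch', of x "\<eta> x"] graph_chart_on_frontier[OF ch1(1) x] eq by simp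
  qed
  then have "graph_chart \<Omega>' p m n r1 h1 sg' \<eta>"
    unfolding graph_chart_def using c1 c'(4,8) ch1(2,3) by auto
  with ch1(1) show thesis
    by (rule that)
qed

text \<open>Boundary points are included at the price of a closure: each point of
  \<open>\<Omega>\<close> in the box enters both interiors under an arbitrarily small shift by
  \<open>- sg * k\<close> along \<open>n\<close>. With the same set in both roles it shows that
  boundary points are limits of interior points.\<close>

lemma same_side_closure:
  assumes ch: "graph_chart \<Omega> p m n r h sg \<eta>" and ch': "graph_chart \<Omega>' p m n r h sg \<eta>"
  obtains e where "e > 0" "ball p e \<inter> \<Omega> \<subseteq> closure (interior \<Omega> \<inter> interior \<Omega>')"
proof -
  note c = graph_chartD[OF ch]
  have "z \<in> closure (interior \<Omega> \<inter> interior \<Omega>')" if z: "z \<in> ball p (min r h)" "z \<in> \<Omega>" for z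
    unfolding closure_approachable
  proof (intro allI impI)
    fix e :: real assume e: "e > 0"
    define x where "x = (z - p) \<bullet> m"
    define y where "y = (z - p) \<bullet> n"
    have zxy: "z = p + x *\<^sub>R m + y *\<^sub>R n"
      unfolding x_def y_def by (rule frame_expand_at[OF c(1)])
    have xy: "\<bar>x\<bar> < r" "\<bar>y\<bar> < h"
      using frame_coord_le[OF c(1), of "z - p"] z(1) by (auto simp: x_def y_def dist_norm norm_minus_commute)
    have "sg * (y - \<eta> x) \<le> 0"
      using c(8)[OF xy] z(2) by (simp add: zxy)
    obtain k where k: "k > 0" "k < e" "\<bar>y + k\<bar> < h" "\<bar>y - k\<bar> < h"
      using small_shift[OF e xy(2)] by blast
    have k': "\<bar>y - sg * k\<bar> < h" "sg * ((y - sg * k) - \<eta> x) < 0"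
      using k c(4) \<open>sg * (y - \<eta> x) \<le> 0\<close> by auto
    define w where "w = p + x *\<^sub>R m + (y - sg * k) *\<^sub>R n"
    have "w \<in> interior \<Omega> \<inter> interior \<Omega>'"
      using graph_chart_sides(1)[OF ch xy(1) k'] graph_chart_sides(1)[OF ch' xy(1) k'] by (simp add: w_def)
    moreover have "w - z = (- sg * k) *\<^sub>R n"
      by (simp add: w_def zxy algebra_simps)
    then have "dist w z < e"
      using k(1,2) c(1,4) by (auto simp: dist_norm frame_def)
    ultimately show "\<exists>w\<in>interior \<Omega> \<inter> interior \<Omega>'. dist w z < e"
      by blast
  qed
  then have "ball p (min r h) \<inter> \<Omega> \<subseteq> closure (interior \<Omega> \<inter> interior \<Omega>')"
    by blast
  moreover have "min r h > 0"
    using c(2,3) by simp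
  ultimately show thesis
    by (intro that)
qed

lemma farthest_not_interior:
  fixes p :: "'a::euclidean_space"
  assumes "\<And>y. y \<in> S \<Longrightarrow> norm y \<le> norm p"
  shows "p \<notin> interior S"
proof
  assume "p \<in> interior S"
  then obtain e where e: "e > 0" "ball p e \<subseteq> S"
    by (meson mem_interior)
  obtain b :: 'a where b: "b \<in> Basis"
    using nonempty_Basis by blast
  define u where "u = (if p = 0 then b else p /\<^sub>R norm p)"
  have u: "norm u = 1"
    using b by (auto simp: u_def)
  have n: "norm (p + (e/2) *\<^sub>R u) = norm p + e/2"
  proof (cases "p = 0")
    case False
    then have "u = (1 / norm p) *\<^sub>R p"
      by (simp add: u_def divide_inverse)
    then have "(e/2) *\<^sub>R u = (e/2 / norm p) *\<^sub>R p"
      by (simp only: scaleR_scaleR) simp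
    then have "p + (e/2) *\<^sub>R u = (1 + e/2 / norm p) *\<^sub>R p"
      by (simp only: scaleR_add_left scaleR_one)
    then have "norm (p + (e/2) *\<^sub>R u) = (1 + e/2 / norm p) * norm p"
      using e(1) by simp
    then show ?thesis
      using False by (simp add: distrib_right)
  qed (use e(1) b in \<open>simp add: u_def\<close>)
  have "p + (e/2) *\<^sub>R u \<in> ball p e"
    using e(1) u by (simp add: dist_norm)
  then show False
    using e assms[of "p + (e/2) *\<^sub>R u"] n by auto
qed

text \<open>Equal boundaries leave open on which side each domain lies, and connectedness propagates
  the answer. The part \<open>A\<close> of \<open>\<Omega>\<close> in the closure of the common
  interior is clopen in \<open>\<Omega>\<close>: in a common chart, one common interior point off
  the graph forces equal sides.\<close>

lemma domain_subset_of_frontier_eq: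
  assumes \<Omega>: "compact \<Omega>" "connected \<Omega>" "\<Omega> \<noteq> {}" "smooth_boundary \<Omega>"
    and \<Omega>': "compact \<Omega>'" "smooth_boundary \<Omega>'" and eq: "frontier \<Omega> = frontier \<Omega>'"
  shows "\<Omega> \<subseteq> \<Omega>'"
proof -
  define C where "C = interior \<Omega> \<inter> interior \<Omega>'"
  have cl: "closed \<Omega>" "closed \<Omega>'"
    using \<Omega>(1) \<Omega>'(1) compact_imp_closed by auto
  define A where "A = \<Omega> \<inter> closure C"
  have bounded_by: "norm z \<le> R" if S: "compact S" "frontier S \<subseteq> cball 0 R" "z \<in> S" for S R and z :: plane
  proof -
    obtain x where x: "x \<in> S" "\<And>y. y \<in> S \<Longrightarrow> norm y \<le> norm x"
      using continuous_attains_sup[OF S(1), of norm] S(3) continuous_on_norm_id by blast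
    have "x \<notin> interior S"
      using farthest_not_interior[of S x] x(2) by blast
    then have "x \<in> frontier S"
      using x(1) closure_subset by (auto simp: frontier_def)
    then show ?thesis
      using S(2) x(2)[OF S(3)] by auto
  qed
  have same: "\<exists>e>0. ball p e \<inter> \<Omega> \<subseteq> closure C" if p: "p \<in> frontier \<Omega>" and
    side: "\<And>m n r h sg sg' \<eta>. graph_chart \<Omega> p m n r h sg \<eta> \<Longrightarrow> graph_chart \<Omega>' p m n r h sg' \<eta> \<Longrightarrow> sg = sg'" for p
  proof -
    obtain m n r h sg sg' \<eta> where ch: "graph_chart \<Omega> p m n r h sg \<eta>" "graph_chart \<Omega>' p m n r h sg' \<eta>"
      by (rule common_graph_chart[OF cl(1) \<Omega>(4) cl(2) \<Omega>'(2) eq p])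
    with side have "sg = sg'"
      by blast
    with ch show ?thesis
      using same_side_closure[of \<Omega> p m n r h sg \<eta> \<Omega>'] unfolding C_def by metis
  qed
  have "openin (top_of_set \<Omega>) A"
    unfolding openin_contains_ball
  proof (intro conjI ballI)
    show "A \<subseteq> \<Omega>"
      by (simp add: A_def)
    fix x assume x: "x \<in> A"
    show "\<exists>e>0. ball x e \<inter> \<Omega> \<subseteq> A"
    proof (cases "x \<in> frontier \<Omega>")
      case False
      have "x \<in> interior \<Omega>"
        using x False closure_subset by (auto simp: A_def frontier_def)
      moreover have "closure C \<subseteq> \<Omega>'"
        by (rule closure_minimal[OF _ cl(2)]) (use interior_subset in \<open>auto simp: C_def\<close>)
      then have "x \<in> interior \<Omega>'"
        using x False eq closure_subset by (auto simp: A_def frontier_def)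
      ultimately have "x \<in> C" "open C"
        by (auto simp: C_def)
      then obtain e where "e > 0" "ball x e \<subseteq> C"
        by (meson openE)
      then show ?thesis
        using closure_subset[of C] by (intro exI[of _ e]) (auto simp: A_def)
    next
      case True
      have "\<exists>e>0. ball x e \<inter> \<Omega> \<subseteq> closure C"
      proof (rule same[OF True])
        fix m n r h sg sg' \<eta>
        assume ch: "graph_chart \<Omega> x m n r h sg \<eta>" "graph_chart \<Omega>' x m n r h sg' \<eta>"
        note c = graph_chartD[OF ch(1)] and c' = graph_chartD[OF ch(2)]
        have "min r h > 0" "x \<in> closure C"
          using c x by (simp_all add: A_def)
        then obtain z where z: "z \<in> C" "dist z x < min r h"
          unfolding closure_approachable by blast
        define a where "a = (z - x) \<bullet> m"
        define b where "b = (z - x) \<bullet> n"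
        have zab: "x + a *\<^sub>R m + b *\<^sub>R n = z"
          unfolding a_def b_def by (rule frame_expand_at[OF c(1), symmetric])
        have ab: "\<bar>a\<bar> < r" "\<bar>b\<bar> < h"
          using frame_coord_le[OF c(1), of "z - x"] z(2) by (auto simp: a_def b_def dist_norm)
        have zC: "z \<in> \<Omega>" "z \<in> \<Omega>'" "z \<notin> frontier \<Omega>"
          using z(1) interior_subset by (auto simp: C_def frontier_def)
        have "b \<noteq> \<eta> a"
          using graph_chart_sides(3)[OF ch(1) ab] zC(3) by (simp add: zab)
        moreover have "sg * (b - \<eta> a) \<le> 0" "sg' * (b - \<eta> a) \<le> 0"
          using c(8)[OF ab] c'(8)[OF ab] zC by (simp_all add: zab)
        ultimately show "sg = sg'"
          using c(4) c'(4) by auto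
      qed
      then show ?thesis
        by (auto simp: A_def)
    qed
  qed
  moreover have "closedin (top_of_set \<Omega>) A"
    unfolding A_def by (rule closedin_closed_Int) simp
  moreover have "A \<noteq> {}"
  proof -
    obtain p where p: "p \<in> \<Omega>" "\<And>y. y \<in> \<Omega> \<Longrightarrow> norm y \<le> norm p"
      using continuous_attains_sup[OF \<Omega>(1,3), of norm] continuous_on_norm_id by blast
    have fs: "frontier \<Omega> \<subseteq> cball 0 (norm p)"
      using frontier_subset_closed[OF cl(1)] p(2) by auto
    \<comment> \<open>A compact set attains its largest norm on its frontier, so with equal
      frontiers \<open>p\<close> is farthest in the union as well. Opposite sides at
      \<open>p\<close> would make \<open>p\<close> interior to the union, hence the sides agree
      there and \<open>A\<close> is nonempty.\<close>
    have le: "norm z \<le> norm p" if "z \<in> \<Omega> \<union> \<Omega>'" for z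
      using that bounded_by[OF \<Omega>(1) fs] bounded_by[OF \<Omega>'(1), of "norm p"] fs eq by auto
    have pi: "p \<notin> interior (\<Omega> \<union> \<Omega>')"
      using farthest_not_interior[of "\<Omega> \<union> \<Omega>'" p] le by blast
    have pF: "p \<in> frontier \<Omega>"
      using pi p(1) closure_subset interior_mono[of \<Omega> "\<Omega> \<union> \<Omega>'"] by (auto simp: frontier_def)
    have "\<exists>e>0. ball p e \<inter> \<Omega> \<subseteq> closure C"
    proof (rule same[OF pF], rule ccontr)
      fix m n r h sg sg' \<eta>
      assume ch: "graph_chart \<Omega> p m n r h sg \<eta>" "graph_chart \<Omega>' p m n r h sg' \<eta>" "sg \<noteq> sg'"
      note c = graph_chartD[OF ch(1)] and c' = graph_chartD[OF ch(2)]
      have "z \<in> \<Omega> \<union> \<Omega>'" if "z \<in> ball p (min r h)" for z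
      proof -
        have "\<bar>(z - p) \<bullet> m\<bar> < r" "\<bar>(z - p) \<bullet> n\<bar> < h"
          using frame_coord_le[OF c(1), of "z - p"] that by (auto simp: dist_norm norm_minus_commute)
        from c(8)[OF this] c'(8)[OF this] show ?thesis
          unfolding frame_expand_at[OF c(1), of z p, symmetric] using c(4) c'(4) ch(3) by auto
      qed
      then have "ball p (min r h) \<subseteq> \<Omega> \<union> \<Omega>'"
        by blast
      then have "p \<in> interior (\<Omega> \<union> \<Omega>')"
        using c(2,3) by (meson mem_interior min_less_iff_conj)
      then show False
        using pi by blast
    qed
    then obtain e where "e > 0" "ball p e \<inter> \<Omega> \<subseteq> closure C"
      by blast
    then have "p \<in> A"
      using p(1) by (auto simp: A_def)
    then show ?thesis
      by blast
  qed
  ultimately have "A = \<Omega>"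
    using \<Omega>(2) unfolding connected_clopen by blast
  moreover have "closure C \<subseteq> \<Omega>'"
    by (rule closure_minimal[OF _ cl(2)]) (use interior_subset in \<open>auto simp: C_def\<close>)
  ultimately show ?thesis
    by (auto simp: A_def)
qed

section \<open>The smoothed V-line transform\<close>

definition ray_length :: "plane set \<Rightarrow> plane \<Rightarrow> plane \<Rightarrow> real" where
  "ray_length \<Omega> v x = (LINT t:{0..}|lborel. indicator \<Omega> (x + t *\<^sub>R v))"

lemma integrable_indicator_bounded:
  fixes S :: "'a::euclidean_space set"
  assumes "S \<in> sets borel" "bounded S"
  shows "integrable lborel (indicator S :: 'a \<Rightarrow> real)"
  using emeasure_bounded_finite[OF assms(2)] assms(1) by (intro integrable_real_indicator) auto

lemmas integrable_indicator_ball = integrable_indicator_bounded[OF borel_open[OF open_ball] bounded_ball]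

lemma norm_unit_dir [simp]: "norm (unit_dir \<theta>) = 1"
  using frame_unit_dir[of \<theta>] by (simp add: frame_def)

lemma unit_dir_inner: "unit_dir \<alpha> \<bullet> unit_dir \<beta> = cos (\<alpha> - \<beta>)"
  by (simp add: unit_dir_def inner_vec_def sum_2 cos_diff)

lemma unit_dir_add_pi: "unit_dir (\<theta> + pi) = - unit_dir \<theta>"
  by (simp add: unit_dir_def vec_eq_iff forall_2)

context
  fixes \<Omega> :: "plane set"
  assumes \<Omega>: "compact \<Omega>" "\<Omega> \<subseteq> ball 0 1"
begin

private lemma borel_\<Omega>: "\<Omega> \<in> sets borel"
  using \<Omega>(1) by (simp add: borel_closed compact_imp_closed)

private lemma borel_chi: "(indicator \<Omega> :: plane \<Rightarrow> real) \<in> borel_measurable borel"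
  using borel_\<Omega> by (rule borel_measurable_indicator)

private lemma ray_interval:
  assumes "norm v = 1" "x + t *\<^sub>R v \<in> \<Omega>"
  shows "t \<in> {- (x \<bullet> v) - 1..- (x \<bullet> v) + 1}"
proof -
  have "\<bar>(x + t *\<^sub>R v) \<bullet> v\<bar> < 1"
    using Cauchy_Schwarz_ineq2[of "x + t *\<^sub>R v" v] assms \<Omega>(2) by force
  then show ?thesis
    using assms(1) by (auto simp: inner_add_left norm_eq_1 abs_less_iff)
qed

private lemma borel_ray: "(\<lambda>t. indicator {0..} t * indicator \<Omega> (x + t *\<^sub>R v) :: real) \<in> borel_measurable borel"
  using borel_chi by measurable

lemma integrable_ray:
  assumes "norm v = 1"
  shows "integrable lborel (\<lambda>t. indicator {0..} t * indicator \<Omega> (x + t *\<^sub>R v) :: real)"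
proof (rule Bochner_Integration.integrable_bound)
  show "integrable lborel (indicator {- (x \<bullet> v) - 1..- (x \<bullet> v) + 1} :: real \<Rightarrow> real)"
    by simp
  show "(\<lambda>t. indicator {0..} t * indicator \<Omega> (x + t *\<^sub>R v) :: real) \<in> borel_measurable lborel"
    using borel_ray by simp
  show "AE t in lborel. norm (indicator {0..} t * indicator \<Omega> (x + t *\<^sub>R v) :: real)
      \<le> norm (indicator {- (x \<bullet> v) - 1..- (x \<bullet> v) + 1} t :: real)"
    using ray_interval[OF assms, of x] by (intro AE_I2) (auto simp: indicator_def)
qed

lemma ray_length_eq: "ray_length \<Omega> v x = (LINT t|lborel. indicator {0..} t * indicator \<Omega> (x + t *\<^sub>R v))"
  by (simp add: ray_length_def set_lebesgue_integral_def)

lemma ray_length_nonneg: "0 \<le> ray_length \<Omega> v x"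
  unfolding ray_length_eq by (rule integral_nonneg_AE) simp

lemma ray_length_le:
  assumes "norm v = 1" "\<And>t. 0 \<le> t \<Longrightarrow> x + t *\<^sub>R v \<in> \<Omega> \<Longrightarrow> c \<le> t \<and> t \<le> c + l" "l \<ge> 0"
  shows "ray_length \<Omega> v x \<le> l"
proof -
  have i: "integrable lborel (indicator {c..c + l} :: real \<Rightarrow> real)"
    by (rule integrable_indicator_bounded) auto
  have "ray_length \<Omega> v x \<le> (LINT t|lborel. indicator {c..c + l} t)"
    unfolding ray_length_eq
    by (rule integral_mono[OF integrable_ray[OF assms(1)] i]) (use assms(2,3) in \<open>auto simp: indicator_def\<close>)
  then show ?thesis
    using assms(3) by simp
qed

lemma ray_length_le_2: "norm v = 1 \<Longrightarrow> ray_length \<Omega> v x \<le> 2"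
  using ray_interval[of v x] by (intro ray_length_le[where c = "- (x \<bullet> v) - 1"]) auto

lemma ray_length_ge:
  assumes "norm v = 1" "0 \<le> c" "0 \<le> l" "\<And>t. c \<le> t \<Longrightarrow> t \<le> c + l \<Longrightarrow> x + t *\<^sub>R v \<in> \<Omega>"
  shows "l \<le> ray_length \<Omega> v x"
proof -
  have i: "integrable lborel (indicator {c..c + l} :: real \<Rightarrow> real)"
    by (rule integrable_indicator_bounded) auto
  have "(LINT t|lborel. indicator {c..c + l} t) \<le> ray_length \<Omega> v x"
    unfolding ray_length_eq
    by (rule integral_mono[OF i integrable_ray[OF assms(1)]]) (use assms(2-4) in \<open>auto simp: indicator_def\<close>)
  then show ?thesis
    using assms(3) by simp
qed

lemma borel_measurable_ray_length: "ray_length \<Omega> v \<in> borel_measurable borel"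
proof -
  have "(\<lambda>(x, t). indicator {0..} t * indicator \<Omega> (x + t *\<^sub>R v) :: real) \<in> borel_measurable (borel \<Otimes>\<^sub>M lborel)"
    using borel_chi by measurable
  then show ?thesis
    unfolding ray_length_eq[abs_def] by (rule lborel.borel_measurable_lebesgue_integral)
qed

lemma vline_indicator:
  "vline a b \<psi> (indicator \<Omega>) x \<phi> = a * ray_length \<Omega> (unit_dir (\<phi> + 2 * \<psi> - pi / 2)) x
    + b * ray_length \<Omega> (unit_dir (\<phi> - pi / 2)) x"
  by (simp add: vline_def ray_length_def)

lemma vline_indicator_bounds:
  assumes "a > 0" "b > 0"
  shows "0 \<le> vline a b \<psi> (indicator \<Omega>) x \<phi>" "vline a b \<psi> (indicator \<Omega>) x \<phi> \<le> 2 * (a + b)"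
  unfolding vline_indicator distrib_left
  using assms ray_length_nonneg ray_length_le_2
  by (auto intro!: add_nonneg_nonneg add_mono mult_left_mono simp: mult.commute[of 2])

lemma borel_measurable_vline_indicator:
  "(\<lambda>x. vline a b \<psi> (indicator \<Omega>) x \<phi>) \<in> borel_measurable borel"
  unfolding vline_indicator using borel_measurable_ray_length by measurable

end

lemma smoothed_vline_scale:
  "smoothed_vline k a b \<psi> (\<lambda>x. u * f x) x \<phi> = u * smoothed_vline k a b \<psi> f x \<phi>"
proof -
  have "vline a b \<psi> (\<lambda>x. u * f x) y \<phi> = u * vline a b \<psi> f y \<phi>" for y
    by (simp add: vline_def set_lebesgue_integral_def mult.left_commute[of _ u] distrib_left)
  then show ?thesis
    by (simp add: smoothed_vline_def convolve_def mult.left_commute[of _ u])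
qed

section \<open>Convolution with the disc kernel\<close>

context
  fixes g :: "plane \<Rightarrow> real" and \<epsilon> M :: real
  assumes g: "g \<in> borel_measurable borel" "\<And>x. 0 \<le> g x" "\<And>x. g x \<le> M" and \<epsilon>: "\<epsilon> > 0"
begin

private lemma M0: "M \<ge> 0"
  using g(2,3) order_trans by blast

lemma integral_disc_kernel: "integrable lborel (disc_kernel \<epsilon>)" "(LINT y|lborel. disc_kernel \<epsilon> y) = pi"
proof -
  have i: "integrable lborel (indicator (ball 0 \<epsilon>) :: plane \<Rightarrow> real)"
    by (rule integrable_indicator_ball)
  have e: "disc_kernel \<epsilon> = (\<lambda>y. 1 / \<epsilon>\<^sup>2 * indicator (ball 0 \<epsilon>) y)"
    by (rule ext) (simp add: disc_kernel_def)
  show "integrable lborel (disc_kernel \<epsilon>)"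
    unfolding e by (rule integrable_mult_right[OF i])
  show "(LINT y|lborel. disc_kernel \<epsilon> y) = pi"
    unfolding e using \<epsilon> content_ball[of \<epsilon> "0 :: plane"] by (simp add: unit_ball_vol_2)
qed

lemma integrable_convolve: "integrable lborel (\<lambda>y. disc_kernel \<epsilon> y * g (x - y))"
proof (rule Bochner_Integration.integrable_bound)
  show "integrable lborel (\<lambda>y. M * disc_kernel \<epsilon> y)"
    by (rule integrable_mult_right[OF integral_disc_kernel(1)])
  have "disc_kernel \<epsilon> \<in> borel_measurable borel"
    using integral_disc_kernel(1) by (auto dest: borel_measurable_integrable)
  then show "(\<lambda>y. disc_kernel \<epsilon> y * g (x - y)) \<in> borel_measurable lborel"
    using g(1) by measurable
  show "AE y in lborel. norm (disc_kernel \<epsilon> y * g (x - y)) \<le> norm (M * disc_kernel \<epsilon> y)"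
    using g(2,3) M0 by (intro AE_I2) (auto simp: disc_kernel_def indicator_def abs_mult divide_right_mono)
qed

lemma convolve_le:
  assumes "\<And>y. y \<in> ball 0 \<epsilon> \<Longrightarrow> g (x - y) \<le> c"
  shows "convolve (disc_kernel \<epsilon>) g x \<le> pi * c"
proof -
  have "convolve (disc_kernel \<epsilon>) g x \<le> (LINT y|lborel. c * disc_kernel \<epsilon> y)"
    unfolding convolve_def
    by (rule integral_mono[OF integrable_convolve integrable_mult_right[OF integral_disc_kernel(1)]])
      (use assms in \<open>auto simp: disc_kernel_def indicator_def divide_right_mono\<close>)
  then show ?thesis
    using integral_disc_kernel(2) by (simp add: mult.commute)
qed

lemma convolve_ge:
  assumes "\<And>y. y \<in> ball 0 \<epsilon> \<Longrightarrow> c \<le> g (x - y)"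
  shows "pi * c \<le> convolve (disc_kernel \<epsilon>) g x"
proof -
  have "(LINT y|lborel. c * disc_kernel \<epsilon> y) \<le> convolve (disc_kernel \<epsilon>) g x"
    unfolding convolve_def
    by (rule integral_mono[OF integrable_mult_right[OF integral_disc_kernel(1)] integrable_convolve])
      (use assms in \<open>auto simp: disc_kernel_def indicator_def divide_right_mono\<close>)
  then show ?thesis
    using integral_disc_kernel(2) by (simp add: mult.commute)
qed

lemma convolve_nonneg: "0 \<le> convolve (disc_kernel \<epsilon>) g x"
  using convolve_ge[of 0 x] g(2) by simp

text \<open>The reflection \<open>y \<mapsto> x - y\<close> moves the dependence on \<open>x\<close>
  from \<open>g\<close>, which is only measurable, into the disc, where it can be estimated by
  areas.\<close>

private lemma convolve_eq: "convolve (disc_kernel \<epsilon>) g x = (LINT z|lborel. 1 / \<epsilon>\<^sup>2 * (indicator (ball x \<epsilon>) z * g z))"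
proof -
  define F where "F = (\<lambda>z. 1 / \<epsilon>\<^sup>2 * (indicator (ball x \<epsilon>) z * g z))"
  have F: "F \<in> borel_measurable borel"
    unfolding F_def
    by (intro borel_measurable_times borel_measurable_indicator borel_measurable_const g(1)) auto
  have "(lborel :: plane measure) = density (distr lborel borel (\<lambda>y. x + (-1) *\<^sub>R y)) (\<lambda>_. ennreal (\<bar>- 1\<bar> ^ DIM(plane)))"
    by (rule lborel_affine) simp
  then have d: "(lborel :: plane measure) = distr lborel borel (\<lambda>y. x - y)"
    by (simp add: density_1)
  have "(LINT z|lborel. F z) = (LINT z|distr lborel borel (\<lambda>y. x - y). F z)"
    using d by simp
  also have "\<dots> = (LINT y|lborel. F (x - y))"
    by (rule integral_distr) (use F in \<open>auto intro: borel_measurable_continuous_onI continuous_intros\<close>)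
  also have "\<dots> = convolve (disc_kernel \<epsilon>) g x"
    unfolding convolve_def F_def
    by (intro Bochner_Integration.integral_cong) (auto simp: disc_kernel_def indicator_def dist_norm)
  finally show ?thesis
    by (simp add: F_def)
qed

private lemma integrable_ball_g: "integrable lborel (\<lambda>z. indicator (ball x r) z * g z)"
proof (rule Bochner_Integration.integrable_bound)
  show "integrable lborel (\<lambda>z. M * indicator (ball x r) z)"
    by (intro integrable_mult_right integrable_indicator_ball)
  show "(\<lambda>z. indicator (ball x r) z * g z) \<in> borel_measurable lborel"
    using g(1) by (intro borel_measurable_times borel_measurable_indicator) auto
  show "AE z in lborel. norm (indicator (ball x r) z * g z) \<le> norm (M * indicator (ball x r) z)"
    using g(2,3) M0 by (intro AE_I2) (auto simp: indicator_def)
qed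

text \<open>For centres at distance \<open>d \<le> \<epsilon>\<close>, the symmetric difference of
  the discs is covered by the two annuli with radii \<open>\<epsilon> - d\<close> and
  \<open>\<epsilon>\<close>, each of area at most \<open>2 * pi * \<epsilon> * d\<close>. The bound
  \<open>g \<le> M\<close> and the factor \<open>1 / \<epsilon>^2\<close> give the constant. For
  larger distances the total mass \<open>pi\<close> of the kernel suffices.\<close>

lemma convolve_lipschitz:
  "\<bar>convolve (disc_kernel \<epsilon>) g x - convolve (disc_kernel \<epsilon>) g x'\<bar> \<le> (4 * pi * M / \<epsilon>) * dist x x'"
proof (cases "dist x x' \<le> \<epsilon>")
  case False
  have "\<bar>convolve (disc_kernel \<epsilon>) g x - convolve (disc_kernel \<epsilon>) g x'\<bar> \<le> pi * M"
    using convolve_le[of x M] convolve_le[of x' M] g(3) convolve_nonneg[of x] convolve_nonneg[of x'] by auto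
  also have "\<dots> \<le> (pi * M / \<epsilon>) * dist x x'"
    using False \<epsilon> M0 by (simp add: field_simps mult_left_mono)
  also have "\<dots> \<le> (4 * pi * M / \<epsilon>) * dist x x'"
    using \<epsilon> M0 by (intro mult_right_mono divide_right_mono) auto
  finally show ?thesis .
next
  case True
  define d where "d = dist x x'"
  have d: "0 \<le> d" "d \<le> \<epsilon>"
    using True by (auto simp: d_def)
  define S where "S = (\<lambda>(y::plane) z. indicator (ball y \<epsilon>) z - indicator (ball y (\<epsilon> - d)) z :: real)"
  have iS: "integrable lborel (S y)" for y
    unfolding S_def by (intro Bochner_Integration.integrable_diff integrable_indicator_ball)
  have intS: "(LINT z|lborel. S y z) \<le> 2 * pi * \<epsilon> * d" for y
  proof -
    have "(LINT z|lborel. S y z) = pi * \<epsilon>\<^sup>2 - pi * (\<epsilon> - d)\<^sup>2"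
      unfolding S_def Bochner_Integration.integral_diff[OF integrable_indicator_ball integrable_indicator_ball]
      using \<epsilon> d by (simp add: content_ball unit_ball_vol_2)
    also have "\<dots> = 2 * pi * \<epsilon> * d - pi * d\<^sup>2"
      by (simp add: power2_eq_square algebra_simps)
    also have "\<dots> \<le> 2 * pi * \<epsilon> * d"
      by simp
    finally show ?thesis .
  qed
  have pw: "\<bar>indicator (ball x \<epsilon>) z * g z - indicator (ball x' \<epsilon>) z * g z\<bar> \<le> M * (S x z + S x' z)" for z
  proof -
    have S0: "S y z \<ge> 0" for y
      using d by (auto simp: S_def indicator_def)
    have "S x z + S x' z \<ge> 1" if "(z \<in> ball x \<epsilon>) \<noteq> (z \<in> ball x' \<epsilon>)"
    proof (cases "z \<in> ball x \<epsilon>")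
      case True
      then have "z \<notin> ball x' \<epsilon>"
        using that by simp
      then have "z \<notin> ball x (\<epsilon> - d)"
        using dist_triangle[of x' z x] by (auto simp: d_def dist_commute)
      then have "S x z = 1"
        using True by (simp add: S_def)
      then show ?thesis
        using S0[of x'] by simp
    next
      case False
      then have "z \<in> ball x' \<epsilon>"
        using that by simp
      moreover have "z \<notin> ball x' (\<epsilon> - d)"
        using False dist_triangle[of x z x'] by (auto simp: d_def dist_commute)
      ultimately have "S x' z = 1"
        by (simp add: S_def)
      then show ?thesis
        using S0[of x] by simp
    qed
    then have "M * 1 \<le> M * (S x z + S x' z)" if "(z \<in> ball x \<epsilon>) \<noteq> (z \<in> ball x' \<epsilon>)"
      using that M0 by (intro mult_left_mono) auto
    moreover have "M * (S x z + S x' z) \<ge> 0"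
      using S0 M0 by simp
    ultimately show ?thesis
      using g(2,3)[of z] by (cases "z \<in> ball x \<epsilon>"; cases "z \<in> ball x' \<epsilon>") (auto simp: indicator_def intro: order_trans)
  qed
  have "convolve (disc_kernel \<epsilon>) g x - convolve (disc_kernel \<epsilon>) g x'
      = (LINT z|lborel. 1 / \<epsilon>\<^sup>2 * (indicator (ball x \<epsilon>) z * g z - indicator (ball x' \<epsilon>) z * g z))"
    unfolding convolve_eq right_diff_distrib[of "1 / \<epsilon>\<^sup>2"]
    by (intro Bochner_Integration.integral_diff[symmetric] integrable_mult_right integrable_ball_g)
  also have "\<dots> = 1 / \<epsilon>\<^sup>2 * (LINT z|lborel. indicator (ball x \<epsilon>) z * g z - indicator (ball x' \<epsilon>) z * g z)"
    by (rule integral_mult_right_zero)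
  finally have "\<bar>convolve (disc_kernel \<epsilon>) g x - convolve (disc_kernel \<epsilon>) g x'\<bar>
      = 1 / \<epsilon>\<^sup>2 * \<bar>LINT z|lborel. indicator (ball x \<epsilon>) z * g z - indicator (ball x' \<epsilon>) z * g z\<bar>"
    by (simp add: abs_mult)
  also have "\<dots> \<le> 1 / \<epsilon>\<^sup>2 * (LINT z|lborel. M * (S x z + S x' z))"
  proof (rule mult_left_mono)
    have i: "integrable lborel (\<lambda>z. indicator (ball x \<epsilon>) z * g z - indicator (ball x' \<epsilon>) z * g z)"
      by (intro Bochner_Integration.integrable_diff integrable_ball_g)
    have "\<bar>LINT z|lborel. indicator (ball x \<epsilon>) z * g z - indicator (ball x' \<epsilon>) z * g z\<bar>
        \<le> (LINT z|lborel. \<bar>indicator (ball x \<epsilon>) z * g z - indicator (ball x' \<epsilon>) z * g z\<bar>)"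
      by (rule integral_abs_bound)
    also have "\<dots> \<le> (LINT z|lborel. M * (S x z + S x' z))"
      by (rule integral_mono[OF integrable_abs[OF i] integrable_mult_right[OF Bochner_Integration.integrable_add[OF iS iS]] pw])
    finally show "\<bar>LINT z|lborel. indicator (ball x \<epsilon>) z * g z - indicator (ball x' \<epsilon>) z * g z\<bar>
        \<le> (LINT z|lborel. M * (S x z + S x' z))" .
  qed simp
  also have "(LINT z|lborel. M * (S x z + S x' z)) = M * ((LINT z|lborel. S x z) + (LINT z|lborel. S x' z))"
    using Bochner_Integration.integral_add[OF iS[of x] iS[of x']] by simp
  also have "1 / \<epsilon>\<^sup>2 * (M * ((LINT z|lborel. S x z) + (LINT z|lborel. S x' z)))
      \<le> 1 / \<epsilon>\<^sup>2 * (M * (2 * pi * \<epsilon> * d + 2 * pi * \<epsilon> * d))"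
    using intS M0 by (intro mult_left_mono add_mono) auto
  also have "\<dots> = (4 * pi * M / \<epsilon>) * d"
    using \<epsilon> by (simp add: power2_eq_square field_simps)
  finally show ?thesis
    by (simp add: d_def)
qed

end

text \<open>\<open>smooth_on\<close> gives continuity of each directional derivative separately;
  bounds for the two directions of a frame bound the operator norm on the convex compact
  disc.\<close>

lemma smooth_on_lipschitz_ball:
  fixes w :: "plane \<Rightarrow> real"
  assumes "smooth_on UNIV w"
  obtains L where "L \<ge> 0" "\<And>x y. x \<in> cball 0 1 \<Longrightarrow> y \<in> cball 0 1 \<Longrightarrow> \<bar>w x - w y\<bar> \<le> L * dist x y"
proof -
  define D where "D = (\<lambda>x. frechet_derivative w (at x))"
  have der: "(w has_derivative D x) (at x)" for x
    unfolding D_def using smooth_on_has_derivative[OF assms] by blast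
  have "\<exists>B. \<forall>x\<in>cball 0 1. \<bar>D x v\<bar> \<le> B" for v
  proof -
    have "continuous_on (cball 0 1) (\<lambda>x. D x v)"
      using smooth_on_imp_continuous_on[OF smooth_on_frechet_derivative[OF assms]] continuous_on_subset
      unfolding D_def by blast
    then have "bounded ((\<lambda>x. D x v) ` cball 0 1)"
      by (intro compact_imp_bounded compact_continuous_image) auto
    then show ?thesis
      by (auto simp: bounded_iff)
  qed
  then obtain B where B: "\<And>v x. x \<in> cball 0 1 \<Longrightarrow> \<bar>D x v\<bar> \<le> B v"
    by metis
  let ?m = "unit_dir 0" and ?n = "unit_dir (0 + pi / 2)"
  note fr = frame_unit_dir[of 0]
  have B0: "B v \<ge> 0" for v
    using B[of 0 v] by simp
  have bound: "\<bar>D x v\<bar> \<le> (B ?m + B ?n) * norm v" if x: "x \<in> cball 0 1" for x v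
  proof -
    have lin: "linear (D x)"
      using der has_derivative_linear by blast
    have "D x ((v \<bullet> ?m) *\<^sub>R ?m + (v \<bullet> ?n) *\<^sub>R ?n) = (v \<bullet> ?m) * D x ?m + (v \<bullet> ?n) * D x ?n"
      by (simp only: linear_add[OF lin] linear_cmul[OF lin] real_scaleR_def)
    then have "D x v = (v \<bullet> ?m) * D x ?m + (v \<bullet> ?n) * D x ?n"
      by (simp only: frame_expand[OF fr, symmetric])
    then have "\<bar>D x v\<bar> \<le> \<bar>v \<bullet> ?m\<bar> * \<bar>D x ?m\<bar> + \<bar>v \<bullet> ?n\<bar> * \<bar>D x ?n\<bar>"
      by (metis abs_mult abs_triangle_ineq)
    also have "\<dots> \<le> norm v * B ?m + norm v * B ?n"
      using frame_coord_le[OF fr, of v] B[OF x] by (intro add_mono mult_mono) auto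
    finally show ?thesis
      by (simp add: algebra_simps)
  qed
  show thesis
  proof (rule that[of "B ?m + B ?n"])
    fix x y :: plane assume xy: "x \<in> cball 0 1" "y \<in> cball 0 1"
    have "norm (w x - w y) \<le> (B ?m + B ?n) * norm (x - y)"
    proof (rule differentiable_bound[of "cball 0 1"])
      show "(w has_derivative D z) (at z within cball 0 1)" for z
        using der by (rule has_derivative_at_withinI)
      show "onorm (D z) \<le> B ?m + B ?n" if "z \<in> cball 0 1" for z
        using bound[OF that] B0 by (intro onorm_bound) auto
    qed (use xy in auto)
    then show "\<bar>w x - w y\<bar> \<le> (B ?m + B ?n) * dist x y"
      by (simp add: dist_norm)
  qed (use B0 in auto)
qed

section \<open>Determining the density\<close>

lemma abs_exp_minus_diff_le:
  fixes p q :: real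
  assumes "p \<ge> 0" "q \<ge> 0"
  shows "\<bar>exp (- p) - exp (- q)\<bar> \<le> \<bar>p - q\<bar>"
proof -
  have *: "exp (- p) - exp (- q) \<le> q - p" if "0 \<le> p" "p \<le> q" for p q :: real
  proof -
    have "exp (- p) - exp (- q) = exp (- p) * (1 - exp (p - q))"
      by (simp add: right_diff_distrib flip: exp_add)
    also have "\<dots> \<le> 1 * (1 - exp (p - q))"
      using that by (intro mult_right_mono) auto
    also have "\<dots> \<le> 1 - (1 + (p - q))"
      unfolding mult_1 by (rule diff_left_mono[OF exp_ge_add_one_self])
    also have "\<dots> = q - p"
      by simp
    finally show ?thesis .
  qed
  show ?thesis
  proof (cases "p \<le> q")
    case True
    then have "exp (- q) \<le> exp (- p)"
      by simp
    then show ?thesis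
      using *[OF assms(1) True] True by simp
  next
    case False
    then have "exp (- p) \<le> exp (- q)"
      by simp
    then show ?thesis
      using *[OF assms(2), of p] False by simp
  qed
qed

text \<open>At a farthest point \<open>\<Omega>\<close> lies below the tangent of the circle through
  \<open>p\<close>. With \<open>n\<close> outward, the boundary is therefore a graph with maximum 0
  at 0, hence slope 0, and \<open>\<Omega>\<close> is below it. A segment backwards along
  \<open>v\<close> descends linearly and so gets below any \<open>\<eta>\<close> of order
  o(x).\<close>

lemma inward_segment:
  assumes cl: "closed \<Omega>" and sb: "smooth_boundary \<Omega>" and pF: "p \<in> frontier \<Omega>"
    and far: "\<And>y. y \<in> \<Omega> \<Longrightarrow> norm y \<le> norm p"
    and \<theta>: "p = norm p *\<^sub>R unit_dir \<theta>" and v: "norm v = 1" "v \<bullet> unit_dir \<theta> > 0"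
  obtains T where "T > 0" "\<And>t. 0 < t \<Longrightarrow> t \<le> T \<Longrightarrow> p - t *\<^sub>R v \<in> interior \<Omega>"
proof -
  define R where "R = norm p"
  define n where "n = unit_dir \<theta>"
  define m where "m = unit_dir (\<theta> + pi / 2)"
  have fr: "frame m n"
    unfolding m_def n_def by (rule frame_swap[OF frame_unit_dir])
  have pR: "p = R *\<^sub>R n"
    using \<theta> by (simp add: R_def n_def)
  have R0: "R \<ge> 0"
    by (simp add: R_def)
  have outside: "x\<^sup>2 + (R + y)\<^sup>2 \<le> R\<^sup>2" if "p + x *\<^sub>R m + y *\<^sub>R n \<in> \<Omega>" for x y
  proof -
    have e: "p + x *\<^sub>R m + y *\<^sub>R n = x *\<^sub>R m + (R + y) *\<^sub>R n"
      by (simp add: pR algebra_simps)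
    have "(norm (x *\<^sub>R m + (R + y) *\<^sub>R n))\<^sup>2 \<le> R\<^sup>2"
      using far[OF that] unfolding e R_def[symmetric] by (rule power_mono) simp
    then show ?thesis
      by (simp only: frame_norm[OF fr])
  qed
  have nonpos: "y \<le> 0" if "p + x *\<^sub>R m + y *\<^sub>R n \<in> \<Omega>" for x y
  proof (rule ccontr)
    assume "\<not> y \<le> 0"
    then have "R\<^sup>2 < (R + y)\<^sup>2"
      using R0 by (intro power_strict_mono) auto
    then show False
      using outside[OF that] zero_le_power2[of x] by linarith
  qed
  obtain r h sg \<eta> where ch: "graph_chart \<Omega> p m n r h sg \<eta>"
  proof (rule graph_chart_cases[OF sb cl pF fr])
    \<comment> \<open>A graph over the outward direction would contain points of
      \<open>\<Omega>\<close> at height \<open>r / 2\<close> above the tangent.\<close>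
    fix r h sg \<eta> assume ch: "graph_chart \<Omega> p n m r h sg \<eta>"
    note c = graph_chartD[OF ch]
    have x: "\<bar>r / 2\<bar> < r"
      using c(2) by simp
    have "p + (r / 2) *\<^sub>R n + \<eta> (r / 2) *\<^sub>R m \<in> \<Omega>"
      using c(8)[OF x c(7)[OF x]] by simp
    then have "p + \<eta> (r / 2) *\<^sub>R m + (r / 2) *\<^sub>R n \<in> \<Omega>"
      by (simp add: algebra_simps)
    then have False
      using nonpos c(2) by fastforce
    then show thesis ..
  qed blast
  note c = graph_chartD[OF ch]
  have sg: "sg = 1"
  proof (rule ccontr)
    assume "sg \<noteq> 1"
    then have "p + 0 *\<^sub>R m + (h / 2) *\<^sub>R n \<in> \<Omega>"
      using c(8)[of 0 "h / 2"] c(2,3,4,6) by simp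
    then show False
      using nonpos c(3) by fastforce
  qed
  have "\<eta> x \<le> 0" if "\<bar>x\<bar> < r" for x
    using c(8)[OF that c(7)[OF that]] nonpos by simp
  then have "deriv \<eta> 0 = 0"
    using graph_chart_DERIV(1)[OF ch, of 0] c(2,6) by (intro DERIV_local_max[of \<eta> "deriv \<eta> 0" 0 r]) auto
  then have der: "(\<eta> has_real_derivative 0) (at 0)"
    using graph_chart_DERIV(1)[OF ch, of 0] c(2) by simp
  define \<sigma> where "\<sigma> = v \<bullet> n"
  define \<tau> where "\<tau> = v \<bullet> m"
  have \<sigma>: "\<sigma> > 0" "\<bar>\<sigma>\<bar> \<le> 1" "\<bar>\<tau>\<bar> \<le> 1"
    using v frame_coord_le[OF fr, of v] by (auto simp: \<sigma>_def \<tau>_def n_def)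
  have ve: "v = \<tau> *\<^sub>R m + \<sigma> *\<^sub>R n"
    unfolding \<sigma>_def \<tau>_def by (rule frame_expand[OF fr])
  \<comment> \<open>Half of the descent rate \<open>\<sigma>\<close> of the segment, so that the
    graph cannot sink as fast as the segment does.\<close>
  obtain d where d: "d > 0" "\<And>x. \<bar>x\<bar> < d \<Longrightarrow> \<bar>\<eta> x - 0 * x\<bar> \<le> (\<sigma> / 2) * \<bar>x\<bar>"
    by (rule DERIV_linear_bound[OF der c(6), of "\<sigma> / 2"]) (use \<sigma>(1) in auto)
  define T where "T = min d (min r h) / 2"
  have T: "T > 0" "T < d" "T < r" "T < h"
    using d(1) c(2,3) by (auto simp: T_def min_def)
  show thesis
  proof (rule that[OF T(1)])
    fix t :: real assume t: "0 < t" "t \<le> T"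
    define x where "x = - (t * \<tau>)"
    define y where "y = - (t * \<sigma>)"
    have x: "\<bar>x\<bar> \<le> t"
      using mult_left_mono[OF \<sigma>(3), of t] t(1) by (simp add: x_def abs_mult)
    have y: "\<bar>y\<bar> \<le> t"
      using mult_left_mono[OF \<sigma>(2), of t] t(1) by (simp add: y_def abs_mult)
    have "\<bar>\<eta> x\<bar> \<le> (\<sigma> / 2) * \<bar>x\<bar>"
      using d(2)[of x] x t(2) T(2) by simp
    also have "\<dots> \<le> (\<sigma> / 2) * t"
      using x \<sigma>(1) by (intro mult_left_mono) auto
    also have "\<dots> < t * \<sigma>"
      using t(1) \<sigma>(1) by simp
    finally have "sg * (y - \<eta> x) < 0"
      by (simp add: sg y_def)
    then have "p + x *\<^sub>R m + y *\<^sub>R n \<in> interior \<Omega>"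
      using x y t(2) T by (intro graph_chart_sides(1)[OF ch]) auto
    moreover have "p - t *\<^sub>R v = p + x *\<^sub>R m + y *\<^sub>R n"
      unfolding ve x_def y_def by (simp add: algebra_simps)
    ultimately show "p - t *\<^sub>R v \<in> interior \<Omega>"
      by (simp only:)
  qed
qed

text \<open>Lines perpendicular to \<open>p\<close> and close to the farthest point \<open>p\<close> meet \<open>\<Omega>\<close> only near \<open>p\<close>.\<close>

lemma farthest_point_not_pos:
  fixes G :: "plane \<Rightarrow> real"
  assumes \<Omega>: "compact \<Omega>" and p: "p \<in> closure (interior \<Omega>)" "\<And>y. y \<in> \<Omega> \<Longrightarrow> norm y \<le> norm p"
    and \<theta>: "unit_dir \<theta> = c *\<^sub>R p" and p0: "p \<noteq> 0"
    and G: "continuous_on UNIV G" and z: "\<And>s. line_integral s \<theta> (\<lambda>x. G x * indicator \<Omega> x) = 0"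
  shows "\<not> G p > 0"
proof
  assume Gp: "G p > 0"
  have "isCont (\<lambda>x. G x - G p / 2) p"
    using G by (auto simp: continuous_on_eq_continuous_at intro!: continuous_intros)
  then obtain \<delta> where \<delta>: "\<delta> > 0" "\<And>x. dist x p < \<delta> \<Longrightarrow> G x - G p / 2 > 0"
    by (rule isCont_pos_near) (use Gp in auto)
  \<comment> \<open>On \<open>\<Omega>\<close>, where \<open>norm x \<le> norm p\<close>, a value of
    \<open>x \<bullet> p\<close> above this threshold forces \<open>dist x p < \<delta>\<close>:
    expand the square of the distance. Moreover \<open>x \<bullet> p\<close> is constant on each
    line perpendicular to \<open>p\<close>.\<close>
  have isc: "isCont (\<lambda>x. x \<bullet> p - ((norm p)\<^sup>2 - \<delta>\<^sup>2 / 2)) p"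
    by (intro continuous_intros)
  obtain e where e: "e > 0" "\<And>x. dist x p < e \<Longrightarrow> x \<bullet> p - ((norm p)\<^sup>2 - \<delta>\<^sup>2 / 2) > 0"
    by (rule isCont_pos_near[OF isc]) (use \<delta>(1) in \<open>auto simp: power2_norm_eq_inner\<close>)
  \<comment> \<open>The line is taken through an interior point, so that it meets
    \<open>\<Omega>\<close> in positive length and a positive integrand shows in the
    integral.\<close>
  obtain x0 where x0: "x0 \<in> interior \<Omega>" "dist x0 p < e"
    using p(1) e(1) unfolding closure_approachable by blast
  define s where "s = x0 \<bullet> unit_dir \<theta>"
  define t0 where "t0 = x0 \<bullet> unit_dir (\<theta> + pi / 2)"
  have x0lp: "x0 = line_point \<theta> s t0"
    unfolding s_def t0_def by (rule line_point_eq)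
  have c0: "c \<noteq> 0"
    using \<theta> norm_unit_dir[of \<theta>] by auto
  have near: "dist x p < \<delta>" if x: "x \<in> \<Omega>" "x \<bullet> unit_dir \<theta> = s" for x
  proof -
    have "x \<bullet> p = x0 \<bullet> p"
      using x(2) c0 unfolding s_def \<theta> by simp
    then have gt: "x \<bullet> p > (norm p)\<^sup>2 - \<delta>\<^sup>2 / 2"
      using e(2)[OF x0(2)] by simp
    have "(norm x)\<^sup>2 \<le> (norm p)\<^sup>2"
      using p(2)[OF x(1)] by simp
    moreover have "(dist x p)\<^sup>2 = (norm x)\<^sup>2 + (norm p)\<^sup>2 - 2 * (x \<bullet> p)"
      unfolding dist_norm power2_norm_eq_inner by (simp add: inner_diff_left inner_diff_right inner_commute)
    ultimately have "(dist x p)\<^sup>2 < \<delta>\<^sup>2"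
      using gt by linarith
    then show ?thesis
      using \<delta>(1) by (simp add: power2_less_imp_less)
  qed
  obtain r where r: "r > 0" "ball x0 r \<subseteq> \<Omega>"
    using x0(1) by (meson mem_interior)
  let ?I = "{t0 - r / 2..t0 + r / 2}"
  have low: "G p / 2 * indicator ?I t \<le> G (line_point \<theta> s t) * indicator \<Omega> (line_point \<theta> s t)" for t
  proof (cases "line_point \<theta> s t \<in> \<Omega>")
    case True
    then have "G (line_point \<theta> s t) - G p / 2 > 0"
      using \<delta>(2)[OF near[OF True]] by (simp add: line_point_inner)
    then show ?thesis
      using True Gp by (simp add: indicator_def)
  next
    case False
    have "t \<notin> ?I"
    proof
      assume "t \<in> ?I"
      then have "\<bar>t0 - t\<bar> < r"
        using r(1) by auto
      then have "line_point \<theta> s t \<in> ball x0 r"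
        using dist_line_point[of \<theta> s t0 s t] by (simp add: x0lp)
      then show False
        using False r(2) by blast
    qed
    then have "indicator ?I t = (0::real)"
      by (rule indicator_simps(2))
    then show ?thesis
      using False by simp
  qed
  have i: "integrable lborel (\<lambda>t. G p / 2 * indicator ?I t)"
    by (intro integrable_mult_right integrable_indicator_bounded) auto
  have "(LINT t|lborel. G p / 2 * indicator ?I t)
      \<le> (LINT t|lborel. G (line_point \<theta> s t) * indicator \<Omega> (line_point \<theta> s t))"
    by (rule integral_mono[OF i integrable_line[OF G \<Omega>] low])
  then have "(LINT t|lborel. G p / 2 * indicator ?I t) \<le> 0"
    unfolding z[of s, unfolded line_integral_eq] .
  moreover have "(LINT t|lborel. G p / 2 * indicator ?I t) = G p / 2 * r"
    using r(1) by simp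
  ultimately have "G p / 2 * r \<le> 0"
    by (simp only:)
  then show False
    using mult_pos_pos[OF half_gt_zero[OF Gp] r(1)] by linarith
qed

lemma farthest_point_zero:
  fixes G :: "plane \<Rightarrow> real"
  assumes "compact \<Omega>" "p \<in> closure (interior \<Omega>)" "\<And>y. y \<in> \<Omega> \<Longrightarrow> norm y \<le> norm p"
    "unit_dir \<theta> = c *\<^sub>R p" "p \<noteq> 0"
    and G: "continuous_on UNIV G" and z: "\<And>s. line_integral s \<theta> (\<lambda>x. G x * indicator \<Omega> x) = 0"
  shows "G p = 0"
proof -
  have "line_integral s \<theta> (\<lambda>x. - G x * indicator \<Omega> x) = 0" for s
    using z[of s] by (simp add: line_integral_eq)
  then have "\<not> - G p > 0"
    using farthest_point_not_pos[OF assms(1-5), of "\<lambda>x. - G x"] G continuous_on_minus by blast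
  then show ?thesis
    using farthest_point_not_pos[OF assms(1-5) G z] by simp
qed

context
  fixes a b \<psi> \<epsilon> :: real and w :: "plane \<Rightarrow> real"
  assumes ab: "a > 0" "b > 0" and \<epsilon>: "\<epsilon> > 0"
    and w: "smooth_on UNIV w" "\<forall>x\<in>ball 0 1. w x > 0"
begin

text \<open>Taken for the density 1 on \<open>\<Omega>\<close>: by linearity of the V-line
  transform, the constant \<open>u\<close> becomes a factor in the exponent.\<close>

definition attenuation :: "plane set \<Rightarrow> real \<Rightarrow> plane \<Rightarrow> real" where
  "attenuation \<Omega> \<theta> x = smoothed_vline (disc_kernel \<epsilon>) a b \<psi> (indicator \<Omega>) x \<theta>"

text \<open>Defined on the whole plane and not only on \<open>\<Omega>\<close>, so that the
  integrand jumps across the boundary through the indicator alone.\<close>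

definition weight :: "plane set \<Rightarrow> real \<Rightarrow> real \<Rightarrow> plane \<Rightarrow> real" where
  "weight \<Omega> u \<theta> x = w x * u * exp (- (u * attenuation \<Omega> \<theta> x))"

lemma nonlinear_transform_eq:
  "nonlinear_transform (disc_kernel \<epsilon>) a b \<psi> c0 w (\<lambda>x. u * indicator \<Omega> x) s \<theta>
    = c0 * line_integral s \<theta> (\<lambda>x. weight \<Omega> u \<theta> x * indicator \<Omega> x)"
  unfolding nonlinear_transform_def smoothed_vline_scale weight_def attenuation_def
  by (simp add: mult_ac)

context
  fixes \<Omega> :: "plane set"
  assumes \<Omega>: "compact \<Omega>" "\<Omega> \<subseteq> ball 0 1"
begin

private lemma vline_facts:
  "(\<lambda>x. vline a b \<psi> (indicator \<Omega>) x \<theta>) \<in> borel_measurable borel"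
  "\<And>x. 0 \<le> vline a b \<psi> (indicator \<Omega>) x \<theta>" "\<And>x. vline a b \<psi> (indicator \<Omega>) x \<theta> \<le> 2 * (a + b)"
  using borel_measurable_vline_indicator[OF \<Omega>] vline_indicator_bounds[OF \<Omega> ab] by auto

lemma attenuation_nonneg: "0 \<le> attenuation \<Omega> \<theta> x"
  unfolding attenuation_def smoothed_vline_def
  by (rule convolve_nonneg[where M = "2 * (a + b)"]) (use vline_facts \<epsilon> in auto)

lemma attenuation_lipschitz:
  "\<bar>attenuation \<Omega> \<theta> x - attenuation \<Omega> \<theta> y\<bar> \<le> (4 * pi * (2 * (a + b)) / \<epsilon>) * dist x y"
  unfolding attenuation_def smoothed_vline_def
  by (rule convolve_lipschitz) (use vline_facts \<epsilon> in auto)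

lemma attenuation_le:
  assumes "\<And>y. y \<in> ball 0 \<epsilon> \<Longrightarrow> vline a b \<psi> (indicator \<Omega>) (x - y) \<theta> \<le> c"
  shows "attenuation \<Omega> \<theta> x \<le> pi * c"
  unfolding attenuation_def smoothed_vline_def
  by (rule convolve_le[where M = "2 * (a + b)"]) (use assms vline_facts \<epsilon> in auto)

lemma attenuation_ge:
  assumes "\<And>y. y \<in> ball 0 \<epsilon> \<Longrightarrow> c \<le> vline a b \<psi> (indicator \<Omega>) (x - y) \<theta>"
  shows "pi * c \<le> attenuation \<Omega> \<theta> x"
  unfolding attenuation_def smoothed_vline_def
  by (rule convolve_ge[where M = "2 * (a + b)"]) (use assms vline_facts \<epsilon> in auto)

lemma continuous_on_attenuation: "continuous_on UNIV (attenuation \<Omega> \<theta>)"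
proof -
  define L where "L = 4 * pi * (2 * (a + b)) / \<epsilon>"
  have "L \<ge> 0"
    using ab \<epsilon> by (simp add: L_def)
  then have "L-lipschitz_on UNIV (attenuation \<Omega> \<theta>)"
    using attenuation_lipschitz by (intro lipschitz_onI) (auto simp: L_def dist_real_def)
  then show ?thesis
    by (rule lipschitz_on_continuous_on)
qed

lemma continuous_on_weight: "continuous_on UNIV (weight \<Omega> u \<theta>)"
  unfolding weight_def
  by (intro continuous_intros continuous_on_attenuation smooth_on_imp_continuous_on[OF w(1)])

lemma weight_lower_bound:
  assumes "u > 0"
  obtains \<mu> where "\<mu> > 0" "\<And>x. x \<in> \<Omega> \<Longrightarrow> weight \<Omega> u \<theta> x \<ge> \<mu>"
proof (cases "\<Omega> = {}")
  case True
  then show thesis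
    using that[of 1] by simp
next
  case False
  have "continuous_on \<Omega> (weight \<Omega> u \<theta>)"
    using continuous_on_weight continuous_on_subset by blast
  then obtain x where x: "x \<in> \<Omega>" "\<And>y. y \<in> \<Omega> \<Longrightarrow> weight \<Omega> u \<theta> x \<le> weight \<Omega> u \<theta> y"
    using continuous_attains_inf[OF \<Omega>(1) False] by blast
  moreover have "weight \<Omega> u \<theta> x > 0"
    using w(2) x(1) \<Omega>(2) assms by (auto simp: weight_def)
  ultimately show thesis
    using that by blast
qed

lemma weight_lipschitz:
  assumes u: "u > 0"
  obtains L M where "L \<ge> 0" "M \<ge> 0"
    "\<And>x y. x \<in> ball 0 1 \<Longrightarrow> y \<in> ball 0 1 \<Longrightarrow> \<bar>weight \<Omega> u \<theta> x - weight \<Omega> u \<theta> y\<bar> \<le> L * dist x y"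
    "\<And>x. x \<in> ball 0 1 \<Longrightarrow> \<bar>weight \<Omega> u \<theta> x\<bar> \<le> M"
proof -
  obtain Lw where Lw: "Lw \<ge> 0" "\<And>x y. x \<in> cball 0 1 \<Longrightarrow> y \<in> cball 0 1 \<Longrightarrow> \<bar>w x - w y\<bar> \<le> Lw * dist x y"
    using smooth_on_lipschitz_ball[OF w(1)] by blast
  define Mw where "Mw = \<bar>w 0\<bar> + Lw"
  have Mw: "\<bar>w x\<bar> \<le> Mw" if "x \<in> ball 0 1" for x
  proof -
    have "\<bar>w x - w 0\<bar> \<le> Lw * dist x 0"
      by (rule Lw(2)) (use that in auto)
    also have "\<dots> \<le> Lw * 1"
      using that Lw(1) by (intro mult_left_mono) auto
    finally show ?thesis
      by (simp add: Mw_def)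
  qed
  have Mw0: "Mw \<ge> 0"
    using Lw(1) by (simp add: Mw_def)
  define La where "La = 4 * pi * (2 * (a + b)) / \<epsilon>"
  have La: "La \<ge> 0"
    using ab \<epsilon> by (simp add: La_def)
  define E where "E = (\<lambda>x. exp (- (u * attenuation \<Omega> \<theta> x)))"
  have E1: "0 \<le> E x" "E x \<le> 1" for x
    using attenuation_nonneg[of \<theta> x] u by (auto simp: E_def)
  have EL: "\<bar>E x - E y\<bar> \<le> u * La * dist x y" for x y
  proof -
    have "\<bar>E x - E y\<bar> \<le> \<bar>u * attenuation \<Omega> \<theta> x - u * attenuation \<Omega> \<theta> y\<bar>"
      unfolding E_def using attenuation_nonneg u by (intro abs_exp_minus_diff_le) auto
    also have "\<dots> = u * \<bar>attenuation \<Omega> \<theta> x - attenuation \<Omega> \<theta> y\<bar>"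
      using u by (simp add: abs_mult flip: right_diff_distrib)
    also have "\<dots> \<le> u * (La * dist x y)"
      using attenuation_lipschitz u unfolding La_def by (intro mult_left_mono) auto
    finally show ?thesis
      by (simp add: mult.assoc)
  qed
  have wt: "weight \<Omega> u \<theta> x = u * (w x * E x)" for x
    by (simp add: weight_def E_def)
  show thesis
  proof (rule that[of "u * (Lw + Mw * (u * La))" "u * Mw"])
    fix x y :: plane assume xy: "x \<in> ball 0 1" "y \<in> ball 0 1"
    have "w x * E x - w y * E y = (w x - w y) * E x + w y * (E x - E y)"
      by (simp add: algebra_simps)
    then have "\<bar>w x * E x - w y * E y\<bar> \<le> \<bar>w x - w y\<bar> * \<bar>E x\<bar> + \<bar>w y\<bar> * \<bar>E x - E y\<bar>"
      by (metis abs_mult abs_triangle_ineq)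
    also have "\<dots> \<le> (Lw * dist x y) * 1 + Mw * (u * La * dist x y)"
      using Lw(2)[of x y] xy E1[of x] Mw[OF xy(2)] EL Lw(1) Mw0
      by (intro add_mono mult_mono) auto
    finally have "u * \<bar>w x * E x - w y * E y\<bar> \<le> u * ((Lw * dist x y) * 1 + Mw * (u * La * dist x y))"
      using u by (intro mult_left_mono) auto
    also have "\<dots> = u * (Lw + Mw * (u * La)) * dist x y"
      by (simp add: algebra_simps)
    finally have "\<bar>u\<bar> * \<bar>w x * E x - w y * E y\<bar> \<le> u * (Lw + Mw * (u * La)) * dist x y"
      using u by simp
    then show "\<bar>weight \<Omega> u \<theta> x - weight \<Omega> u \<theta> y\<bar> \<le> u * (Lw + Mw * (u * La)) * dist x y"
      unfolding wt right_diff_distrib[of u, symmetric] abs_mult[of u] .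
  next
    fix x :: plane assume x: "x \<in> ball 0 1"
    have "\<bar>w x\<bar> * \<bar>E x\<bar> \<le> Mw * 1"
      using Mw[OF x] E1[of x] Mw0 by (intro mult_mono) auto
    then show "\<bar>weight \<Omega> u \<theta> x\<bar> \<le> u * Mw"
      using u by (simp add: wt abs_mult)
  qed (use u Lw Mw0 La in auto)
qed

end

text \<open>A line with a single tangency to one domain must be tangent to the other, since one and
  the same function of \<open>s\<close> cannot both satisfy and violate
  \<open>sym_lipschitz\<close>. The fact \<open>link\<close> is stated for arbitrary
  \<open>A\<close> and \<open>B\<close> because both directions are needed.\<close>

lemma same_domain:
  fixes \<Omega> \<Omega>' :: "plane set"
  assumes \<Omega>: "compact_smooth_domain \<Omega>" "\<Omega> \<subseteq> ball 0 1" "finite (degenerate_tangents \<Omega>)" "u > 0"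
    and \<Omega>': "compact_smooth_domain \<Omega>'" "\<Omega>' \<subseteq> ball 0 1" "finite (degenerate_tangents \<Omega>')" "u' > 0"
    and eq: "\<And>s \<theta>. line_integral s \<theta> (\<lambda>x. weight \<Omega> u \<theta> x * indicator \<Omega> x)
        = line_integral s \<theta> (\<lambda>x. weight \<Omega>' u' \<theta> x * indicator \<Omega>' x)"
  shows "\<Omega> = \<Omega>'"
proof -
  have d: "compact \<Omega>" "connected \<Omega>" "\<Omega> \<noteq> {}" "smooth_boundary \<Omega>"
    and d': "compact \<Omega>'" "connected \<Omega>'" "\<Omega>' \<noteq> {}" "smooth_boundary \<Omega>'"
    using \<Omega>(1) \<Omega>'(1) by (auto simp: compact_smooth_domain_def)
  have link: "tangency_set B s \<theta> \<noteq> {}"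
    if A: "compact A" "A \<subseteq> ball 0 1" "smooth_boundary A" "v > 0"
      and B: "compact B" "B \<subseteq> ball 0 1" "smooth_boundary B" "v' > 0"
      and AB: "\<And>s \<theta>. line_integral s \<theta> (\<lambda>x. weight A v \<theta> x * indicator A x)
        = line_integral s \<theta> (\<lambda>x. weight B v' \<theta> x * indicator B x)"
      and z: "tangency_set A s \<theta> = {z}"
    for A B :: "plane set" and v v' s \<theta> z
  proof
    assume e: "tangency_set B s \<theta> = {}"
    obtain L M where LM: "L \<ge> 0" "M \<ge> 0"
      "\<And>x y. x \<in> ball 0 1 \<Longrightarrow> y \<in> ball 0 1 \<Longrightarrow> \<bar>weight A v \<theta> x - weight A v \<theta> y\<bar> \<le> L * dist x y"
      "\<And>x. x \<in> ball 0 1 \<Longrightarrow> \<bar>weight A v \<theta> x\<bar> \<le> M"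
      using weight_lipschitz[OF A(1,2,4), where \<theta> = \<theta>] by blast
    obtain L' M' where LM': "L' \<ge> 0" "M' \<ge> 0"
      "\<And>x y. x \<in> ball 0 1 \<Longrightarrow> y \<in> ball 0 1 \<Longrightarrow> \<bar>weight B v' \<theta> x - weight B v' \<theta> y\<bar> \<le> L' * dist x y"
      "\<And>x. x \<in> ball 0 1 \<Longrightarrow> \<bar>weight B v' \<theta> x\<bar> \<le> M'"
      using weight_lipschitz[OF B(1,2,4), where \<theta> = \<theta>] by blast
    obtain \<mu> where \<mu>: "\<mu> > 0" "\<And>x. x \<in> A \<Longrightarrow> weight A v \<theta> x \<ge> \<mu>"
      using weight_lower_bound[OF A(1,2,4), where \<theta> = \<theta>] by blast
    have "sym_lipschitz (\<lambda>s. line_integral s \<theta> (\<lambda>x. weight B v' \<theta> x * indicator B x)) s"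
      by (rule transversal_sym_lipschitz[OF B(1-3) continuous_on_weight[OF B(1,2)] LM'(3,4,1,2) e])
    moreover have "\<not> sym_lipschitz (\<lambda>s. line_integral s \<theta> (\<lambda>x. weight A v \<theta> x * indicator A x)) s"
      by (rule tangent_not_sym_lipschitz[OF A(1-3) continuous_on_weight[OF A(1,2)] LM(3,4,1,2) z \<mu>])
    ultimately show False
      unfolding AB by simp
  qed
  have cv: "p + x *\<^sub>R m + \<eta> x *\<^sub>R n \<in> frontier \<Omega>'"
    if "graph_chart \<Omega> p m n r h sg \<eta>" "\<bar>x\<bar> < r" "deriv (deriv \<eta>) x \<noteq> 0" for p m n r h sg \<eta> x
    by (rule curved_in_frontier[OF that \<Omega>(3) _ d'(1,4)])
      (rule link[OF d(1) \<Omega>(2) d(4) \<Omega>(4) d'(1) \<Omega>'(2) d'(4) \<Omega>'(4) eq])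
  have cv': "p + x *\<^sub>R m + \<eta> x *\<^sub>R n \<in> frontier \<Omega>"
    if "graph_chart \<Omega>' p m n r h sg \<eta>" "\<bar>x\<bar> < r" "deriv (deriv \<eta>) x \<noteq> 0" for p m n r h sg \<eta> x
    by (rule curved_in_frontier[OF that \<Omega>'(3) _ d(1,4)])
      (rule link[OF d'(1) \<Omega>'(2) d'(4) \<Omega>'(4) d(1) \<Omega>(2) d(4) \<Omega>(4) eq[symmetric]])
  have "frontier \<Omega> \<subseteq> frontier \<Omega>'"
    by (rule frontier_subset_of_curved[OF d(1,4) d'(1,4)]) (erule (2) cv, erule (2) cv')
  moreover have "frontier \<Omega>' \<subseteq> frontier \<Omega>"
    by (rule frontier_subset_of_curved[OF d'(1,4) d(1,4)]) (erule (2) cv', erule (2) cv)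
  ultimately have fr: "frontier \<Omega> = frontier \<Omega>'"
    by (rule equalityI)
  show ?thesis
    by (rule equalityI) (rule domain_subset_of_frontier_eq[OF d d'(1,4) fr]
        domain_subset_of_frontier_eq[OF d' d(1,4) fr[symmetric]])+
qed


text \<open>At \<open>p\<close> the integral identity becomes
  \<open>u * exp (- u * A) = u' * exp (- u' * A)\<close>, and logarithms solve it for
  \<open>A\<close>. The result depends only on \<open>u\<close> and \<open>u'\<close>, and
  \<open>c\<close> may have either sign, so both orientations of the perpendicular lines must yield
  the same attenuation.\<close>

lemma attenuation_at_farthest_point:
  assumes \<Omega>: "compact \<Omega>" "\<Omega> \<subseteq> ball 0 1" and u: "u > 0" "u' > 0" "u \<noteq> u'"
    and p: "p \<in> \<Omega>" "p \<in> closure (interior \<Omega>)" "\<And>y. y \<in> \<Omega> \<Longrightarrow> norm y \<le> norm p"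
    and \<theta>: "unit_dir \<theta> = c *\<^sub>R p" and p0: "p \<noteq> 0"
    and eq: "\<And>s. line_integral s \<theta> (\<lambda>x. weight \<Omega> u \<theta> x * indicator \<Omega> x)
        = line_integral s \<theta> (\<lambda>x. weight \<Omega> u' \<theta> x * indicator \<Omega> x)"
  shows "attenuation \<Omega> \<theta> p = (ln u - ln u') / (u - u')"
proof -
  define G where "G = (\<lambda>x. weight \<Omega> u \<theta> x - weight \<Omega> u' \<theta> x)"
  define A where "A = attenuation \<Omega> \<theta> p"
  have "line_integral s \<theta> (\<lambda>x. G x * indicator \<Omega> x) = 0" for s
    using eq[of s] Bochner_Integration.integral_diff[OF
        integrable_line[OF continuous_on_weight[OF \<Omega>] \<Omega>(1)] integrable_line[OF continuous_on_weight[OF \<Omega>] \<Omega>(1)],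
        of u \<theta> \<theta> s u' \<theta> \<theta> s]
    by (simp add: line_integral_eq G_def left_diff_distrib)
  moreover have "continuous_on UNIV G"
    unfolding G_def by (intro continuous_intros continuous_on_weight[OF \<Omega>])
  ultimately have "G p = 0"
    using farthest_point_zero[OF \<Omega>(1) p(2,3) \<theta> p0] by blast
  moreover have "w p > 0"
    using w(2) p(1) \<Omega>(2) by blast
  ultimately have "u * exp (- (u * A)) = u' * exp (- (u' * A))"
    by (simp add: G_def weight_def A_def)
  then have "ln (u * exp (- (u * A))) = ln (u' * exp (- (u' * A)))"
    by simp
  then have "ln u - u * A = ln u' - u' * A"
    using u by (simp add: ln_mult)
  then have "A * (u - u') = ln u - ln u'"
    by (simp add: algebra_simps)
  then show ?thesis
    using u(3) by (simp add: A_def field_simps)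
qed

text \<open>At the farthest point \<open>p\<close> with outward direction \<open>\<theta>\<close>, both rays leave \<open>\<Omega>\<close> after a length that
  tends to 0 with \<open>\<epsilon>\<close>; for the opposite direction the first ray enters \<open>\<Omega>\<close>.\<close>

lemma attenuation_opposite_directions:
  assumes \<Omega>: "compact \<Omega>" "\<Omega> \<subseteq> ball 0 1" and far: "\<And>y. y \<in> \<Omega> \<Longrightarrow> norm y \<le> norm p"
    and \<theta>: "p = norm p *\<^sub>R unit_dir \<theta>" and \<psi>: "0 < 2 * \<psi>" "2 * \<psi> < pi"
    and \<epsilon>p: "\<epsilon> \<le> norm p" and c: "0 \<le> c" "0 \<le> l"
    and inward: "\<And>y t. y \<in> ball 0 \<epsilon> \<Longrightarrow> c \<le> t \<Longrightarrow> t \<le> c + l \<Longrightarrow>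
      p - y - t *\<^sub>R unit_dir (\<theta> + 2 * \<psi> - pi / 2) \<in> \<Omega>"
    and small: "(a + b) * (\<epsilon> + sqrt (2 * norm p * \<epsilon>)) < a * l"
  shows "attenuation \<Omega> \<theta> p < attenuation \<Omega> (\<theta> + pi) p"
proof -
  define R where "R = norm p"
  \<comment> \<open>A ray that starts at \<open>p - y\<close> with
    \<open>norm y < \<epsilon>\<close>, does not point inward at \<open>p\<close>, and is at time
    \<open>t\<close> in the disc of radius \<open>R\<close> satisfies
    \<open>(R - \<epsilon>)^2 - 2 * t * \<epsilon> + t^2 \<le> R^2\<close>, that is
    \<open>(t - \<epsilon>)^2 \<le> 2 * R * \<epsilon>\<close>.\<close>
  define l0 where "l0 = \<epsilon> + sqrt (2 * R * \<epsilon>)"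
  have R: "\<epsilon> \<le> R" "R \<ge> 0"
    using \<epsilon>p by (auto simp: R_def)
  have l0: "l0 \<ge> 0"
    using R \<epsilon> by (simp add: l0_def)
  have short: "ray_length \<Omega> v (p - y) \<le> l0"
    if y: "y \<in> ball 0 \<epsilon>" and v: "norm v = 1" "v \<bullet> unit_dir \<theta> \<ge> 0" for y v
  proof (rule ray_length_le[OF \<Omega> v(1), where c = 0])
    fix t :: real assume t: "0 \<le> t" "p - y + t *\<^sub>R v \<in> \<Omega>"
    have ny: "norm y < \<epsilon>"
      using y by simp
    have "(norm (p - y + t *\<^sub>R v))\<^sup>2 \<le> R\<^sup>2"
      using far[OF t(2)] by (simp add: R_def)
    moreover have "(norm (p - y + t *\<^sub>R v))\<^sup>2 = (norm (p - y))\<^sup>2 + 2 * t * ((p - y) \<bullet> v) + t\<^sup>2"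
      using v(1) unfolding power2_norm_eq_inner
      by (simp add: inner_add_left inner_add_right inner_commute power2_eq_square norm_eq_1)
    moreover have "(R - \<epsilon>)\<^sup>2 \<le> (norm (p - y))\<^sup>2"
      using norm_triangle_ineq2[of p y] ny R(1) by (intro power_mono) (auto simp: R_def)
    moreover have "2 * t * ((p - y) \<bullet> v) \<ge> - (2 * t * \<epsilon>)"
    proof -
      have "p \<bullet> v = norm p * (unit_dir \<theta> \<bullet> v)"
        by (subst \<theta>) (rule inner_scaleR_left)
      then have "p \<bullet> v \<ge> 0"
        using v(2) by (simp add: inner_commute)
      moreover have "y \<bullet> v \<le> norm y"
        using norm_cauchy_schwarz[of y v] v(1) by simp
      ultimately have "- \<epsilon> \<le> (p - y) \<bullet> v"
        using ny by (simp add: inner_diff_left)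
      then have "2 * t * (- \<epsilon>) \<le> 2 * t * ((p - y) \<bullet> v)"
        using t(1) by (intro mult_left_mono) auto
      then show ?thesis
        by simp
    qed
    moreover have "(t - \<epsilon>)\<^sup>2 = t\<^sup>2 - 2 * t * \<epsilon> + \<epsilon>\<^sup>2" "(R - \<epsilon>)\<^sup>2 = R\<^sup>2 - 2 * R * \<epsilon> + \<epsilon>\<^sup>2"
      by (simp_all add: power2_eq_square algebra_simps)
    ultimately have "(t - \<epsilon>)\<^sup>2 \<le> 2 * R * \<epsilon>"
      by linarith
    then have "t - \<epsilon> \<le> sqrt (2 * R * \<epsilon>)"
      by (rule real_le_rsqrt)
    then show "0 \<le> t \<and> t \<le> 0 + l0"
      using t(1) by (simp add: l0_def)
  qed (rule l0)
  define v where "v = unit_dir (\<theta> + 2 * \<psi> - pi / 2)"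
  define v' where "v' = unit_dir (\<theta> - pi / 2)"
  have vn: "norm v = 1" "norm v' = 1"
    by (auto simp: v_def v'_def)
  \<comment> \<open>As \<open>2 * \<psi>\<close> lies between 0 and \<open>pi\<close>, the first ray
    points outward and the second along the tangent at \<open>p\<close>. For
    \<open>\<theta> + pi\<close> both are reversed: the first ray enters \<open>\<Omega>\<close>,
    and the second contributes at least 0.\<close>
  have "v \<bullet> unit_dir \<theta> = sin (2 * \<psi>)" "v' \<bullet> unit_dir \<theta> = 0"
    by (auto simp: v_def v'_def unit_dir_inner cos_diff)
  then have vd: "v \<bullet> unit_dir \<theta> \<ge> 0" "v' \<bullet> unit_dir \<theta> \<ge> 0"
    using \<psi> sin_gt_zero[of "2 * \<psi>"] by auto
  have "attenuation \<Omega> \<theta> p \<le> pi * ((a + b) * l0)"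
  proof (rule attenuation_le[OF \<Omega>])
    fix y :: plane assume y: "y \<in> ball 0 \<epsilon>"
    have "vline a b \<psi> (indicator \<Omega>) (p - y) \<theta> \<le> a * l0 + b * l0"
      unfolding vline_indicator[OF \<Omega>] v_def[symmetric] v'_def[symmetric]
      using short[OF y vn(1) vd(1)] short[OF y vn(2) vd(2)] ab by (intro add_mono mult_left_mono) auto
    then show "vline a b \<psi> (indicator \<Omega>) (p - y) \<theta> \<le> (a + b) * l0"
      by (simp add: algebra_simps)
  qed
  also have "\<dots> < pi * (a * l)"
    using small by (simp add: l0_def R_def)
  also have "\<dots> \<le> attenuation \<Omega> (\<theta> + pi) p"
  proof (rule attenuation_ge[OF \<Omega>])
    fix y :: plane assume y: "y \<in> ball 0 \<epsilon>"
    have "unit_dir (\<theta> + pi + 2 * \<psi> - pi / 2) = - v"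
      using unit_dir_add_pi[of "\<theta> + 2 * \<psi> - pi / 2"] by (simp add: v_def algebra_simps)
    moreover have "l \<le> ray_length \<Omega> (- v) (p - y)"
      using inward[OF y] vn(1) c by (intro ray_length_ge[OF \<Omega>, where c = c]) (auto simp: v_def)
    ultimately have "a * l \<le> a * ray_length \<Omega> (unit_dir (\<theta> + pi + 2 * \<psi> - pi / 2)) (p - y)"
      using ab by simp
    moreover have "0 \<le> b * ray_length \<Omega> (unit_dir (\<theta> + pi - pi / 2)) (p - y)"
      using ab ray_length_nonneg[OF \<Omega>] by simp
    ultimately show "a * l \<le> vline a b \<psi> (indicator \<Omega>) (p - y) (\<theta> + pi)"
      unfolding vline_indicator[OF \<Omega>] by linarith
  qed
  finally show ?thesis .
qed

end

theorem corollary4p18: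
  fixes a b \<psi> c0 :: real and w f :: "plane \<Rightarrow> real"
  assumes "a > 0" and "b > 0" and "0 < 2 * \<psi>" and "2 * \<psi> < pi" and "c0 > 0"
    and "smooth_on UNIV w" and "\<forall>x\<in>ball 0 1. w x > 0"
    and "f \<in> admissible_densities"
  shows "\<exists>\<epsilon>\<^sub>0>0. \<forall>\<epsilon>. 0 < \<epsilon> \<and> \<epsilon> < \<epsilon>\<^sub>0 \<longrightarrow>
           (\<forall>g\<in>admissible_densities.
              (\<forall>s \<theta>. nonlinear_transform (disc_kernel \<epsilon>) a b \<psi> c0 w g s \<theta> =
                     nonlinear_transform (disc_kernel \<epsilon>) a b \<psi> c0 w f s \<theta>) \<longrightarrow> g = f)"
proof -
  from assms(8) obtain \<Omega> u where \<Omega>: "compact_smooth_domain \<Omega>" "\<Omega> \<subseteq> ball 0 1"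
      "finite (degenerate_tangents \<Omega>)" "u > 0" and f: "f = (\<lambda>x. u * indicator \<Omega> x)"
    unfolding admissible_densities_def by blast
  have d: "compact \<Omega>" "\<Omega> \<noteq> {}" "smooth_boundary \<Omega>"
    using \<Omega>(1) by (auto simp: compact_smooth_domain_def)
  have cl: "closed \<Omega>"
    using d(1) by (rule compact_imp_closed)
  obtain p where p: "p \<in> \<Omega>" "\<And>y. y \<in> \<Omega> \<Longrightarrow> norm y \<le> norm p"
    using continuous_attains_sup[OF d(1,2), of norm] continuous_on_norm_id by blast
  have pi: "p \<notin> interior \<Omega>"
    using farthest_not_interior p(2) by blast
  have pF: "p \<in> frontier \<Omega>"
    using p(1) pi closure_subset by (auto simp: frontier_def)
  obtain m n r h sg \<eta> where ch: "graph_chart \<Omega> p m n r h sg \<eta>"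
    by (rule graph_chart_ex[OF d(3) cl pF])
  have pcl: "p \<in> closure (interior \<Omega>)"
  proof -
    obtain e where e: "e > 0" "ball p e \<inter> \<Omega> \<subseteq> closure (interior \<Omega> \<inter> interior \<Omega>)"
      by (rule same_side_closure[OF ch ch])
    then show ?thesis
      using p(1) by auto
  qed
  have p0: "p \<noteq> 0"
  proof
    assume "p = 0"
    then have "\<Omega> \<subseteq> {p}"
      using p(2) by auto
    then have "interior \<Omega> \<subseteq> {p}"
      using interior_subset by blast
    then show False
      using pi pcl by (auto dest: subset_singletonD)
  qed
  define R where "R = norm p"
  have R: "R > 0"
    using p0 by (simp add: R_def)
  obtain \<theta> where \<theta>: "unit_dir \<theta> = p /\<^sub>R R"
    by (rule ex_unit_dir[of "p /\<^sub>R R"]) (use R in \<open>auto simp: R_def\<close>)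
  have p\<theta>: "p = norm p *\<^sub>R unit_dir \<theta>"
    using \<theta> R by (simp add: R_def)
  define v where "v = unit_dir (\<theta> + 2 * \<psi> - pi / 2)"
  have v: "norm v = 1" "v \<bullet> unit_dir \<theta> > 0"
    using assms(3,4) sin_gt_zero[of "2 * \<psi>"] by (auto simp: v_def unit_dir_inner cos_diff)
  obtain T where T: "T > 0" "\<And>t. 0 < t \<Longrightarrow> t \<le> T \<Longrightarrow> p - t *\<^sub>R v \<in> interior \<Omega>"
    using inward_segment[OF cl d(3) pF p(2) p\<theta> v] by blast
  \<comment> \<open>The half of the segment away from \<open>p\<close> is compact inside the
    interior, so it stays in \<open>\<Omega>\<close> under every displacement shorter than
    \<open>\<epsilon>1\<close>, in particular under all those of the disc kernel.\<close>
  define S where "S = (\<lambda>t. p - t *\<^sub>R v) ` {T/2..T/2 + T/2}"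
  have "compact S"
    unfolding S_def by (intro compact_continuous_image continuous_intros) auto
  moreover have "S \<subseteq> interior \<Omega>"
    using T by (auto simp: S_def)
  ultimately obtain \<epsilon>1 where \<epsilon>1: "\<epsilon>1 > 0" "(\<Union>x\<in>S. ball x \<epsilon>1) \<subseteq> interior \<Omega>"
    using compact_subset_open_imp_ball_epsilon_subset[OF _ open_interior] by blast
  \<comment> \<open>At \<open>\<epsilon> = 0\<close> this is \<open>a * (T/2) > 0\<close>, and
    positivity persists nearby. It weighs the inward ray, with length at least \<open>T/2\<close> in
    \<open>\<Omega>\<close>, against the bound for the two rays that do not point inward.\<close>
  have "isCont (\<lambda>\<epsilon>. a * (T/2) - (a + b) * (\<epsilon> + sqrt (2 * R * \<epsilon>))) 0"
    by (intro continuous_intros)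
  then obtain \<epsilon>2 where \<epsilon>2: "\<epsilon>2 > 0"
      "\<And>\<epsilon>. dist \<epsilon> 0 < \<epsilon>2 \<Longrightarrow> a * (T/2) - (a + b) * (\<epsilon> + sqrt (2 * R * \<epsilon>)) > 0"
    by (rule isCont_pos_near) (use assms(1) T(1) in auto)
  show ?thesis
  \<comment> \<open>The bound involves only \<open>\<Omega>\<close> and the data, so it precedes
    \<open>g\<close>. The entry \<open>R\<close> keeps \<open>\<epsilon>\<close> below
    \<open>norm p\<close>, as the length estimate for outward rays requires.\<close>
  proof (intro exI[of _ "min (min \<epsilon>1 \<epsilon>2) R"] conjI allI impI ballI)
    show "0 < min (min \<epsilon>1 \<epsilon>2) R"
      using \<epsilon>1 \<epsilon>2 R by simp
    fix \<epsilon> g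
    assume "0 < \<epsilon> \<and> \<epsilon> < min (min \<epsilon>1 \<epsilon>2) R"
    then have \<epsilon>: "0 < \<epsilon>" "\<epsilon> < \<epsilon>1" "\<epsilon> < \<epsilon>2" "\<epsilon> < R"
      by auto
    assume "g \<in> admissible_densities"
    then obtain \<Omega>' u' where \<Omega>': "compact_smooth_domain \<Omega>'" "\<Omega>' \<subseteq> ball 0 1"
        "finite (degenerate_tangents \<Omega>')" "u' > 0" and g: "g = (\<lambda>x. u' * indicator \<Omega>' x)"
      unfolding admissible_densities_def by blast
    assume eq: "\<forall>s \<theta>. nonlinear_transform (disc_kernel \<epsilon>) a b \<psi> c0 w g s \<theta> =
      nonlinear_transform (disc_kernel \<epsilon>) a b \<psi> c0 w f s \<theta>"
    note ctxt = assms(1,2) \<epsilon>(1) assms(6,7)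
    let ?W = "weight a b \<psi> \<epsilon> w"
    have eqW: "line_integral s \<theta> (\<lambda>x. ?W \<Omega> u \<theta> x * indicator \<Omega> x)
        = line_integral s \<theta> (\<lambda>x. ?W \<Omega>' u' \<theta> x * indicator \<Omega>' x)" for s \<theta>
      using eq[rule_format, of s \<theta>] assms(5)
      unfolding f g nonlinear_transform_eq[OF ctxt] by simp
    have dom: "\<Omega> = \<Omega>'"
      by (rule same_domain[OF ctxt \<Omega> \<Omega>' eqW])
    have "u = u'"
    proof (rule ccontr)
      assume u: "u \<noteq> u'"
      have att: "attenuation a b \<psi> \<epsilon> \<Omega> \<alpha> p = (ln u - ln u') / (u - u')"
        if "unit_dir \<alpha> = c *\<^sub>R p" for \<alpha> c
        by (rule attenuation_at_farthest_point[OF ctxt d(1) \<Omega>(2,4) \<Omega>'(4) u p(1) pcl p(2) that p0])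
          (use eqW dom in auto)
      \<comment> \<open>Both orientations are multiples of \<open>p\<close>, with factors of
        opposite sign, so \<open>att\<close> equates the two attenuations that differ by the choice
        of \<open>\<epsilon>\<close>.\<close>
      have "unit_dir \<theta> = (1 / R) *\<^sub>R p" "unit_dir (\<theta> + pi) = (- 1 / R) *\<^sub>R p"
        unfolding unit_dir_add_pi \<theta> by (simp_all add: divide_inverse)
      then have "attenuation a b \<psi> \<epsilon> \<Omega> \<theta> p = attenuation a b \<psi> \<epsilon> \<Omega> (\<theta> + pi) p"
        using att by metis
      moreover have "attenuation a b \<psi> \<epsilon> \<Omega> \<theta> p < attenuation a b \<psi> \<epsilon> \<Omega> (\<theta> + pi) p"
      proof (rule attenuation_opposite_directions[OF ctxt d(1) \<Omega>(2) p(2) p\<theta> assms(3,4), where c = "T/2" and l = "T/2"])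
        show "\<epsilon> \<le> norm p" "0 \<le> T/2" "0 \<le> T/2"
          using \<epsilon>(4) T(1) by (auto simp: R_def)
        show "(a + b) * (\<epsilon> + sqrt (2 * norm p * \<epsilon>)) < a * (T/2)"
          using \<epsilon>2(2)[of \<epsilon>] \<epsilon>(1,3) by (simp add: R_def)
        fix y :: plane and t :: real
        assume y: "y \<in> ball 0 \<epsilon>" and t: "T/2 \<le> t" "t \<le> T/2 + T/2"
        have "p - t *\<^sub>R v \<in> S"
          using t by (auto simp: S_def)
        moreover have "p - y - t *\<^sub>R v \<in> ball (p - t *\<^sub>R v) \<epsilon>1"
          using y \<epsilon>(2) by (simp add: dist_norm)
        ultimately show "p - y - t *\<^sub>R unit_dir (\<theta> + 2 * \<psi> - pi / 2) \<in> \<Omega>"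
          using \<epsilon>1(2) interior_subset unfolding v_def[symmetric] by blast
      qed
      ultimately show False
        by simp
    qed
    with dom show "g = f"
      by (simp add: f g)
  qed
qed

end
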